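(* Over $\mathsf{RCA}_0$: if a quasi order $Q$ is $\Delta^0_2\text{-}\mathsf{BQO}$, then $T_f^w(Q)$ is $\mathsf{BQO}$.
   Context: $T_f(Q)$ is the set of finite ordered $Q$-labelled trees, generated by: for $q\in Q$ and previously constructed $b_0,\dots,b_{n-1}$ ($n\geq0$), $q\star\langle b_0,\dots,b_{n-1}\rangle\in T_f(Q)$. For $a=p\star\langle a_0,\dots,a_{m-1}\rangle$ and $b=q\star\langle b_0,\dots,b_{n-1}\rangle$, define recursively $a\leq^w b$ iff either ($p\leq_Q q$ and $a_i\leq^w b$ for all $i<m$) or $a\leq^w b_j$ for some $j<n$; $T^w_f(Q)$ is $T_f(Q)$ with $\leq^w$. Finite subsets of $\mathbb N$ are identified with increasing enumerations; $s\vartriangleleft t$ means there is an infinite $X\subseteq\mathbb N$ with $s$ an initial segment of $X$ and $t$ an initial segment of $X$ minus its least element. A block is a set $B$ of finite subsets of $\mathbb N$ whose base $\bigcup B$ is infinite, such that every infinite $X\subseteq\bigcup B$ has an initial segment in $B$ and no element of $B$ is a proper initial segment of another; a barrier is a block with no element a proper subset of another. A quasi order $P$ is $\mathsf{BQO}$ if for every barrier $B$ and $f:B\to P$ there are $s\vartriangleleft t$ in $B$ with $f(s)\leq f(t)$. For $X\in[\mathbb N]^\omega$ (infinite subsets), $X^-$ is $X$ without its least element; $F:[\mathbb N]^\omega\to Q$ is bad if no $X$ has $F(X)\leq_Q F(X^-)$; a $\Delta^0_2$-function is one whose graph $F(X)=q$ is defined by a $\Sigma^0_2$-formula (with parameters)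 defining a total function; $Q$ is $\Delta^0_2\text{-}\mathsf{BQO}$ if there is no bad $\Delta^0_2$-function $[\mathbb N]^\omega\to Q$. *)

theory Defs
  imports Main
begin

text \<open>
  The base theory is \<open>RCA\<^sub>0\<close>, and ``over \<open>RCA\<^sub>0\<close>'' is read as ``in every model of \<open>RCA\<^sub>0\<close>''
  (equivalent to provability by the completeness theorem).
  Models are arbitrary (possibly nonstandard, possibly not omega-models) structures for the
  language of second order arithmetic. All notions below are interpreted inside such a
  structure \<open>M\<close>: number quantifiers range over the carrier \<open>'a\<close>, set quantifiers over \<open>sets2 M\<close>.
\<close>

record 'a L2_structure =
  zero2 :: 'a
  one2 :: 'a
  add2 :: "'a \<Rightarrow> 'a \<Rightarrow> 'a"
  mul2 :: "'a \<Rightarrow> 'a \<Rightarrow> 'a"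
  lt2 :: "'a \<Rightarrow> 'a \<Rightarrow> bool"
  sets2 :: "'a set set"

datatype L2_term =
  TVar nat | TZero | TOne | TAdd L2_term L2_term | TMul L2_term L2_term

text \<open>Number variables and set variables are two separate sorts, both named by \<open>nat\<close>.\<close>

datatype L2_form =
  FEq L2_term L2_term
| FLt L2_term L2_term
| FMem L2_term nat
| FNeg L2_form
| FAnd L2_form L2_form
| FOr L2_form L2_form
| FImp L2_form L2_form
| FAll nat L2_form
| FEx nat L2_form
| FAllSet nat L2_form
| FExSet nat L2_form

fun tvars :: "L2_term \<Rightarrow> nat set" where
  "tvars (TVar i) = {i}"
| "tvars TZero = {}"
| "tvars TOne = {}"
| "tvars (TAdd s t) = tvars s \<union> tvars t"
| "tvars (TMul s t) = tvars s \<union> tvars t"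

fun tval :: "'a L2_structure \<Rightarrow> (nat \<Rightarrow> 'a) \<Rightarrow> L2_term \<Rightarrow> 'a" where
  "tval M e (TVar i) = e i"
| "tval M e TZero = zero2 M"
| "tval M e TOne = one2 M"
| "tval M e (TAdd s t) = add2 M (tval M e s) (tval M e t)"
| "tval M e (TMul s t) = mul2 M (tval M e s) (tval M e t)"

fun sat :: "'a L2_structure \<Rightarrow> (nat \<Rightarrow> 'a) \<Rightarrow> (nat \<Rightarrow> 'a set) \<Rightarrow> L2_form \<Rightarrow> bool" where
  "sat M e E (FEq s t) \<longleftrightarrow> tval M e s = tval M e t"
| "sat M e E (FLt s t) \<longleftrightarrow> lt2 M (tval M e s) (tval M e t)"
| "sat M e E (FMem t U) \<longleftrightarrow> tval M e t \<in> E U"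
| "sat M e E (FNeg \<phi>) \<longleftrightarrow> \<not> sat M e E \<phi>"
| "sat M e E (FAnd \<phi> \<psi>) \<longleftrightarrow> sat M e E \<phi> \<and> sat M e E \<psi>"
| "sat M e E (FOr \<phi> \<psi>) \<longleftrightarrow> sat M e E \<phi> \<or> sat M e E \<psi>"
| "sat M e E (FImp \<phi> \<psi>) \<longleftrightarrow> (sat M e E \<phi> \<longrightarrow> sat M e E \<psi>)"
| "sat M e E (FAll x \<phi>) \<longleftrightarrow> (\<forall>a. sat M (e(x := a)) E \<phi>)"
| "sat M e E (FEx x \<phi>) \<longleftrightarrow> (\<exists>a. sat M (e(x := a)) E \<phi>)"
| "sat M e E (FAllSet U \<phi>) \<longleftrightarrow> (\<forall>A\<in>sets2 M. sat M e (E(U := A)) \<phi>)"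
| "sat M e E (FExSet U \<phi>) \<longleftrightarrow> (\<exists>A\<in>sets2 M. sat M e (E(U := A)) \<phi>)"

inductive bounded_form :: "L2_form \<Rightarrow> bool" where
  "bounded_form (FEq s t)"
| "bounded_form (FLt s t)"
| "bounded_form (FMem t U)"
| "bounded_form \<phi> \<Longrightarrow> bounded_form (FNeg \<phi>)"
| "bounded_form \<phi> \<Longrightarrow> bounded_form \<psi> \<Longrightarrow> bounded_form (FAnd \<phi> \<psi>)"
| "bounded_form \<phi> \<Longrightarrow> bounded_form \<psi> \<Longrightarrow> bounded_form (FOr \<phi> \<psi>)"
| "bounded_form \<phi> \<Longrightarrow> bounded_form \<psi> \<Longrightarrow> bounded_form (FImp \<phi> \<psi>)"
| "bounded_form \<phi> \<Longrightarrow> x \<notin> tvars t \<Longrightarrow> bounded_form (FAll x (FImp (FLt (TVar x) t) \<phi>))"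
| "bounded_form \<phi> \<Longrightarrow> x \<notin> tvars t \<Longrightarrow> bounded_form (FEx x (FAnd (FLt (TVar x) t) \<phi>))"

definition Sigma01 :: "L2_form \<Rightarrow> bool" where
  "Sigma01 \<phi> \<longleftrightarrow> (\<exists>x \<theta>. bounded_form \<theta> \<and> \<phi> = FEx x \<theta>)"

definition Pi01 :: "L2_form \<Rightarrow> bool" where
  "Pi01 \<phi> \<longleftrightarrow> (\<exists>x \<theta>. bounded_form \<theta> \<and> \<phi> = FAll x \<theta>)"

definition Sigma02 :: "L2_form \<Rightarrow> bool" where
  "Sigma02 \<phi> \<longleftrightarrow> (\<exists>x y \<theta>. bounded_form \<theta> \<and> \<phi> = FEx x (FAll y \<theta>))"

definition L2_basic_axioms :: "'a L2_structure \<Rightarrow> bool" where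
  "L2_basic_axioms M \<longleftrightarrow>
     (\<forall>n. add2 M n (one2 M) \<noteq> zero2 M) \<and>
     (\<forall>m n. add2 M m (one2 M) = add2 M n (one2 M) \<longrightarrow> m = n) \<and>
     (\<forall>m. add2 M m (zero2 M) = m) \<and>
     (\<forall>m n. add2 M m (add2 M n (one2 M)) = add2 M (add2 M m n) (one2 M)) \<and>
     (\<forall>m. mul2 M m (zero2 M) = zero2 M) \<and>
     (\<forall>m n. mul2 M m (add2 M n (one2 M)) = add2 M (mul2 M m n) m) \<and>
     (\<forall>m. \<not> lt2 M m (zero2 M)) \<and>
     (\<forall>m n. lt2 M m (add2 M n (one2 M)) \<longleftrightarrow> lt2 M m n \<or> m = n)"

text \<open>The assignments \<open>e\<close> and \<open>E\<close> supply the number and set parameters of the schemes.\<close>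

definition Sigma01_induction :: "'a L2_structure \<Rightarrow> bool" where
  "Sigma01_induction M \<longleftrightarrow>
     (\<forall>\<phi> x e E. Sigma01 \<phi> \<and> range E \<subseteq> sets2 M \<and>
        sat M (e(x := zero2 M)) E \<phi> \<and>
        (\<forall>n. sat M (e(x := n)) E \<phi> \<longrightarrow> sat M (e(x := add2 M n (one2 M))) E \<phi>) \<longrightarrow>
        (\<forall>n. sat M (e(x := n)) E \<phi>))"

definition Delta01_comprehension :: "'a L2_structure \<Rightarrow> bool" where
  "Delta01_comprehension M \<longleftrightarrow>
     (\<forall>\<phi> \<psi> x e E. Sigma01 \<phi> \<and> Pi01 \<psi> \<and> range E \<subseteq> sets2 M \<and>
        (\<forall>n. sat M (e(x := n)) E \<phi> \<longleftrightarrow> sat M (e(x := n)) E \<psi>) \<longrightarrow>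
        (\<exists>A\<in>sets2 M. \<forall>n. n \<in> A \<longleftrightarrow> sat M (e(x := n)) E \<phi>))"

definition RCA0_model :: "'a L2_structure \<Rightarrow> bool" where
  "RCA0_model M \<longleftrightarrow> sets2 M \<noteq> {} \<and> L2_basic_axioms M \<and> Sigma01_induction M \<and>
     Delta01_comprehension M"

text \<open>
  Simpson's coding: \<open>(i, j)\<close> is \<open>(i + j)\<^sup>2 + i\<close>, and \<open>(k, (m, n))\<close> represents the finite
  set of all \<open>i < k\<close> such that \<open>m(i + 1) + 1\<close> divides \<open>n\<close>. The code of a finite set is the
  least number that represents it. Numbers not of the form \<open>(k, (m, n))\<close> are assigned the
  empty set, which already has the code \<open>0 = (0, (0, 0))\<close>, so they are never codes.
\<close>

definition pair2 :: "'a L2_structure \<Rightarrow> 'a \<Rightarrow> 'a \<Rightarrow> 'a" where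
  "pair2 M i j = add2 M (mul2 M (add2 M i j) (add2 M i j)) i"

definition fset2 :: "'a L2_structure \<Rightarrow> 'a \<Rightarrow> 'a set" where
  "fset2 M c = {i. \<exists>k m n d. c = pair2 M k (pair2 M m n) \<and> lt2 M i k \<and>
     n = mul2 M (add2 M (mul2 M m (add2 M i (one2 M))) (one2 M)) d}"

definition fset_code :: "'a L2_structure \<Rightarrow> 'a \<Rightarrow> bool" where
  "fset_code M c \<longleftrightarrow> (\<forall>d. lt2 M d c \<longrightarrow> fset2 M d \<noteq> fset2 M c)"

text \<open>A finite sequence of length \<open>n\<close> is (the code of) a finite function with domain \<open>{i. i < n}\<close>.\<close>

definition entry2 :: "'a L2_structure \<Rightarrow> 'a \<Rightarrow> 'a \<Rightarrow> 'a \<Rightarrow> bool" where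
  "entry2 M s i v \<longleftrightarrow> pair2 M i v \<in> fset2 M s"

definition is_seq :: "'a L2_structure \<Rightarrow> 'a \<Rightarrow> 'a \<Rightarrow> bool" where
  "is_seq M s n \<longleftrightarrow> fset_code M s \<and>
     (\<forall>u\<in>fset2 M s. \<exists>i v. lt2 M i n \<and> u = pair2 M i v) \<and>
     (\<forall>i. lt2 M i n \<longrightarrow> (\<exists>!v. entry2 M s i v))"

definition related :: "'a L2_structure \<Rightarrow> 'a set \<Rightarrow> 'a \<Rightarrow> 'a \<Rightarrow> bool" where
  "related M R a b \<longleftrightarrow> pair2 M a b \<in> R"

definition quasi_order :: "'a L2_structure \<Rightarrow> 'a set \<Rightarrow> 'a set \<Rightarrow> bool" where
  "quasi_order M P R \<longleftrightarrow> P \<in> sets2 M \<and> R \<in> sets2 M \<and>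
     (\<forall>a\<in>P. related M R a a) \<and>
     (\<forall>a\<in>P. \<forall>b\<in>P. \<forall>c\<in>P. related M R a b \<and> related M R b c \<longrightarrow> related M R a c)"

text \<open>Infinite means unbounded in \<open>M\<close>, which differs from \<open>infinite\<close> when \<open>M\<close> is nonstandard.\<close>

definition unbounded2 :: "'a L2_structure \<Rightarrow> 'a set \<Rightarrow> bool" where
  "unbounded2 M X \<longleftrightarrow> (\<forall>n. \<exists>x\<in>X. lt2 M n x)"

definition inf_sets :: "'a L2_structure \<Rightarrow> 'a set set" where
  "inf_sets M = {X \<in> sets2 M. unbounded2 M X}"

definition tail2 :: "'a L2_structure \<Rightarrow> 'a set \<Rightarrow> 'a set" where
  "tail2 M X = {x \<in> X. \<exists>y\<in>X. lt2 M y x}"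

definition init_seg :: "'a L2_structure \<Rightarrow> 'a set \<Rightarrow> 'a set \<Rightarrow> bool" where
  "init_seg M A X \<longleftrightarrow> A \<subseteq> X \<and> (\<forall>x\<in>A. \<forall>y\<in>X. lt2 M y x \<longrightarrow> y \<in> A)"

definition shift_rel :: "'a L2_structure \<Rightarrow> 'a \<Rightarrow> 'a \<Rightarrow> bool" where
  "shift_rel M s t \<longleftrightarrow> (\<exists>X\<in>inf_sets M.
     init_seg M (fset2 M s) X \<and> init_seg M (fset2 M t) (tail2 M X))"

text \<open>The base is only a definable class, which is not assumed to belong to \<open>sets2 M\<close>.\<close>

definition base2 :: "'a L2_structure \<Rightarrow> 'a set \<Rightarrow> 'a set" where
  "base2 M B = (\<Union>s\<in>B. fset2 M s)"

definition block2 :: "'a L2_structure \<Rightarrow> 'a set \<Rightarrow> bool" where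
  "block2 M B \<longleftrightarrow> B \<in> sets2 M \<and> (\<forall>s\<in>B. fset_code M s) \<and>
     unbounded2 M (base2 M B) \<and>
     (\<forall>X\<in>inf_sets M. X \<subseteq> base2 M B \<longrightarrow> (\<exists>s\<in>B. init_seg M (fset2 M s) X)) \<and>
     (\<forall>s\<in>B. \<forall>t\<in>B. \<not> (init_seg M (fset2 M s) (fset2 M t) \<and> fset2 M s \<noteq> fset2 M t))"

definition barrier2 :: "'a L2_structure \<Rightarrow> 'a set \<Rightarrow> bool" where
  "barrier2 M B \<longleftrightarrow> block2 M B \<and> (\<forall>s\<in>B. \<forall>t\<in>B. \<not> fset2 M s \<subset> fset2 M t)"

definition function2 :: "'a L2_structure \<Rightarrow> 'a set \<Rightarrow> 'a set \<Rightarrow> 'a set \<Rightarrow> bool" where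
  "function2 M f A P \<longleftrightarrow> f \<in> sets2 M \<and>
     (\<forall>u\<in>f. \<exists>a\<in>A. \<exists>p\<in>P. u = pair2 M a p) \<and>
     (\<forall>a\<in>A. \<exists>!p. pair2 M a p \<in> f)"

definition BQO :: "'a L2_structure \<Rightarrow> 'a set \<Rightarrow> 'a set \<Rightarrow> bool" where
  "BQO M P R \<longleftrightarrow> quasi_order M P R \<and>
     (\<forall>B f. barrier2 M B \<and> function2 M f B P \<longrightarrow>
        (\<exists>s\<in>B. \<exists>t\<in>B. \<exists>p q. shift_rel M s t \<and>
           pair2 M s p \<in> f \<and> pair2 M t q \<in> f \<and> related M R p q))"

text \<open>
  A \<open>\<Delta>\<^sup>0\<^sub>2\<close>-function is given by a \<open>\<Sigma>\<^sup>0\<^sub>2\<close>-formula \<open>\<phi>\<close>, a set variable \<open>U\<close> for the argument and a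
  number variable \<open>y\<close> for the value; \<open>e\<close> and \<open>E\<close> supply the parameters. The values of \<open>F\<close>
  outside \<open>inf_sets M\<close> are irrelevant.
\<close>

definition Delta02_function ::
  "'a L2_structure \<Rightarrow> 'a set \<Rightarrow> ('a set \<Rightarrow> 'a) \<Rightarrow> bool" where
  "Delta02_function M Q F \<longleftrightarrow> (\<forall>X\<in>inf_sets M. F X \<in> Q) \<and>
     (\<exists>\<phi> U y e E. Sigma02 \<phi> \<and> range E \<subseteq> sets2 M \<and>
        (\<forall>X\<in>inf_sets M. \<forall>q. F X = q \<longleftrightarrow> sat M (e(y := q)) (E(U := X)) \<phi>))"

definition bad_function ::
  "'a L2_structure \<Rightarrow> 'a set \<Rightarrow> ('a set \<Rightarrow> 'a) \<Rightarrow> bool" where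
  "bad_function M R F \<longleftrightarrow> \<not> (\<exists>X\<in>inf_sets M. related M R (F X) (F (tail2 M X)))"

definition Delta02_BQO :: "'a L2_structure \<Rightarrow> 'a set \<Rightarrow> 'a set \<Rightarrow> bool" where
  "Delta02_BQO M Q R \<longleftrightarrow> quasi_order M Q R \<and>
     \<not> (\<exists>F. Delta02_function M Q F \<and> bad_function M R F)"

text \<open>
  The tree with root label \<open>q\<close> and immediate subtrees listed by the sequence \<open>s\<close> is the number
  \<open>(q, s)\<close>. The entries of \<open>s\<close> are smaller than \<open>(q, s)\<close>, so by induction in \<open>M\<close> the
  equivalence below has at most one solution \<open>T\<close> in \<open>sets2 M\<close>: it is the recursion on codes that
  defines \<open>T\<^sub>f(Q)\<close> in \<open>RCA\<^sub>0\<close>. For the same reason the order is determined on \<open>T\<close> by its recursive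
  clause.
\<close>

definition tree_set :: "'a L2_structure \<Rightarrow> 'a set \<Rightarrow> 'a set \<Rightarrow> bool" where
  "tree_set M Q T \<longleftrightarrow> T \<in> sets2 M \<and>
     (\<forall>t. t \<in> T \<longleftrightarrow> (\<exists>q\<in>Q. \<exists>s n. t = pair2 M q s \<and> is_seq M s n \<and>
        (\<forall>i v. entry2 M s i v \<longrightarrow> v \<in> T)))"

definition weak_tree_order ::
  "'a L2_structure \<Rightarrow> 'a set \<Rightarrow> 'a set \<Rightarrow> 'a set \<Rightarrow> bool" where
  "weak_tree_order M R T W \<longleftrightarrow> W \<in> sets2 M \<and>
     (\<forall>p r q s. pair2 M p r \<in> T \<and> pair2 M q s \<in> T \<longrightarrow>
        (related M W (pair2 M p r) (pair2 M q s) \<longleftrightarrow>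
           (related M R p q \<and> (\<forall>i v. entry2 M r i v \<longrightarrow> related M W v (pair2 M q s))) \<or>
           (\<exists>j v. entry2 M s j v \<and> related M W (pair2 M p r) v)))"

definition weak_tree_quasi_order ::
  "'a L2_structure \<Rightarrow> 'a set \<Rightarrow> 'a set \<Rightarrow> 'a set \<Rightarrow> 'a set \<Rightarrow> bool" where
  "weak_tree_quasi_order M Q R T W \<longleftrightarrow> tree_set M Q T \<and> weak_tree_order M R T W"

text \<open>
  \<open>T\<^sup>w\<^sub>f(Q)\<close> exists in \<open>M\<close> and is a better quasi order. Without the existence part, the second
  conjunct could hold vacuously.
\<close>

definition weak_trees_BQO :: "'a L2_structure \<Rightarrow> 'a set \<Rightarrow> 'a set \<Rightarrow> bool" where
  "weak_trees_BQO M Q R \<longleftrightarrow>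
     (\<exists>T W. weak_tree_quasi_order M Q R T W) \<and>
     (\<forall>T W. weak_tree_quasi_order M Q R T W \<longrightarrow> BQO M T W)"

end

theory Submission
  imports Defs
begin

text \<open>
  Let \<open>f : B \<rightarrow> T\<close> be a bad array on a barrier. For infinite \<open>X\<close> put \<open>g\<^sub>0(X) = f(s)\<close>, where \<open>s\<close> is the
  initial segment of \<open>X\<close> in \<open>B\<close>; then \<open>g\<^sub>0(X)\<close> is not below \<open>g\<^sub>0(X\<^sup>-)\<close>. Suppose that \<open>g\<^sub>n(X)\<close> is never
  below \<open>g\<^sub>n(X\<^sup>-)\<close>. If the root label of \<open>g\<^sub>n(X)\<close> is below the one of \<open>g\<^sub>n(X\<^sup>-)\<close>, some immediate subtree
  of \<open>g\<^sub>n(X)\<close> is not below \<open>g\<^sub>n(X\<^sup>-)\<close>; let \<open>g\<^sub>n\<^sub>+\<^sub>1(X)\<close> be the one with the least code. Otherwise let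
  \<open>g\<^sub>n\<^sub>+\<^sub>1(X) = g\<^sub>n(X)\<close>. As \<open>g\<^sub>n\<^sub>+\<^sub>1(X\<^sup>-)\<close> lies below \<open>g\<^sub>n(X\<^sup>-)\<close>, badness is preserved. Codes decrease
  from trees to subtrees, so \<open>g\<^sub>n(X)\<close> is eventually constant by the \<open>\<Sigma>\<^sup>0\<^sub>1\<close> least number principle.
  Once the values for both \<open>X\<close> and \<open>X\<^sup>-\<close> have settled, the first label is not below the second.
  Hence the label of the limit is a bad function of \<open>X\<close>, and it is \<open>\<Delta>\<^sup>0\<^sub>2\<close> because \<open>g\<^sub>n(X)\<close> is computed from
  finite parts of \<open>X\<close>.
\<close>

section \<open>Arithmetic in a model\<close>

text \<open>The weak base theory shapes the proof. Induction and comprehension reach only predicates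
  of low complexity, while \<open>g\<^sub>n(X)\<close> depends on an infinite set. It is therefore
  replaced by a decidable relation between numbers, telling which values a finite part of
  \<open>X\<close> already settles. Uniqueness, badness and monotonicity are then proved inside one
  finite part, by induction on decidable claims; only existence of the values needs the whole of
  \<open>X\<close>. The values attained by the sequence form just a
  \<open>\<Sigma>\<^sup>0\<^sub>1\<close> class, so their minimum needs more than the least number
  principle for sets. The proof yields no computed bound on the stage of stabilisation, hence a
  \<open>\<Delta>\<^sup>0\<^sub>2\<close>-function. Its graph keeps this complexity because the
  limit is described negatively: no late finite part shows another label. Totality of all stages
  prevents this from holding vacuously. Choosing the subtree with the least code makes each step
  single-valued and decidable.\<close>

lemma sat_fresh:
  "\<exists>k. \<forall>z\<ge>k. \<forall>e E a. sat M (e(z := a)) E \<phi> \<longleftrightarrow> sat M e E \<phi>"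
proof -
  have tfresh: "\<exists>k. \<forall>z\<ge>k. \<forall>e a. tval M (e(z := a)) t = tval M e t" for t
  proof (induction t)
    case (TVar x) show ?case by (rule exI[of _ "Suc x"]) auto
  next
    case (TAdd s t)
    then obtain k l where "\<forall>z\<ge>k. \<forall>e a. tval M (e(z := a)) s = tval M e s"
      "\<forall>z\<ge>l. \<forall>e a. tval M (e(z := a)) t = tval M e t" by blast
    then have "\<forall>z\<ge>max k l. \<forall>e a. tval M (e(z := a)) (TAdd s t) = tval M e (TAdd s t)"
      unfolding tval.simps by simp
    then show ?case by blast
  next
    case (TMul s t)
    then obtain k l where "\<forall>z\<ge>k. \<forall>e a. tval M (e(z := a)) s = tval M e s"
      "\<forall>z\<ge>l. \<forall>e a. tval M (e(z := a)) t = tval M e t" by blast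
    then have "\<forall>z\<ge>max k l. \<forall>e a. tval M (e(z := a)) (TMul s t) = tval M e (TMul s t)"
      unfolding tval.simps by simp
    then show ?case by blast
  qed auto
  have two: "\<exists>k. \<forall>z\<ge>k. P z \<and> Q z" if "\<exists>k. \<forall>z\<ge>k. P z" "\<exists>k. \<forall>z\<ge>k. Q z" for P Q :: "nat \<Rightarrow> bool"
  proof -
    from that obtain k l where "\<forall>z\<ge>k. P z" "\<forall>z\<ge>l. Q z" by blast
    then show ?thesis by (intro exI[of _ "max k l"]) auto
  qed
  show ?thesis
  proof (induction \<phi>)
    case (FEq s t)
    obtain k where "\<forall>z\<ge>k. (\<forall>e f. tval M (e(z := f)) s = tval M e s) \<and>
      (\<forall>e f. tval M (e(z := f)) t = tval M e t)"
      using two[OF tfresh[of s] tfresh[of t]] by blast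
    then show ?case unfolding sat.simps by (intro exI[of _ k] allI impI) (simp del: fun_upd_apply)
  next
    case (FLt s t)
    obtain k where "\<forall>z\<ge>k. (\<forall>e f. tval M (e(z := f)) s = tval M e s) \<and>
      (\<forall>e f. tval M (e(z := f)) t = tval M e t)"
      using two[OF tfresh[of s] tfresh[of t]] by blast
    then show ?case unfolding sat.simps by (intro exI[of _ k] allI impI) (simp del: fun_upd_apply)
  next
    case (FMem t U)
    obtain k where "\<forall>z\<ge>k. \<forall>e f. tval M (e(z := f)) t = tval M e t" using tfresh by blast
    then show ?case unfolding sat.simps by (intro exI[of _ k] allI impI) (simp del: fun_upd_apply)
  next
    case (FAnd \<phi> \<psi>)
    then obtain k where "\<forall>z\<ge>k. (\<forall>e E f. sat M (e(z := f)) E \<phi> \<longleftrightarrow> sat M e E \<phi>) \<and>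
      (\<forall>e E f. sat M (e(z := f)) E \<psi> \<longleftrightarrow> sat M e E \<psi>)"
      using two[OF FAnd] by blast
    then show ?case unfolding sat.simps by (intro exI[of _ k] allI impI) (simp del: fun_upd_apply)
  next
    case (FOr \<phi> \<psi>)
    then obtain k where "\<forall>z\<ge>k. (\<forall>e E f. sat M (e(z := f)) E \<phi> \<longleftrightarrow> sat M e E \<phi>) \<and>
      (\<forall>e E f. sat M (e(z := f)) E \<psi> \<longleftrightarrow> sat M e E \<psi>)"
      using two[OF FOr] by blast
    then show ?case unfolding sat.simps by (intro exI[of _ k] allI impI) (simp del: fun_upd_apply)
  next
    case (FImp \<phi> \<psi>)
    then obtain k where "\<forall>z\<ge>k. (\<forall>e E f. sat M (e(z := f)) E \<phi> \<longleftrightarrow> sat M e E \<phi>) \<and>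
      (\<forall>e E f. sat M (e(z := f)) E \<psi> \<longleftrightarrow> sat M e E \<psi>)"
      using two[OF FImp] by blast
    then show ?case unfolding sat.simps by (intro exI[of _ k] allI impI) (simp del: fun_upd_apply)
  next
    case (FAll x \<phi>)
    then obtain k where k: "\<forall>z\<ge>k. \<forall>e E a. sat M (e(z := a)) E \<phi> \<longleftrightarrow> sat M e E \<phi>" by blast
    have "sat M ((e(z := a))(x := b)) E \<phi> = sat M (e(x := b)) E \<phi>" if "z \<ge> max k (Suc x)" for z e E a b
      using k[rule_format, of z "e(x := b)"] that by (subst fun_upd_twist) auto
    then show ?case unfolding sat.simps by (intro exI[of _ "max k (Suc x)"]) (simp del: fun_upd_apply)
  next
    case (FEx x \<phi>)
    then obtain k where k: "\<forall>z\<ge>k. \<forall>e E a. sat M (e(z := a)) E \<phi> \<longleftrightarrow> sat M e E \<phi>" by blast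
    have "sat M ((e(z := a))(x := b)) E \<phi> = sat M (e(x := b)) E \<phi>" if "z \<ge> max k (Suc x)" for z e E a b
      using k[rule_format, of z "e(x := b)"] that by (subst fun_upd_twist) auto
    then show ?case unfolding sat.simps by (intro exI[of _ "max k (Suc x)"]) (simp del: fun_upd_apply)
  next
    case (FAllSet U \<phi>)
    then obtain k where "\<forall>z\<ge>k. \<forall>e E f. sat M (e(z := f)) E \<phi> \<longleftrightarrow> sat M e E \<phi>" by blast
    then show ?case unfolding sat.simps by (intro exI[of _ k]) (simp del: fun_upd_apply)
  next
    case (FExSet U \<phi>)
    then obtain k where "\<forall>z\<ge>k. \<forall>e E f. sat M (e(z := f)) E \<phi> \<longleftrightarrow> sat M e E \<phi>" by blast
    then show ?case unfolding sat.simps by (intro exI[of _ k]) (simp del: fun_upd_apply)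
  qed (simp_all del: fun_upd_apply)
qed

locale rca0 =
  fixes M :: "'a L2_structure"
  assumes model: "RCA0_model M"
begin

abbreviation zer :: 'a ("\<zero>") where "\<zero> \<equiv> zero2 M"
abbreviation uno :: 'a ("\<one>") where "\<one> \<equiv> one2 M"
abbreviation pls :: "'a \<Rightarrow> 'a \<Rightarrow> 'a" (infixl "\<oplus>" 65) where "x \<oplus> y \<equiv> add2 M x y"
abbreviation tms :: "'a \<Rightarrow> 'a \<Rightarrow> 'a" (infixl "\<otimes>" 70) where "x \<otimes> y \<equiv> mul2 M x y"
abbreviation less2 :: "'a \<Rightarrow> 'a \<Rightarrow> bool" (infix "\<prec>" 50) where "x \<prec> y \<equiv> lt2 M x y"
definition leq2 :: "'a \<Rightarrow> 'a \<Rightarrow> bool" (infix "\<preceq>" 50) where "x \<preceq> y \<longleftrightarrow> x \<prec> y \<or> x = y"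
definition mns :: "'a \<Rightarrow> 'a \<Rightarrow> 'a" (infixl "\<ominus>" 65) where
  "x \<ominus> y = (if y \<prec> x then THE d. x = y \<oplus> d else \<zero>)"
abbreviation pr :: "'a \<Rightarrow> 'a \<Rightarrow> 'a" where "pr \<equiv> pair2 M"

lemma basic: "L2_basic_axioms M" and sigma_ind: "Sigma01_induction M"
  and delta_compr: "Delta01_comprehension M" and sets_ne: "sets2 M \<noteq> {}"
  using model by (auto simp: RCA0_model_def)

lemma
  shows succ_ne_zero [simp]: "n \<oplus> \<one> \<noteq> \<zero>"
    and succ_inj [simp]: "m \<oplus> \<one> = n \<oplus> \<one> \<longleftrightarrow> m = n"
    and add_zero [simp]: "m \<oplus> \<zero> = m"
    and add_succ: "m \<oplus> (n \<oplus> \<one>) = (m \<oplus> n) \<oplus> \<one>"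
    and mul_zero [simp]: "m \<otimes> \<zero> = \<zero>"
    and mul_succ: "m \<otimes> (n \<oplus> \<one>) = m \<otimes> n \<oplus> m"
    and not_less_zero [simp]: "\<not> m \<prec> \<zero>"
    and less_succ: "m \<prec> n \<oplus> \<one> \<longleftrightarrow> m \<prec> n \<or> m = n"
  using basic unfolding L2_basic_axioms_def by blast+

lemma sigma_induct:
  assumes "bounded_form \<theta>" "range E \<subseteq> sets2 M"
    and "\<exists>a. sat M (e(x := \<zero>, z := a)) E \<theta>"
    and "\<And>n. \<exists>a. sat M (e(x := n, z := a)) E \<theta> \<Longrightarrow> \<exists>a. sat M (e(x := n \<oplus> \<one>, z := a)) E \<theta>"
  shows "\<exists>a. sat M (e(x := n, z := a)) E \<theta>"
proof -
  have "Sigma01 (FEx z \<theta>)" using assms(1) unfolding Sigma01_def by blast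
  then have "sat M (e(x := n)) E (FEx z \<theta>)" for n
    using assms(2-4) by (intro sigma_ind[unfolded Sigma01_induction_def, rule_format]) auto
  then show ?thesis by simp
qed

lemma delta_set:
  assumes "bounded_form \<theta>" "bounded_form \<theta>'" "range E \<subseteq> sets2 M"
    and "\<And>n. (\<exists>a. sat M (e(x := n, z := a)) E \<theta>) \<longleftrightarrow> (\<forall>a. sat M (e(x := n, z := a)) E \<theta>')"
  shows "{n. \<exists>a. sat M (e(x := n, z := a)) E \<theta>} \<in> sets2 M"
proof -
  have "Sigma01 (FEx z \<theta>)" "Pi01 (FAll z \<theta>')"
    using assms(1,2) unfolding Sigma01_def Pi01_def by blast+
  then have "\<exists>A\<in>sets2 M. \<forall>n. n \<in> A \<longleftrightarrow> sat M (e(x := n)) E (FEx z \<theta>)"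
    using assms(3,4) by (intro delta_compr[unfolded Delta01_comprehension_def, rule_format, where \<psi>="FAll z \<theta>'"]) auto
  then obtain A where A: "A \<in> sets2 M" "\<forall>n. n \<in> A \<longleftrightarrow> sat M (e(x := n)) E (FEx z \<theta>)" by blast
  then have "A = {n. \<exists>a. sat M (e(x := n, z := a)) E \<theta>}" by auto
  with A(1) show ?thesis by simp
qed

text \<open>Comprehension asks for a leading unbounded quantifier. A vacuous one, over a variable
  supplied by \<open>sat_fresh\<close>, serves as both the \<open>\<Sigma>\<^sup>0\<^sub>1\<close>
  and the \<open>\<Pi>\<^sup>0\<^sub>1\<close> form.\<close>

lemma bounded_set:
  assumes "bounded_form \<theta>" "range E \<subseteq> sets2 M"
  shows "{n. sat M (e(x := n)) E \<theta>} \<in> sets2 M"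
proof -
  obtain k where k: "\<forall>z\<ge>k. \<forall>e E a. sat M (e(z := a)) E \<theta> \<longleftrightarrow> sat M e E \<theta>"
    using sat_fresh by blast
  have "{n. \<exists>a. sat M (e(x := n, k := a)) E \<theta>} \<in> sets2 M"
    using k by (intro delta_set[OF assms(1,1,2)]) auto
  then show ?thesis using k by simp
qed

lemma set_induct:
  assumes "S \<in> sets2 M" "\<zero> \<in> S" "\<And>n. n \<in> S \<Longrightarrow> n \<oplus> \<one> \<in> S"
  shows "n \<in> S"
  using sigma_induct[of "FMem (TVar 0) 0" "\<lambda>_. S" "\<lambda>_. \<zero>" 0 1 n] assms
  by (auto intro: bounded_form.intros)

text \<open>The arithmetical formulas below mention no set, but the scheme wants set variables
  assigned within \<open>sets2 M\<close>; an arbitrary set of the model fills them.\<close>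

lemma qf_induct:
  assumes "bounded_form \<theta>" "sat M (e(x := \<zero>)) (\<lambda>_. SOME S. S \<in> sets2 M) \<theta>"
    and "\<And>n. sat M (e(x := n)) (\<lambda>_. SOME S. S \<in> sets2 M) \<theta> \<Longrightarrow>
      sat M (e(x := n \<oplus> \<one>)) (\<lambda>_. SOME S. S \<in> sets2 M) \<theta>"
  shows "sat M (e(x := n)) (\<lambda>_. SOME S. S \<in> sets2 M) \<theta>"
proof -
  have "(SOME S. S \<in> sets2 M) \<in> sets2 M" using sets_ne by (simp add: some_in_eq)
  then have "{n. sat M (e(x := n)) (\<lambda>_. SOME S. S \<in> sets2 M) \<theta>} \<in> sets2 M"
    by (intro bounded_set assms(1)) auto
  from set_induct[OF this, of n] assms(2,3) show ?thesis by simp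
qed

lemma pred_induct:
  assumes "bounded_form \<theta>" "\<And>n. sat M (e(x := n)) (\<lambda>_. SOME S. S \<in> sets2 M) \<theta> \<longleftrightarrow> P n"
    and "P \<zero>" "\<And>n. P n \<Longrightarrow> P (n \<oplus> \<one>)"
  shows "P n"
  using qf_induct[OF assms(1), of e x n] assms(2-4) by simp

lemma sigma_pred_induct:
  assumes "bounded_form \<theta>"
    "\<And>n. (\<exists>a. sat M (e(x := n, z := a)) (\<lambda>_. SOME S. S \<in> sets2 M) \<theta>) \<longleftrightarrow> P n"
    and "P \<zero>" "\<And>n. P n \<Longrightarrow> P (n \<oplus> \<one>)"
  shows "P n"
proof -
  have "(SOME S. S \<in> sets2 M) \<in> sets2 M" using sets_ne by (simp add: some_in_eq)
  then show ?thesis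
    using sigma_induct[OF assms(1), of "\<lambda>_. SOME S. S \<in> sets2 M" e x z n] assms(2-4) by auto
qed

section \<open>Semiring and order laws\<close>

lemmas bf = bounded_form.intros

lemma zero_add [simp]: "\<zero> \<oplus> n = n"
  by (rule pred_induct[of "FEq (TAdd TZero (TVar 0)) (TVar 0)"
      "\<lambda>_. \<zero>" 0 "\<lambda>n. \<zero> \<oplus> n = n" n])
    (simp_all add: bf add_succ)

lemma succ_add: "(m \<oplus> \<one>) \<oplus> n = (m \<oplus> n) \<oplus> \<one>"
  by (rule pred_induct[of "FEq (TAdd (TAdd (TVar 1) TOne) (TVar 0)) (TAdd (TAdd (TVar 1) (TVar 0)) TOne)"
      "\<lambda>_. m" 0 "\<lambda>n. (m \<oplus> \<one>) \<oplus> n = (m \<oplus> n) \<oplus> \<one>" n])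
    (simp_all add: bf add_succ)

lemma add_comm: "m \<oplus> n = n \<oplus> m"
  by (rule pred_induct[of "FEq (TAdd (TVar 1) (TVar 0)) (TAdd (TVar 0) (TVar 1))"
      "\<lambda>_. m" 0 "\<lambda>n. m \<oplus> n = n \<oplus> m" n])
    (simp_all add: bf add_succ succ_add)

lemma add_ass: "(m \<oplus> n) \<oplus> p = m \<oplus> (n \<oplus> p)"
  by (rule pred_induct[of "FEq (TAdd (TAdd (TVar 1) (TVar 2)) (TVar 0)) (TAdd (TVar 1) (TAdd (TVar 2) (TVar 0)))"
      "(\<lambda>_. m)(2 := n)" 0 "\<lambda>p. (m \<oplus> n) \<oplus> p = m \<oplus> (n \<oplus> p)" p])
    (simp_all add: bf add_succ)

lemma add_left_comm: "m \<oplus> (n \<oplus> p) = n \<oplus> (m \<oplus> p)"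
  by (metis add_ass add_comm)

lemma add_cancel: assumes "a \<oplus> n = b \<oplus> n" shows "a = b"
proof -
  have "a \<oplus> n = b \<oplus> n \<longrightarrow> a = b"
    by (rule pred_induct[of "FImp (FEq (TAdd (TVar 1) (TVar 0)) (TAdd (TVar 2) (TVar 0))) (FEq (TVar 1) (TVar 2))"
        "(\<lambda>_. a)(2 := b)" 0 "\<lambda>n. a \<oplus> n = b \<oplus> n \<longrightarrow> a = b" n])
      (simp_all add: bf add_succ)
  with assms show ?thesis by blast
qed

lemma zero_mul [simp]: "\<zero> \<otimes> n = \<zero>"
  by (rule pred_induct[of "FEq (TMul TZero (TVar 0)) TZero"
      "\<lambda>_. \<zero>" 0 "\<lambda>n. \<zero> \<otimes> n = \<zero>" n])
    (simp_all add: bf mul_succ)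

lemma succ_mul: "(m \<oplus> \<one>) \<otimes> n = m \<otimes> n \<oplus> n"
  by (rule pred_induct[of "FEq (TMul (TAdd (TVar 1) TOne) (TVar 0)) (TAdd (TMul (TVar 1) (TVar 0)) (TVar 0))"
      "\<lambda>_. m" 0 "\<lambda>n. (m \<oplus> \<one>) \<otimes> n = m \<otimes> n \<oplus> n" n])
    (simp_all add: bf mul_succ add_ass add_comm add_left_comm)

lemma mul_comm: "m \<otimes> n = n \<otimes> m"
  by (rule pred_induct[of "FEq (TMul (TVar 1) (TVar 0)) (TMul (TVar 0) (TVar 1))"
      "\<lambda>_. m" 0 "\<lambda>n. m \<otimes> n = n \<otimes> m" n])
    (simp_all add: bf mul_succ succ_mul)

lemma distrib: "m \<otimes> (n \<oplus> p) = m \<otimes> n \<oplus> m \<otimes> p"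
  by (rule pred_induct[of "FEq (TMul (TVar 1) (TAdd (TVar 2) (TVar 0)))
       (TAdd (TMul (TVar 1) (TVar 2)) (TMul (TVar 1) (TVar 0)))"
      "(\<lambda>_. m)(2 := n)" 0 "\<lambda>p. m \<otimes> (n \<oplus> p) = m \<otimes> n \<oplus> m \<otimes> p" p])
    (simp_all add: bf add_succ mul_succ add_ass[symmetric])

lemma mul_one: "m \<otimes> \<one> = m"
  by (metis zero_add mul_succ mul_zero)

lemma mul_ass: "(m \<otimes> n) \<otimes> p = m \<otimes> (n \<otimes> p)"
  by (rule pred_induct[of "FEq (TMul (TMul (TVar 1) (TVar 2)) (TVar 0)) (TMul (TVar 1) (TMul (TVar 2) (TVar 0)))"
      "(\<lambda>_. m)(2 := n)" 0 "\<lambda>p. (m \<otimes> n) \<otimes> p = m \<otimes> (n \<otimes> p)" p])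
    (simp_all add: bf distrib mul_one)

lemma zero_or_succ: "n = \<zero> \<or> (\<exists>d. n = d \<oplus> \<one>)"
proof -
  have "\<exists>d. n = \<zero> \<or> n = d \<oplus> \<one>"
    by (rule sigma_pred_induct[of "FOr (FEq (TVar 0) TZero) (FEq (TVar 0) (TAdd (TVar 1) TOne))"
      "\<lambda>_. \<zero>" 0 1 "\<lambda>n. \<exists>d. n = \<zero> \<or> n = d \<oplus> \<one>" n])
      (simp_all add: bf)
  then show ?thesis by blast
qed

lemma less_add_succ: "x \<prec> x \<oplus> (d \<oplus> \<one>)"
  by (rule pred_induct[of "FLt (TVar 1) (TAdd (TVar 1) (TAdd (TVar 0) TOne))"
      "\<lambda>_. x" 0 "\<lambda>d. x \<prec> x \<oplus> (d \<oplus> \<one>)" d])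
    (simp_all add: bf add_succ less_succ)

text \<open>Reduces the order to addition; irreflexivity, transitivity and strict monotonicity of
  multiplication then need no further induction.\<close>

lemma less_iff_ex: "x \<prec> y \<longleftrightarrow> (\<exists>d. y = x \<oplus> (d \<oplus> \<one>))"
proof -
  have *: "\<exists>d. x \<prec> n \<oplus> \<one> \<longrightarrow> n \<oplus> \<one> = x \<oplus> (d \<oplus> \<one>)"
    if IH: "\<exists>d. x \<prec> n \<longrightarrow> n = x \<oplus> (d \<oplus> \<one>)" for n
  proof -
    consider "x = n" | "x \<prec> n" | "\<not> x \<prec> n \<oplus> \<one>" using less_succ by blast
    then show ?thesis
    proof cases
      case 1
      then have "n \<oplus> \<one> = x \<oplus> (\<zero> \<oplus> \<one>)" by simp
      then show ?thesis by blast
    next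
      case 2
      with IH obtain d where "n = x \<oplus> (d \<oplus> \<one>)" by blast
      then have "n \<oplus> \<one> = x \<oplus> ((d \<oplus> \<one>) \<oplus> \<one>)" using add_ass by simp
      then show ?thesis by blast
    qed blast
  qed
  \<comment> \<open>With the quantifier in front of the implication the claim is
    \<open>\<Sigma>\<^sup>0\<^sub>1\<close> in \<open>y\<close>, so induction applies.\<close>
  have "\<exists>d. x \<prec> y \<longrightarrow> y = x \<oplus> (d \<oplus> \<one>)"
    by (rule sigma_pred_induct[of "FImp (FLt (TVar 2) (TVar 0)) (FEq (TVar 0) (TAdd (TVar 2) (TAdd (TVar 1) TOne)))"
      "\<lambda>_. x" 0 1 "\<lambda>y. \<exists>d. x \<prec> y \<longrightarrow> y = x \<oplus> (d \<oplus> \<one>)" y])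
      (use * in \<open>simp_all add: bf\<close>)
  then show ?thesis using less_add_succ by blast
qed

lemma less_irr: "\<not> x \<prec> x"
  by (metis less_iff_ex succ_ne_zero add_cancel add_comm zero_add)

lemma less_trans2: "x \<prec> y \<Longrightarrow> y \<prec> z \<Longrightarrow> x \<prec> z"
  unfolding less_iff_ex by (metis add_ass)

lemma less_lin: "x \<prec> y \<or> x = y \<or> y \<prec> x"
proof -
  have "x \<prec> n \<oplus> \<one> \<or> x = n \<oplus> \<one> \<or> n \<oplus> \<one> \<prec> x" if "x \<prec> n \<or> x = n \<or> n \<prec> x" for n
    using that
  proof (elim disjE)
    assume "n \<prec> x"
    then obtain d where d: "x = n \<oplus> (d \<oplus> \<one>)" unfolding less_iff_ex by blast
    from zero_or_succ[of d] show ?thesis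
    proof (elim disjE exE)
      fix b assume "d = b \<oplus> \<one>"
      then have "x = (n \<oplus> \<one>) \<oplus> (b \<oplus> \<one>)" using d by (metis add_ass add_comm)
      then show ?thesis using less_add_succ by auto
    qed (use d in simp)
  qed (auto simp: less_succ)
  moreover have "x = \<zero> \<or> \<zero> \<prec> x" using zero_or_succ[of x] less_add_succ[of \<zero>] by auto
  ultimately show ?thesis
    by (intro pred_induct[of "FOr (FLt (TVar 1) (TVar 0)) (FOr (FEq (TVar 1) (TVar 0)) (FLt (TVar 0) (TVar 1)))"
      "\<lambda>_. x" 0 "\<lambda>y. x \<prec> y \<or> x = y \<or> y \<prec> x" y]) (simp_all add: bf)
qed

lemma mul_less: assumes "a \<prec> b" "\<zero> \<prec> c" shows "c \<otimes> a \<prec> c \<otimes> b"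
proof -
  obtain d where d: "b = a \<oplus> (d \<oplus> \<one>)" using assms(1) unfolding less_iff_ex by blast
  obtain e where e: "c = e \<oplus> \<one>" using assms(2) unfolding less_iff_ex by auto
  have "c \<otimes> b = c \<otimes> a \<oplus> ((c \<otimes> d \<oplus> e) \<oplus> \<one>)" by (simp add: d distrib mul_one) (simp add: e add_ass)
  then show ?thesis unfolding less_iff_ex by blast
qed

lemma add_cancel_left: "y \<oplus> a = y \<oplus> b \<longleftrightarrow> a = b"
  using add_cancel[of a y b] by (auto simp: add_comm)

lemma leq_iff_ex: "y \<preceq> x \<longleftrightarrow> (\<exists>d. x = y \<oplus> d)"
proof
  assume "y \<preceq> x"
  then show "\<exists>d. x = y \<oplus> d" unfolding leq2_def less_iff_ex by (metis add_zero)
next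
  assume "\<exists>d. x = y \<oplus> d"
  then obtain d where d: "x = y \<oplus> d" by blast
  from zero_or_succ[of d] show "y \<preceq> x"
    unfolding leq2_def less_iff_ex using d by auto
qed

lemma add_diff': "(y \<oplus> d) \<ominus> y = d"
proof (cases "d = \<zero>")
  case False
  with zero_or_succ[of d] have "y \<prec> y \<oplus> d" unfolding less_iff_ex by blast
  then show ?thesis by (simp add: mns_def add_cancel_left)
qed (simp add: mns_def less_irr)

lemma diff_add: "y \<preceq> x \<Longrightarrow> (x \<ominus> y) \<oplus> y = x"
  unfolding leq_iff_ex by (metis add_diff' add_comm)

lemma diff_zero: assumes "\<not> y \<preceq> x" shows "x \<ominus> y = \<zero>"
  using assms unfolding leq2_def mns_def using less_lin by auto

lemma leq_trans: "x \<preceq> y \<Longrightarrow> y \<preceq> z \<Longrightarrow> x \<preceq> z"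
  unfolding leq2_def using less_trans2 by blast

lemma diff_diff: "a \<ominus> b \<ominus> c = a \<ominus> (b \<oplus> c)"
proof (cases "b \<preceq> a")
  case True
  then obtain d where d: "a = b \<oplus> d" unfolding leq_iff_ex by blast
  show ?thesis
  proof (cases "c \<preceq> d")
    case True
    then obtain f where "d = c \<oplus> f" unfolding leq_iff_ex by blast
    then have "a \<ominus> b = c \<oplus> f" "a = (b \<oplus> c) \<oplus> f" using d by (simp_all add: add_diff' add_ass)
    then show ?thesis by (simp add: add_diff')
  next
    case False
    then have "\<not> b \<oplus> c \<preceq> a" unfolding d leq_iff_ex by (metis add_ass add_cancel_left)
    with False show ?thesis by (simp add: d add_diff' diff_zero)
  qed
next
  case False
  moreover have "b \<preceq> b \<oplus> c" unfolding leq_iff_ex by blast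
  ultimately have "\<not> b \<oplus> c \<preceq> a" using leq_trans by blast
  moreover have "\<zero> \<ominus> c = \<zero>" by (simp add: mns_def)
  ultimately show ?thesis using False by (simp add: diff_zero)
qed

lemma zero_one: "\<zero> \<prec> \<one>" "\<zero> \<noteq> \<one>"
  using less_succ[of \<zero> \<zero>] succ_ne_zero[of \<zero>] by auto

text \<open>Truncated subtraction is only needed to make the library on ordered semirings available.\<close>

sublocale ar: linordered_semidom "(\<oplus>)" "(\<ominus>)" "(\<preceq>)" "(\<prec>)" "\<zero>" "(\<otimes>)" "\<one>"
proof unfold_locales
  fix a b c :: 'a
  show "(a \<oplus> b) \<oplus> c = a \<oplus> (b \<oplus> c)" by (rule add_ass)
  show "a \<oplus> b = b \<oplus> a" by (rule add_comm)
  show "(a \<oplus> b) \<ominus> a = b" by (rule add_diff')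
  show "a \<ominus> b \<ominus> c = a \<ominus> (b \<oplus> c)" by (rule diff_diff)
  show less_le: "a \<prec> b \<longleftrightarrow> a \<preceq> b \<and> \<not> b \<preceq> a" for a b
    unfolding leq2_def using less_irr less_trans2 by blast
  show "a \<preceq> a" unfolding leq2_def by blast
  show "a \<preceq> b \<Longrightarrow> b \<preceq> c \<Longrightarrow> a \<preceq> c" by (rule leq_trans)
  show "a \<preceq> b \<Longrightarrow> b \<preceq> a \<Longrightarrow> a = b" using less_le leq2_def by blast
  show "a \<preceq> b \<Longrightarrow> c \<oplus> a \<preceq> c \<oplus> b" unfolding leq_iff_ex using add_ass by auto
  show "a \<preceq> b \<or> b \<preceq> a" unfolding leq2_def using less_lin by blast
  show "\<zero> \<oplus> a = a" "\<zero> \<otimes> a = \<zero>" "a \<otimes> \<zero> = \<zero>" by simp_all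
  show "(a \<otimes> b) \<otimes> c = a \<otimes> (b \<otimes> c)" by (rule mul_ass)
  show "a \<otimes> b = b \<otimes> a" by (rule mul_comm)
  show "(a \<oplus> b) \<otimes> c = a \<otimes> c \<oplus> b \<otimes> c" by (simp only: mul_comm[of _ c] distrib)
  show "a \<prec> b \<Longrightarrow> \<zero> \<prec> c \<Longrightarrow> c \<otimes> a \<prec> c \<otimes> b" by (rule mul_less)
  show "\<one> \<otimes> a = a" using mul_comm[of \<one> a] mul_one by simp
  show "\<zero> \<noteq> \<one>" "\<zero> \<prec> \<one>" by (rule zero_one)+
  show "a \<otimes> (b \<oplus> c) = a \<otimes> b \<oplus> a \<otimes> c" by (rule distrib)
  show "a \<otimes> (b \<ominus> c) = a \<otimes> b \<ominus> a \<otimes> c"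
  proof (cases "c \<preceq> b")
    case True
    then obtain d where "b = c \<oplus> d" unfolding leq_iff_ex by blast
    then show ?thesis by (simp add: add_diff' distrib)
  next
    case False
    then have bc: "b \<ominus> c = \<zero>" "b \<prec> c" using diff_zero less_lin[of b c] unfolding leq2_def by auto
    show ?thesis
    proof (cases "a = \<zero>")
      case True
      then show ?thesis by (simp add: mns_def)
    next
      case False
      then have "\<zero> \<prec> a" using less_lin[of \<zero> a] by auto
      then have "a \<otimes> b \<prec> a \<otimes> c" using bc mul_less by blast
      then show ?thesis using bc diff_zero less_le by simp
    qed
  qed
  show "a \<noteq> \<zero> \<Longrightarrow> b \<noteq> \<zero> \<Longrightarrow> a \<otimes> b \<noteq> \<zero>"
    using zero_or_succ[of b] zero_or_succ[of a] by (auto simp: distrib mul_one add_ass[symmetric])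
  show "b \<preceq> a \<Longrightarrow> (a \<ominus> b) \<oplus> b = a" by (rule diff_add)
qed

section \<open>Decidable predicates and computable functions\<close>

lemma less_succ_leq [simp]: "x \<prec> y \<oplus> \<one> \<longleftrightarrow> x \<preceq> y"
  by (simp add: less_succ leq2_def)

lemma zero_leq [simp]: "\<zero> \<preceq> x"
  by (simp add: leq_iff_ex)

lemma succ_leq: "x \<oplus> \<one> \<preceq> y \<longleftrightarrow> x \<prec> y"
  by (metis ar.not_le less_succ_leq)

lemma leq_add: "x \<preceq> x \<oplus> y" "y \<preceq> x \<oplus> y"
  unfolding leq_iff_ex using add_comm by blast+

lemma leq_square: "x \<preceq> x \<otimes> x"
proof (cases "x = \<zero>")
  case False
  then obtain d where "x = d \<oplus> \<one>" using zero_or_succ by blast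
  then have "x \<otimes> x = x \<oplus> x \<otimes> d" using distrib mul_one add_comm by metis
  then show ?thesis using leq_add by simp
qed simp

text \<open>The square of \<open>s + 1\<close> exceeds every \<open>s^2 + i\<close> with
  \<open>i\<close> at most \<open>s\<close>. Pairs with different sums thus have codes in disjoint
  intervals, which gives injectivity and monotonicity of pairing.\<close>

lemma pr_key:
  assumes "s \<prec> t" "i \<preceq> s"
  shows "s \<otimes> s \<oplus> i \<prec> t \<otimes> t"
proof -
  have "s \<otimes> s \<oplus> i \<preceq> s \<otimes> s \<oplus> s" using assms(2) by simp
  also have "\<dots> \<prec> s \<otimes> s \<oplus> s \<oplus> s \<oplus> \<one>" using leq_add(1) by simp
  also have "\<dots> = (s \<oplus> \<one>) \<otimes> (s \<oplus> \<one>)" by (simp add: distrib mul_one ar.distrib_right add_ass)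
  also have "\<dots> \<preceq> t \<otimes> t" using assms(1) succ_leq by (intro ar.mult_mono) auto
  finally show ?thesis .
qed

lemma pr_mono_sum: "i \<oplus> j \<prec> k \<oplus> l \<Longrightarrow> pr i j \<prec> pr k l"
  unfolding pair2_def using pr_key[of "i \<oplus> j" "k \<oplus> l" i] leq_add ar.less_le_trans by blast

lemma pr_inj [simp]: "pr i j = pr k l \<longleftrightarrow> i = k \<and> j = l"
proof
  assume eq: "pr i j = pr k l"
  then have "i \<oplus> j = k \<oplus> l" using pr_mono_sum[of i j k l] pr_mono_sum[of k l i j] less_irr less_lin by metis
  moreover from this have "i = k" using eq unfolding pair2_def by simp
  ultimately show "i = k \<and> j = l" by simp
qed simp

lemma pr_mono1: "i \<prec> k \<Longrightarrow> pr i j \<prec> pr k j"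
  by (rule pr_mono_sum) simp

lemma pr_mono2: "j \<prec> l \<Longrightarrow> pr i j \<prec> pr i l"
  by (rule pr_mono_sum) simp

lemma fst_leq_pr: "i \<preceq> pr i j"
  unfolding pair2_def by (rule leq_add)

lemma snd_leq_pr: "j \<preceq> pr i j"
proof -
  have "j \<preceq> (i \<oplus> j) \<otimes> (i \<oplus> j)" using leq_add leq_square leq_trans by blast
  then show ?thesis unfolding pair2_def using leq_add leq_trans by blast
qed

text \<open>The coding of pairs is not surjective: \<open>p1\<close> and \<open>p2\<close> are \<open>\<zero>\<close> off its range.\<close>

definition p1 :: "'a \<Rightarrow> 'a" where "p1 z = (if \<exists>i j. z = pr i j then THE i. \<exists>j. z = pr i j else \<zero>)"
definition p2 :: "'a \<Rightarrow> 'a" where "p2 z = (if \<exists>i j. z = pr i j then THE j. \<exists>i. z = pr i j else \<zero>)"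

lemma p1_pr [simp]: "p1 (pr i j) = i" and p2_pr [simp]: "p2 (pr i j) = j"
  unfolding p1_def p2_def by auto

lemma p1_leq: "p1 z \<preceq> z"
proof (cases "\<exists>i j. z = pr i j")
  case True
  then show ?thesis using fst_leq_pr by auto
qed (auto simp: p1_def)

lemma p2_leq: "p2 z \<preceq> z"
proof (cases "\<exists>i j. z = pr i j")
  case True
  then show ?thesis using snd_leq_pr by auto
qed (auto simp: p2_def)

text \<open>
  Formulas only occur in the proofs of the closure rules \<open>dcf\<close>. With these, \<open>intro dcf\<close> shows that a
  predicate of \<open>M\<close> is \<open>\<Delta>\<^sup>0\<^sub>1\<close>. Relations and functions of several arguments are coded by pairs.
\<close>

definition dec :: "('a \<Rightarrow> bool) \<Rightarrow> bool" where "dec P \<longleftrightarrow> {x. P x} \<in> sets2 M"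
definition cf :: "('a \<Rightarrow> 'a) \<Rightarrow> bool" where
  "cf f \<longleftrightarrow> (\<exists>S\<in>sets2 M. \<forall>x y. pr x y \<in> S \<longleftrightarrow> y = f x)"

definition tpair :: "L2_term \<Rightarrow> L2_term \<Rightarrow> L2_term" where
  "tpair s t = TAdd (TMul (TAdd s t) (TAdd s t)) s"

lemma tval_tpair [simp]: "tval M e (tpair s t) = pr (tval M e s) (tval M e t)"
  by (simp add: tpair_def pair2_def)

definition ble :: "nat \<Rightarrow> nat \<Rightarrow> L2_form \<Rightarrow> L2_form" where
  "ble x y \<phi> = FEx x (FAnd (FLt (TVar x) (TAdd (TVar y) TOne)) \<phi>)"

definition blt :: "nat \<Rightarrow> nat \<Rightarrow> L2_form \<Rightarrow> L2_form" where
  "blt x y \<phi> = FAll x (FImp (FLt (TVar x) (TVar y)) \<phi>)"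

lemma bf_ble: "bounded_form \<phi> \<Longrightarrow> x \<noteq> y \<Longrightarrow> bounded_form (ble x y \<phi>)"
  unfolding ble_def by (auto intro: bf)

lemma bf_blt: "bounded_form \<phi> \<Longrightarrow> x \<noteq> y \<Longrightarrow> bounded_form (blt x y \<phi>)"
  unfolding blt_def by (auto intro: bf)

lemma sat_ble [simp]: "x \<noteq> y \<Longrightarrow> sat M e E (ble x y \<phi>) \<longleftrightarrow> (\<exists>a. a \<preceq> e y \<and> sat M (e(x := a)) E \<phi>)"
  unfolding ble_def by simp

lemma sat_blt [simp]: "x \<noteq> y \<Longrightarrow> sat M e E (blt x y \<phi>) \<longleftrightarrow> (\<forall>a. a \<prec> e y \<longrightarrow> sat M (e(x := a)) E \<phi>)"
  unfolding blt_def by simp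

text \<open>The code of a pair bounds both components, so decoding costs only bounded
  quantifiers.\<close>

lemma bounded_pair_set:
  assumes "bounded_form \<theta>" "range E \<subseteq> sets2 M"
  shows "\<exists>S\<in>sets2 M. \<forall>x y. pr x y \<in> S \<longleftrightarrow> sat M (e(0 := x, 1 := y)) E \<theta>"
proof -
  obtain k where k: "\<forall>z\<ge>k. \<forall>e E a. sat M (e(z := a)) E \<theta> \<longleftrightarrow> sat M e E \<theta>"
    using sat_fresh by blast
  define z where "z = max k 2"
  have z: "z \<noteq> 0" "z \<noteq> 1" by (auto simp: z_def)
  have zf: "sat M ((e(z := c))(0 := a, 1 := b)) E \<theta> = sat M (e(0 := a, 1 := b)) E \<theta>" for a b c
  proof -
    have "(e(z := c))(0 := a, 1 := b) = (e(0 := a, 1 := b))(z := c)" using z by auto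
    then show ?thesis using k by (simp add: z_def del: fun_upd_apply)
  qed
  define \<phi> where "\<phi> = ble 0 z (ble 1 z (FAnd (FEq (TVar z) (tpair (TVar 0) (TVar 1))) \<theta>))"
  have "bounded_form \<phi>" unfolding \<phi>_def using z assms(1) by (auto intro!: bf bf_ble)
  then have "{n. sat M (e(z := n)) E \<phi>} \<in> sets2 M" using assms(2) by (rule bounded_set)
  moreover have "sat M (e(z := pr x y)) E \<phi> \<longleftrightarrow> sat M (e(0 := x, 1 := y)) E \<theta>" for x y
    unfolding \<phi>_def using z fst_leq_pr snd_leq_pr zf by (auto simp del: fun_upd_apply simp: fun_upd_same fun_upd_other)
  ultimately show ?thesis by (intro bexI[of _ "{n. sat M (e(z := n)) E \<phi>}"]) auto
qed


section \<open>Closure rules\<close>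

named_theorems dcf

lemma dec_bounded:
  assumes "bounded_form \<theta>" "\<And>i. E i \<in> sets2 M"
    "\<And>n. sat M (e(x := n)) E \<theta> \<longleftrightarrow> P n"
  shows "dec P"
  using bounded_set[OF assms(1), of E e x] assms(2,3) unfolding dec_def by auto

lemma dec_delta:
  assumes "bounded_form \<theta>" "bounded_form \<theta>'" "\<And>i. E i \<in> sets2 M"
    "\<And>n. (\<exists>a. sat M (e(x := n, z := a)) E \<theta>) \<longleftrightarrow> P n"
    "\<And>n. (\<forall>a. sat M (e(x := n, z := a)) E \<theta>') \<longleftrightarrow> P n"
  shows "dec P"
  using delta_set[OF assms(1,2), of E e x z] assms(3-5) unfolding dec_def by auto

lemma cf_bounded:
  assumes "bounded_form \<theta>" "\<And>i. E i \<in> sets2 M"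
    "\<And>x y. sat M (e(0 := x, 1 := y)) E \<theta> \<longleftrightarrow> y = f x"
  shows "cf f"
proof -
  have "range E \<subseteq> sets2 M" using assms(2) by blast
  from bounded_pair_set[OF assms(1) this, of e] show ?thesis unfolding cf_def assms(3) .
qed

lemma decE: assumes "dec P" obtains S where "S \<in> sets2 M" "\<forall>x. x \<in> S \<longleftrightarrow> P x"
  using assms unfolding dec_def by (auto intro: that)

lemma cfE: assumes "cf f" obtains S where "S \<in> sets2 M" "\<forall>x y. pr x y \<in> S \<longleftrightarrow> y = f x"
  using assms unfolding cf_def by (auto intro: that)

lemma cf_id [dcf]: "cf (\<lambda>x. x)"
  by (rule cf_bounded[of "FEq (TVar 1) (TVar 0)" "\<lambda>_. SOME S. S \<in> sets2 M" "\<lambda>_. \<zero>"])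
    (use sets_ne in \<open>simp_all add: bf some_in_eq\<close>)

lemma cf_const [dcf]: "cf (\<lambda>x. c)"
  by (rule cf_bounded[of "FEq (TVar 1) (TVar 2)" "\<lambda>_. SOME S. S \<in> sets2 M" "\<lambda>_. c"])
    (use sets_ne in \<open>simp_all add: bf some_in_eq\<close>)

lemma dec_not [dcf]: assumes "dec P" shows "dec (\<lambda>x. \<not> P x)"
proof -
  obtain S where S: "S \<in> sets2 M" "\<forall>x. x \<in> S \<longleftrightarrow> P x" using assms by (rule decE)
  show ?thesis
    by (rule dec_bounded[of "FNeg (FMem (TVar 0) 0)" "\<lambda>_. S" "\<lambda>_. \<zero>" 0]) (use S in \<open>simp_all add: bf\<close>)
qed

lemma dec_conj [dcf]: assumes "dec P" "dec Q" shows "dec (\<lambda>x. P x \<and> Q x)"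
proof -
  obtain S where S: "S \<in> sets2 M" "\<forall>x. x \<in> S \<longleftrightarrow> P x" using assms(1) by (rule decE)
  obtain T where T: "T \<in> sets2 M" "\<forall>x. x \<in> T \<longleftrightarrow> Q x" using assms(2) by (rule decE)
  show ?thesis
    by (rule dec_bounded[of "FAnd (FMem (TVar 0) 0) (FMem (TVar 0) 1)" "\<lambda>i. if i = 0 then S else T" "\<lambda>_. \<zero>" 0])
      (use S T in \<open>simp_all add: bf\<close>)
qed

lemma dec_disj [dcf]: assumes "dec P" "dec Q" shows "dec (\<lambda>x. P x \<or> Q x)"
  using dec_not[OF dec_conj[OF dec_not[OF assms(1)] dec_not[OF assms(2)]]] by simp

lemma dec_imp [dcf]: assumes "dec P" "dec Q" shows "dec (\<lambda>x. P x \<longrightarrow> Q x)"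
  using dec_disj[OF dec_not[OF assms(1)] assms(2)] by (simp only: imp_conv_disj)

lemma dec_iff [dcf]: assumes "dec P" "dec Q" shows "dec (\<lambda>x. P x \<longleftrightarrow> Q x)"
  using dec_conj[OF dec_imp[OF assms] dec_imp[OF assms(2,1)]] by (simp only: iff_conv_conj_imp)

text \<open>The intermediate value \<open>f x\<close> is unique, so it can be introduced by an
  existential quantifier with a conjunction or by a universal one with an implication. These are the
  two forms that comprehension compares.\<close>

lemma dec_comp: assumes "dec P" "cf f" shows "dec (\<lambda>x. P (f x))"
proof -
  obtain S where S: "S \<in> sets2 M" "\<forall>x. x \<in> S \<longleftrightarrow> P x" using assms(1) by (rule decE)
  obtain T where T: "T \<in> sets2 M" "\<forall>x y. pr x y \<in> T \<longleftrightarrow> y = f x" using assms(2) by (rule cfE)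
  show ?thesis
    by (rule dec_delta[of "FAnd (FMem (tpair (TVar 0) (TVar 1)) 1) (FMem (TVar 1) 0)"
          "FImp (FMem (tpair (TVar 0) (TVar 1)) 1) (FMem (TVar 1) 0)"
          "\<lambda>i. if i = 0 then S else T" "\<lambda>_. \<zero>" 0 1])
      (use S T in \<open>simp_all add: bf\<close>)
qed

lemma cf_comp: assumes "cf g" "cf f" shows "cf (\<lambda>x. g (f x))"
proof -
  obtain S where S: "S \<in> sets2 M" "\<forall>x y. pr x y \<in> S \<longleftrightarrow> y = g x" using assms(1) by (rule cfE)
  obtain T where T: "T \<in> sets2 M" "\<forall>x y. pr x y \<in> T \<longleftrightarrow> y = f x" using assms(2) by (rule cfE)
  let ?A = "FMem (tpair (TVar 0) (TVar 3)) 1" and ?B = "FMem (tpair (TVar 3) (TVar 1)) 0"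
  let ?E = "FEq (TVar 2) (tpair (TVar 0) (TVar 1))"
  let ?P = "\<lambda>z. \<exists>x. x \<preceq> z \<and> (\<exists>y. y \<preceq> z \<and> z = pr x y \<and> y = g (f x))"
  \<comment> \<open>In the universal form \<open>w\<close> must stand in front of the bounded search
    for \<open>x\<close> and \<open>y\<close>. As \<open>z\<close> determines both, the order does
    not matter; the instance \<open>w = f (p1 z)\<close> recovers the value.\<close>
  have *: "(\<forall>w. \<exists>x. x \<preceq> z \<and> (\<exists>y. y \<preceq> z \<and> z = pr x y \<and> (w = f x \<longrightarrow> y = g w))) \<longleftrightarrow> ?P z" for z
  proof
    assume "\<forall>w. \<exists>x. x \<preceq> z \<and> (\<exists>y. y \<preceq> z \<and> z = pr x y \<and> (w = f x \<longrightarrow> y = g w))"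
    from this[rule_format, of "f (p1 z)"] show "?P z" by auto
  qed auto
  have "dec ?P"
  proof (rule dec_delta[of "ble 0 2 (ble 1 2 (FAnd ?E (FAnd ?A ?B)))"
          "ble 0 2 (ble 1 2 (FAnd ?E (FImp ?A ?B)))"
          "\<lambda>i. if i = 0 then S else T" "\<lambda>_. \<zero>" 2 3])
    fix n
    show "(\<forall>a. sat M ((\<lambda>_. \<zero>)(2 := n, 3 := a)) (\<lambda>i. if i = 0 then S else T)
        (ble 0 2 (ble 1 2 (FAnd ?E (FImp ?A ?B))))) \<longleftrightarrow> ?P n"
      unfolding *[symmetric] using S T by simp
  qed (use S T in \<open>auto intro!: bf bf_ble\<close>)
  then obtain U where U: "U \<in> sets2 M" "\<forall>z. z \<in> U \<longleftrightarrow> ?P z" by (rule decE)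
  then have "pr x y \<in> U \<longleftrightarrow> y = g (f x)" for x y using fst_leq_pr snd_leq_pr by auto
  with U(1) show ?thesis unfolding cf_def by blast
qed

lemma cf_pr [dcf]: assumes "cf f" "cf g" shows "cf (\<lambda>x. pr (f x) (g x))"
proof -
  obtain S where S: "S \<in> sets2 M" "\<forall>x y. pr x y \<in> S \<longleftrightarrow> y = f x" using assms(1) by (rule cfE)
  obtain T where T: "T \<in> sets2 M" "\<forall>x y. pr x y \<in> T \<longleftrightarrow> y = g x" using assms(2) by (rule cfE)
  let ?\<theta> = "ble 2 1 (ble 3 1 (FAnd (FEq (TVar 1) (tpair (TVar 2) (TVar 3)))
    (FAnd (FMem (tpair (TVar 0) (TVar 2)) 0) (FMem (tpair (TVar 0) (TVar 3)) 1))))"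
  show ?thesis
    by (rule cf_bounded[of ?\<theta> "\<lambda>i. if i = 0 then S else T" "\<lambda>_. \<zero>"])
      (use S T fst_leq_pr snd_leq_pr in \<open>auto intro!: bf bf_ble\<close>)
qed

lemma p1_iff: "y = p1 z \<longleftrightarrow> (\<exists>j. j \<preceq> z \<and> z = pr y j) \<or> y = \<zero> \<and> \<not> (\<exists>i. i \<preceq> z \<and> (\<exists>j. j \<preceq> z \<and> z = pr i j))"
proof (cases "\<exists>i j. z = pr i j")
  case True
  then obtain i j where "z = pr i j" by blast
  then show ?thesis using fst_leq_pr[of i j] snd_leq_pr[of j i] by auto
next
  case False
  then show ?thesis by (simp add: p1_def)
qed

lemma p2_iff: "y = p2 z \<longleftrightarrow> (\<exists>j. j \<preceq> z \<and> z = pr j y) \<or> y = \<zero> \<and> \<not> (\<exists>i. i \<preceq> z \<and> (\<exists>j. j \<preceq> z \<and> z = pr i j))"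
proof (cases "\<exists>i j. z = pr i j")
  case True
  then obtain i j where "z = pr i j" by blast
  then show ?thesis using fst_leq_pr[of i j] snd_leq_pr[of j i] by auto
next
  case False
  then show ?thesis by (simp add: p2_def)
qed

lemma cf_p1 [dcf]: assumes "cf f" shows "cf (\<lambda>x. p1 (f x))"
proof -
  let ?\<theta> = "FOr (ble 2 0 (FEq (TVar 0) (tpair (TVar 1) (TVar 2))))
    (FAnd (FEq (TVar 1) TZero) (FNeg (ble 2 0 (ble 3 0 (FEq (TVar 0) (tpair (TVar 2) (TVar 3)))))))"
  have "cf p1"
    by (rule cf_bounded[of ?\<theta> "\<lambda>_. SOME S. S \<in> sets2 M" "\<lambda>_. \<zero>"])
      (use sets_ne p1_iff in \<open>auto intro!: bf bf_ble simp: some_in_eq\<close>)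
  from cf_comp[OF this assms] show ?thesis .
qed

lemma cf_p2 [dcf]: assumes "cf f" shows "cf (\<lambda>x. p2 (f x))"
proof -
  let ?\<theta> = "FOr (ble 2 0 (FEq (TVar 0) (tpair (TVar 2) (TVar 1))))
    (FAnd (FEq (TVar 1) TZero) (FNeg (ble 2 0 (ble 3 0 (FEq (TVar 0) (tpair (TVar 2) (TVar 3)))))))"
  have "cf p2"
    by (rule cf_bounded[of ?\<theta> "\<lambda>_. SOME S. S \<in> sets2 M" "\<lambda>_. \<zero>"])
      (use sets_ne p2_iff in \<open>auto intro!: bf bf_ble simp: some_in_eq\<close>)
  from cf_comp[OF this assms] show ?thesis .
qed

lemma cf_binary:
  assumes "\<And>e. tval M e t = h (e 2) (e 3)" "cf f" "cf g"
  shows "cf (\<lambda>x. h (f x) (g x))"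
proof -
  let ?\<theta> = "FOr (ble 2 0 (ble 3 0 (FAnd (FEq (TVar 0) (tpair (TVar 2) (TVar 3))) (FEq (TVar 1) t))))
    (FAnd (FEq (TVar 1) TZero) (FNeg (ble 2 0 (ble 3 0 (FEq (TVar 0) (tpair (TVar 2) (TVar 3)))))))"
  have "cf (\<lambda>z. if \<exists>i j. z = pr i j then h (p1 z) (p2 z) else \<zero>)"
  proof (rule cf_bounded[of ?\<theta> "\<lambda>_. SOME S. S \<in> sets2 M" "\<lambda>_. \<zero>"])
    fix x y
    show "sat M ((\<lambda>_. \<zero>)(0 := x, 1 := y)) (\<lambda>_. SOME S. S \<in> sets2 M) ?\<theta> \<longleftrightarrow>
      y = (if \<exists>i j. x = pr i j then h (p1 x) (p2 x) else \<zero>)"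
    proof (cases "\<exists>i j. x = pr i j")
      case True
      then obtain i j where "x = pr i j" by blast
      then show ?thesis using assms(1) fst_leq_pr[of i j] snd_leq_pr[of j i] by auto
    qed (use assms(1) in simp)
  qed (use sets_ne in \<open>auto intro!: bf bf_ble simp: some_in_eq\<close>)
  from cf_comp[OF this cf_pr[OF assms(2,3)]] show ?thesis by simp
qed

lemma cf_add [dcf]: "cf f \<Longrightarrow> cf g \<Longrightarrow> cf (\<lambda>x. f x \<oplus> g x)"
  by (rule cf_binary[of "TAdd (TVar 2) (TVar 3)"]) simp_all

lemma cf_mul [dcf]: "cf f \<Longrightarrow> cf g \<Longrightarrow> cf (\<lambda>x. f x \<otimes> g x)"
  by (rule cf_binary[of "TMul (TVar 2) (TVar 3)"]) simp_all

lemma dec_const [dcf]: "dec (\<lambda>x. c)"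
  by (rule dec_bounded[of "if c then FEq TZero TZero else FNeg (FEq TZero TZero)"
        "\<lambda>_. SOME S. S \<in> sets2 M" "\<lambda>_. \<zero>" 0])
    (use sets_ne in \<open>auto intro!: bf simp: some_in_eq\<close>)

lemma dec_mem [dcf]: "A \<in> sets2 M \<Longrightarrow> cf f \<Longrightarrow> dec (\<lambda>x. f x \<in> A)"
  by (rule dec_comp[of "\<lambda>x. x \<in> A"]) (simp_all add: dec_def)

lemma dec_binary:
  assumes "bounded_form \<theta>" "\<And>e E. sat M e E \<theta> \<longleftrightarrow> h (e 2) (e 3)" "cf f" "cf g"
  shows "dec (\<lambda>x. h (f x) (g x))"
proof -
  have "dec (\<lambda>z. \<exists>i j. i \<preceq> z \<and> j \<preceq> z \<and> z = pr i j \<and> h i j)"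
    by (rule dec_bounded[of "ble 2 0 (ble 3 0 (FAnd (FEq (TVar 0) (tpair (TVar 2) (TVar 3))) \<theta>))"
        "\<lambda>_. SOME S. S \<in> sets2 M" "\<lambda>_. \<zero>" 0])
      (use sets_ne assms(1,2) fst_leq_pr snd_leq_pr in \<open>auto intro!: bf bf_ble simp: some_in_eq\<close>)
  from dec_comp[OF this cf_pr[OF assms(3,4)]] show ?thesis using fst_leq_pr snd_leq_pr by simp
qed

lemma dec_eq [dcf]: "cf f \<Longrightarrow> cf g \<Longrightarrow> dec (\<lambda>x. f x = g x)"
  by (rule dec_binary[of "FEq (TVar 2) (TVar 3)"]) (auto intro: bf)

lemma dec_less [dcf]: "cf f \<Longrightarrow> cf g \<Longrightarrow> dec (\<lambda>x. f x \<prec> g x)"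
  by (rule dec_binary[of "FLt (TVar 2) (TVar 3)"]) (auto intro: bf)

lemma dec_leq [dcf]: assumes "cf f" "cf g" shows "dec (\<lambda>x. f x \<preceq> g x)"
  unfolding leq2_def by (intro dcf assms)

lemma dec_related [dcf]: "S \<in> sets2 M \<Longrightarrow> cf f \<Longrightarrow> cf g \<Longrightarrow> dec (\<lambda>x. related M S (f x) (g x))"
  unfolding related_def by (intro dcf)

lemma dec_comp2:
  assumes "dec (\<lambda>z. P (p1 z) (p2 z))" "cf f" "cf g" shows "dec (\<lambda>x. P (f x) (g x))"
  using dec_comp[OF assms(1) cf_pr[OF assms(2,3)]] by simp

text \<open>The bound \<open>f x\<close> is not a term of the language. A variable for its value is
  introduced in the two ways of \<open>dec_comp\<close>, and \<open>y\<close> is bounded by that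
  variable.\<close>

lemma dec_ball [dcf]:
  assumes "dec (\<lambda>z. P (p1 z) (p2 z))" "cf f"
  shows "dec (\<lambda>x. \<forall>y. y \<prec> f x \<longrightarrow> P x y)"
proof -
  obtain S where S: "S \<in> sets2 M" "\<forall>x. x \<in> S \<longleftrightarrow> P (p1 x) (p2 x)" using assms(1) by (rule decE)
  obtain T where T: "T \<in> sets2 M" "\<forall>x y. pr x y \<in> T \<longleftrightarrow> y = f x" using assms(2) by (rule cfE)
  show ?thesis
    by (rule dec_delta[of "FAnd (FMem (tpair (TVar 0) (TVar 1)) 1) (blt 2 1 (FMem (tpair (TVar 0) (TVar 2)) 0))"
          "FImp (FMem (tpair (TVar 0) (TVar 1)) 1) (blt 2 1 (FMem (tpair (TVar 0) (TVar 2)) 0))"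
          "\<lambda>i. if i = 0 then S else T" "\<lambda>_. \<zero>" 0 1])
      (use S T in \<open>auto intro!: bf bf_blt\<close>)
qed

lemma dec_bex [dcf]:
  assumes "dec (\<lambda>z. P (p1 z) (p2 z))" "cf f"
  shows "dec (\<lambda>x. \<exists>y. y \<prec> f x \<and> P x y)"
  using dec_not[OF dec_ball[OF dec_not[OF assms(1)] assms(2)]] by simp

lemma dec_ball_leq [dcf]:
  assumes "dec (\<lambda>z. P (p1 z) (p2 z))" "cf f"
  shows "dec (\<lambda>x. \<forall>y. y \<preceq> f x \<longrightarrow> P x y)"
  using dec_ball[OF assms(1), of "\<lambda>x. f x \<oplus> \<one>"] cf_add[OF assms(2) cf_const] by simp

lemma dec_bex_leq [dcf]:
  assumes "dec (\<lambda>z. P (p1 z) (p2 z))" "cf f"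
  shows "dec (\<lambda>x. \<exists>y. y \<preceq> f x \<and> P x y)"
  using dec_bex[OF assms(1), of "\<lambda>x. f x \<oplus> \<one>"] cf_add[OF assms(2) cf_const] by simp

lemma dec_ball_mem [dcf]:
  assumes "dec (\<lambda>z. p2 z \<in> A (p1 z))" "dec (\<lambda>z. P (p1 z) (p2 z))" "cf f" "\<And>x y. y \<in> A x \<Longrightarrow> y \<prec> f x"
  shows "dec (\<lambda>x. \<forall>y\<in>A x. P x y)"
proof -
  have "dec (\<lambda>x. \<forall>y. y \<prec> f x \<longrightarrow> y \<in> A x \<longrightarrow> P x y)" by (intro dcf assms)
  moreover have "(\<forall>y. y \<prec> f x \<longrightarrow> y \<in> A x \<longrightarrow> P x y) \<longleftrightarrow> (\<forall>y\<in>A x. P x y)" for x using assms(4) by blast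
  ultimately show ?thesis by simp
qed

section \<open>Induction, least numbers and search\<close>

lemma ind [consumes 1, case_names zero succ]:
  assumes "dec P" "P \<zero>" "\<And>n. P n \<Longrightarrow> P (n \<oplus> \<one>)"
  shows "P n"
  using set_induct[of "{x. P x}"] assms unfolding dec_def by simp

lemma sind [consumes 1, case_names zero succ]:
  assumes "dec (\<lambda>z. P (p1 z) (p2 z))" "\<exists>y. P \<zero> y" "\<And>n y. P n y \<Longrightarrow> \<exists>y. P (n \<oplus> \<one>) y"
  shows "\<exists>y. P n y"
proof -
  obtain S where S: "S \<in> sets2 M" "\<forall>x. x \<in> S \<longleftrightarrow> P (p1 x) (p2 x)" using assms(1) by (rule decE)
  have "\<exists>a. sat M ((\<lambda>_. \<zero>)(0 := n, 1 := a)) (\<lambda>_. S) (FMem (tpair (TVar 0) (TVar 1)) 0)"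
    by (rule sigma_induct) (use S assms(2,3) in \<open>auto intro: bf\<close>)
  then show ?thesis using S by simp
qed

lemma strong_ind [consumes 1, case_names less]:
  assumes "dec P" "\<And>n. (\<And>m. m \<prec> n \<Longrightarrow> P m) \<Longrightarrow> P n"
  shows "P n"
proof -
  have "dec (\<lambda>n. \<forall>m. m \<prec> n \<longrightarrow> P m)" by (intro dcf dec_comp[OF assms(1)])
  then have "\<forall>m. m \<prec> n \<oplus> \<one> \<longrightarrow> P m"
    by (rule ind[where P = "\<lambda>n. \<forall>m. m \<prec> n \<longrightarrow> P m"]) (use assms(2) in \<open>auto simp: leq2_def\<close>)
  then show ?thesis by (simp add: leq2_def)
qed

lemma least:
  assumes "dec P" "P a" shows "\<exists>m. P m \<and> (\<forall>k. k \<prec> m \<longrightarrow> \<not> P k)"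
proof (rule ccontr)
  assume "\<not> ?thesis"
  then have "\<not> P a" using strong_ind[OF dec_not[OF assms(1)], of a] by blast
  with assms(2) show False by simp
qed

text \<open>The class of witnessed numbers need not be a set of the model, so \<open>least\<close>
  does not apply. Without a least element one could descend from \<open>a\<close> any number
  \<open>j\<close> of times. That a witnessed number plus \<open>j\<close> is at most
  \<open>a\<close> is a \<open>\<Sigma>\<^sup>0\<^sub>1\<close> claim in \<open>j\<close>, hence
  inductive, but it fails at \<open>a \<oplus> \<one>\<close>.\<close>

lemma least_sigma:
  assumes "dec (\<lambda>z. P (p1 z) (p2 z))" "P a b"
  shows "\<exists>m. (\<exists>y. P m y) \<and> (\<forall>k y. k \<prec> m \<longrightarrow> \<not> P k y)"
proof (rule ccontr)
  assume "\<not> ?thesis"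
  then have no: "\<exists>k y'. k \<prec> m \<and> P k y'" if "P m y" for m y using that by blast
  have "dec (\<lambda>z. P (p1 (p2 z)) (p2 (p2 z)) \<and> p1 (p2 z) \<oplus> p1 z \<preceq> a)"
    by (intro dcf dec_comp2[OF assms(1)])
  then have "\<exists>u. P (p1 u) (p2 u) \<and> p1 u \<oplus> j \<preceq> a" for j
  proof (rule sind[where P="\<lambda>j u. P (p1 u) (p2 u) \<and> p1 u \<oplus> j \<preceq> a"])
    show "\<exists>y. P (p1 y) (p2 y) \<and> p1 y \<oplus> \<zero> \<preceq> a"
      using assms(2) by (intro exI[of _ "pr a b"]) simp
    fix n u assume u: "P (p1 u) (p2 u) \<and> p1 u \<oplus> n \<preceq> a"
    then obtain k y where k: "k \<prec> p1 u" "P k y" using no by blast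
    then have "k \<oplus> n \<prec> p1 u \<oplus> n" by simp
    then have "k \<oplus> (n \<oplus> \<one>) \<preceq> a" using u by (metis add_succ succ_leq ar.less_le_trans)
    then show "\<exists>y. P (p1 y) (p2 y) \<and> p1 y \<oplus> (n \<oplus> \<one>) \<preceq> a"
      using k by (intro exI[of _ "pr k y"]) simp
  qed
  from this[of "a \<oplus> \<one>"] obtain u where "p1 u \<oplus> (a \<oplus> \<one>) \<preceq> a" by blast
  then have "a \<oplus> \<one> \<preceq> a" using leq_add(2) leq_trans by blast
  then show False by (simp add: succ_leq)
qed

definition mu :: "('a \<Rightarrow> bool) \<Rightarrow> 'a" where "mu P = (THE y. P y \<and> (\<forall>z. z \<prec> y \<longrightarrow> \<not> P z))"

lemma mu_iff:
  assumes "dec P" "P a" shows "y = mu P \<longleftrightarrow> P y \<and> (\<forall>z. z \<prec> y \<longrightarrow> \<not> P z)"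
proof -
  have "\<exists>!y. P y \<and> (\<forall>z. z \<prec> y \<longrightarrow> \<not> P z)"
    using least[OF assms] less_lin by metis
  from theI'[OF this] this show ?thesis unfolding mu_def by blast
qed

lemma dec_section: assumes "dec (\<lambda>z. P (p1 z) (p2 z))" shows "dec (P x)"
  using dec_comp2[OF assms cf_const cf_id] .

lemma cf_mu:
  assumes "dec (\<lambda>z. P (p1 z) (p2 z))" "\<And>x. \<exists>y. P x y"
  shows "cf (\<lambda>x. mu (P x))"
proof -
  have "dec (\<lambda>z. P (p1 z) (p2 z) \<and> (\<forall>w. w \<prec> p2 z \<longrightarrow> \<not> P (p1 z) w))"
    by (intro dcf dec_comp2[OF assms(1)])
  then obtain S where S: "S \<in> sets2 M" "\<forall>z. z \<in> S \<longleftrightarrow> P (p1 z) (p2 z) \<and> (\<forall>w. w \<prec> p2 z \<longrightarrow> \<not> P (p1 z) w)"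
    by (rule decE)
  have "pr x y \<in> S \<longleftrightarrow> y = mu (P x)" for x y
  proof -
    obtain a where "P x a" using assms(2) by blast
    from mu_iff[OF dec_section[OF assms(1), of x] this, of y] S(2) show ?thesis by simp
  qed
  with S(1) show ?thesis unfolding cf_def by blast
qed

lemma mu_prop:
  assumes "dec (\<lambda>z. P (p1 z) (p2 z))" "\<exists>y. P x y"
  shows "P x (mu (P x))"
  using mu_iff[OF dec_section[OF assms(1)]] assms(2) by blast

lemma cf_if [dcf]:
  assumes "dec P" "cf f" "cf g" shows "cf (\<lambda>x. if P x then f x else g x)"
proof -
  have "dec (\<lambda>z. (P (p1 z) \<and> p2 z = f (p1 z)) \<or> (\<not> P (p1 z) \<and> p2 z = g (p1 z)))"
    by (intro dcf dec_comp[OF assms(1)] cf_comp[OF assms(2)] cf_comp[OF assms(3)])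
  then obtain S where "S \<in> sets2 M"
    "\<forall>z. z \<in> S \<longleftrightarrow> (P (p1 z) \<and> p2 z = f (p1 z)) \<or> (\<not> P (p1 z) \<and> p2 z = g (p1 z))" by (rule decE)
  then show ?thesis unfolding cf_def by (intro bexI[of _ S]) auto
qed

section \<open>Finite sets and primitive recursion\<close>

text \<open>The modulus is positive, so the cofactor \<open>d\<close> is at most the product and
  hence at most \<open>c\<close>. Membership in a coded set is thereby decidable.\<close>

lemma fset_iff:
  "i \<in> fset2 M c \<longleftrightarrow> c = pr (p1 c) (pr (p1 (p2 c)) (p2 (p2 c))) \<and> i \<prec> p1 c \<and>
     (\<exists>d. d \<preceq> c \<and> p2 (p2 c) = (p1 (p2 c) \<otimes> (i \<oplus> \<one>) \<oplus> \<one>) \<otimes> d)"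
proof
  assume "i \<in> fset2 M c"
  then obtain k m n d where *: "c = pr k (pr m n)" "i \<prec> k" "n = (m \<otimes> (i \<oplus> \<one>) \<oplus> \<one>) \<otimes> d"
    unfolding fset2_def by blast
  have "d \<preceq> n" unfolding *(3) ar.distrib_right using leq_add(2)[of d] by simp
  also have "n \<preceq> c" unfolding *(1) using snd_leq_pr leq_trans by blast
  finally show "c = pr (p1 c) (pr (p1 (p2 c)) (p2 (p2 c))) \<and> i \<prec> p1 c \<and>
     (\<exists>d. d \<preceq> c \<and> p2 (p2 c) = (p1 (p2 c) \<otimes> (i \<oplus> \<one>) \<oplus> \<one>) \<otimes> d)" using * by auto
qed (auto simp: fset2_def)

lemma dec_fset [dcf]: assumes "cf f" "cf g" shows "dec (\<lambda>x. f x \<in> fset2 M (g x))"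
  unfolding fset_iff by (intro dcf cf_comp[OF assms(1)] cf_comp[OF assms(2)])

lemma fset_less: "i \<in> fset2 M c \<Longrightarrow> i \<prec> c"
  unfolding fset_iff using p1_leq ar.less_le_trans by blast

lemma dec_bfset [dcf]:
  assumes "dec (\<lambda>z. P (p1 z) (p2 z))" "cf f"
  shows "dec (\<lambda>x. \<forall>y\<in>fset2 M (f x). P x y)"
  by (intro dec_ball_mem[where f = f] assms dcf cf_comp[OF assms(2)] fset_less)

lemma dec_bexfset [dcf]:
  assumes "dec (\<lambda>z. P (p1 z) (p2 z))" "cf f"
  shows "dec (\<lambda>x. \<exists>y\<in>fset2 M (f x). P x y)"
  using dec_not[OF dec_bfset[OF dec_not[OF assms(1)] assms(2)]] by simp

section \<open>Divisibility and codes of finite sets\<close>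

definition dv :: "'a \<Rightarrow> 'a \<Rightarrow> bool" where "dv a b \<longleftrightarrow> (\<exists>d. d \<preceq> b \<and> b = a \<otimes> d)"

lemma dv_iff: "\<zero> \<prec> a \<Longrightarrow> dv a b \<longleftrightarrow> (\<exists>d. b = a \<otimes> d)"
proof -
  assume "\<zero> \<prec> a"
  then obtain e where e: "a = e \<oplus> \<one>" unfolding less_iff_ex by auto
  have "d \<preceq> a \<otimes> d" for d unfolding e ar.distrib_right using leq_add(2)[of d] by simp
  then show ?thesis unfolding dv_def by auto
qed

lemma dec_dv [dcf]: assumes "cf f" "cf g" shows "dec (\<lambda>x. dv (f x) (g x))"
  unfolding dv_def by (intro dcf cf_comp[OF assms(1)] cf_comp[OF assms(2)])

text \<open>Plays the role of the factorial of \<open>k\<close>, built by multiplying with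
  \<open>n \<oplus> \<one>\<close> at each step. As the \<open>m\<close> of a set code it is
  divisible by all distances between indices below \<open>k\<close>.\<close>

lemma ex_common_multiple: "\<exists>m. \<zero> \<prec> m \<and> (\<forall>j. j \<prec> k \<longrightarrow> dv (j \<oplus> \<one>) m)"
proof (rule sind[where P = "\<lambda>k m. \<zero> \<prec> m \<and> (\<forall>j. j \<prec> k \<longrightarrow> dv (j \<oplus> \<one>) m)"])
  show "dec (\<lambda>z. \<zero> \<prec> p2 z \<and> (\<forall>j. j \<prec> p1 z \<longrightarrow> dv (j \<oplus> \<one>) (p2 z)))" by (intro dcf)
  show "\<exists>y. \<zero> \<prec> y \<and> (\<forall>j. j \<prec> \<zero> \<longrightarrow> dv (j \<oplus> \<one>) y)" using zero_one by (intro exI[of _ \<one>]) simp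
next
  fix n y assume y: "\<zero> \<prec> y \<and> (\<forall>j. j \<prec> n \<longrightarrow> dv (j \<oplus> \<one>) y)"
  have pos: "\<zero> \<prec> j \<oplus> \<one>" for j by simp
  have "dv (j \<oplus> \<one>) (y \<otimes> (n \<oplus> \<one>))" if "j \<prec> n \<oplus> \<one>" for j
  proof (cases "j = n")
    case False
    with that y have "dv (j \<oplus> \<one>) y" by (auto simp: leq2_def)
    then show ?thesis unfolding dv_iff[OF pos] by (metis mul_ass)
  qed (auto simp: dv_iff[OF pos] mul_comm)
  moreover have "\<zero> \<prec> y \<otimes> (n \<oplus> \<one>)" using y by (intro ar.mult_pos_pos) simp_all
  ultimately show "\<exists>y. \<zero> \<prec> y \<and> (\<forall>j. j \<prec> n \<oplus> \<one> \<longrightarrow> dv (j \<oplus> \<one>) y)" by blast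
qed

text \<open>Replaces subtraction in the Bezout argument: comparing the products shows that
  \<open>x\<close> is at most \<open>y\<close>, and their difference is the cofactor of
  \<open>n\<close>.\<close>

lemma dv_cancel_aux:
  assumes "\<zero> \<prec> a" "n \<oplus> a \<otimes> x = a \<otimes> y" shows "dv a n"
proof -
  have "a \<otimes> x \<preceq> a \<otimes> y" using assms(2) leq_add(2) by metis
  then have "x \<preceq> y" using mul_less[OF _ assms(1)] ar.not_le by blast
  then obtain z where z: "y = x \<oplus> z" unfolding leq_iff_ex by blast
  have "a \<otimes> x \<oplus> n = a \<otimes> x \<oplus> a \<otimes> z" using assms(2) unfolding z distrib by (simp add: add_comm)
  then show ?thesis unfolding dv_iff[OF assms(1)] add_cancel_left by blast
qed

text \<open>
  The moduli in the coding of finite sets are pairwise coprime: for \<open>I = i + 1\<close>, \<open>J = j + 1\<close>, and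
  \<open>m = D m'\<close> with \<open>D\<close> the distance of \<open>I\<close> and \<open>J\<close>, both identities \<open>id\<close> in the proof are Bezout
  relations between \<open>m I + 1\<close> and \<open>m J + 1\<close>, with terms moved so that no subtraction occurs.
\<close>

lemma dv_coprime:
  assumes "i \<noteq> j" "i \<prec> k" "j \<prec> k" and m: "\<And>j. j \<prec> k \<Longrightarrow> dv (j \<oplus> \<one>) m"
    and dv: "dv (m \<otimes> (i \<oplus> \<one>) \<oplus> \<one>) (n \<otimes> (m \<otimes> (j \<oplus> \<one>) \<oplus> \<one>))"
  shows "dv (m \<otimes> (i \<oplus> \<one>) \<oplus> \<one>) n"
proof -
  define I J where IJ: "I = i \<oplus> \<one>" "J = j \<oplus> \<one>"
  have pos: "\<zero> \<prec> m \<otimes> I \<oplus> \<one>" by simp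
  obtain e where e: "n \<otimes> (m \<otimes> J \<oplus> \<one>) = (m \<otimes> I \<oplus> \<one>) \<otimes> e"
    using dv unfolding IJ dv_def by blast
  have "\<exists>x y. n \<oplus> (m \<otimes> I \<oplus> \<one>) \<otimes> x = (m \<otimes> I \<oplus> \<one>) \<otimes> y"
  proof (cases "i \<prec> j")
    case True
    then obtain d where "j = i \<oplus> (d \<oplus> \<one>)" unfolding less_iff_ex by blast
    moreover from this have "d \<prec> k" using assms(3) leq_add(1)[of d "\<one>"] leq_add(2)[of "d \<oplus> \<one>" i]
      by (meson ar.le_less_trans)
    then obtain m' where "m = (d \<oplus> \<one>) \<otimes> m'" using m unfolding dv_def by blast
    moreover define D where "D = d \<oplus> \<one>"
    ultimately have J: "J = I \<oplus> D" and m': "m = D \<otimes> m'" by (simp_all add: IJ algebra_simps)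
    have id: "\<one> \<oplus> (m \<otimes> I \<oplus> \<one>) \<otimes> (m' \<otimes> I \<otimes> J) = (m \<otimes> I \<oplus> \<one>) \<oplus> (m' \<otimes> I \<otimes> I) \<otimes> (m \<otimes> J \<oplus> \<one>)"
      unfolding J m' by (simp add: algebra_simps)
    have "n \<oplus> (m \<otimes> I \<oplus> \<one>) \<otimes> (n \<otimes> (m' \<otimes> I \<otimes> J)) = n \<otimes> (\<one> \<oplus> (m \<otimes> I \<oplus> \<one>) \<otimes> (m' \<otimes> I \<otimes> J))"
      by (simp add: algebra_simps)
    also have "\<dots> = n \<otimes> (m \<otimes> I \<oplus> \<one>) \<oplus> (m' \<otimes> I \<otimes> I) \<otimes> (n \<otimes> (m \<otimes> J \<oplus> \<one>))"
      unfolding id by (simp add: algebra_simps)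
    also have "\<dots> = (m \<otimes> I \<oplus> \<one>) \<otimes> (n \<oplus> (m' \<otimes> I \<otimes> I) \<otimes> e)"
      unfolding e by (simp add: algebra_simps)
    finally show ?thesis by blast
  next
    case False
    then have "j \<prec> i" using assms(1) less_lin by blast
    then obtain d where "i = j \<oplus> (d \<oplus> \<one>)" unfolding less_iff_ex by blast
    moreover from this have "d \<prec> k" using assms(2) leq_add(1)[of d "\<one>"] leq_add(2)[of "d \<oplus> \<one>" j]
      by (meson ar.le_less_trans)
    then obtain m' where "m = (d \<oplus> \<one>) \<otimes> m'" using m unfolding dv_def by blast
    moreover define D where "D = d \<oplus> \<one>"
    ultimately have I: "I = J \<oplus> D" and m': "m = D \<otimes> m'" by (simp_all add: IJ algebra_simps)
    have id: "\<one> \<oplus> (m' \<otimes> I \<otimes> I) \<otimes> (m \<otimes> J \<oplus> \<one>) = (m \<otimes> I \<oplus> \<one>) \<otimes> (\<one> \<oplus> m' \<otimes> I \<otimes> J)"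
      unfolding I m' by (simp add: algebra_simps)
    have "n \<oplus> (m \<otimes> I \<oplus> \<one>) \<otimes> ((m' \<otimes> I \<otimes> I) \<otimes> e) = n \<oplus> (m' \<otimes> I \<otimes> I) \<otimes> ((m \<otimes> I \<oplus> \<one>) \<otimes> e)"
      by (simp add: algebra_simps)
    also have "\<dots> = n \<otimes> (\<one> \<oplus> (m' \<otimes> I \<otimes> I) \<otimes> (m \<otimes> J \<oplus> \<one>))"
      unfolding e[symmetric] by (simp add: algebra_simps)
    also have "\<dots> = (m \<otimes> I \<oplus> \<one>) \<otimes> (n \<otimes> (\<one> \<oplus> m' \<otimes> I \<otimes> J))"
      unfolding id by (simp add: algebra_simps)
    finally show ?thesis by blast
  qed
  then show ?thesis using dv_cancel_aux[OF pos] unfolding IJ by blast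
qed

text \<open>Goedel's coding: \<open>n\<close> acts as the product of the moduli \<open>a i\<close>
  over the \<open>i\<close> with \<open>P i\<close>. By coprimality a new factor \<open>a j\<close>
  does not affect divisibility by the other moduli with index below \<open>k\<close>.\<close>

lemma finite_set_code:
  assumes "dec P" shows "\<exists>c. fset2 M c = {i. i \<prec> k \<and> P i}"
proof -
  obtain m where m: "\<zero> \<prec> m" "\<And>j. j \<prec> k \<Longrightarrow> dv (j \<oplus> \<one>) m" using ex_common_multiple by blast
  define a where "a i = m \<otimes> (i \<oplus> \<one>) \<oplus> \<one>" for i
  have apos: "\<zero> \<prec> a i" for i unfolding a_def by simp
  have a1: "\<one> \<prec> a i" for i unfolding a_def using m(1) by (simp add: distrib mul_one ar.add_nonneg_pos)
  \<comment> \<open>\<open>k\<close> is fixed, while the indices below \<open>j\<close> have been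
    treated. The start is \<open>\<one>\<close>, which no modulus divides, since all exceed
    \<open>\<one>\<close>.\<close>
  have "\<exists>n. \<forall>i. i \<prec> k \<longrightarrow> (dv (a i) n \<longleftrightarrow> i \<prec> j \<and> P i)" for j
  proof (rule sind[where P = "\<lambda>j n. \<forall>i. i \<prec> k \<longrightarrow> (dv (a i) n \<longleftrightarrow> i \<prec> j \<and> P i)"])
    show "dec (\<lambda>z. \<forall>i. i \<prec> k \<longrightarrow> (dv (a i) (p2 z) \<longleftrightarrow> i \<prec> p1 z \<and> P i))"
      unfolding a_def by (intro dcf dec_comp[OF assms])
    have "\<not> dv (a i) \<one>" for i
    proof
      assume "dv (a i) \<one>"
      then obtain d where d: "\<one> = a i \<otimes> d" unfolding dv_def by blast
      then have "d \<noteq> \<zero>" by auto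
      then obtain b where "d = b \<oplus> \<one>" using zero_or_succ by blast
      then have "a i \<otimes> d = a i \<otimes> b \<oplus> a i" by (simp only: mul_succ)
      then have "a i \<preceq> \<one>" unfolding d[symmetric] using leq_add(2)[of "a i" "a i \<otimes> b"] by simp
      with a1 show False using ar.not_le by blast
    qed
    then show "\<exists>y. \<forall>i. i \<prec> k \<longrightarrow> dv (a i) y = (i \<prec> \<zero> \<and> P i)" by auto
  next
    fix j n assume n: "\<forall>i. i \<prec> k \<longrightarrow> (dv (a i) n \<longleftrightarrow> i \<prec> j \<and> P i)"
    show "\<exists>y. \<forall>i. i \<prec> k \<longrightarrow> dv (a i) y = (i \<prec> j \<oplus> \<one> \<and> P i)"
    proof (cases "j \<prec> k \<and> P j")
      case False
      then show ?thesis using n by (intro exI[of _ n]) (auto simp: leq2_def)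
    next
      case True
      have "dv (a i) (n \<otimes> a j) \<longleftrightarrow> i \<prec> j \<oplus> \<one> \<and> P i" if "i \<prec> k" for i
      proof (cases "i = j")
        case True
        then show ?thesis using \<open>j \<prec> k \<and> P j\<close> unfolding dv_iff[OF apos] by (auto simp: mul_comm)
      next
        case False
        have "dv (a i) (n \<otimes> a j) \<longleftrightarrow> dv (a i) n"
        proof
          assume "dv (a i) n"
          then show "dv (a i) (n \<otimes> a j)" unfolding dv_iff[OF apos] by (metis mul_ass)
        qed (use dv_coprime[OF False that _ m(2)] True in \<open>simp add: a_def\<close>)
        then show ?thesis using n that False by (auto simp: leq2_def)
      qed
      then show ?thesis by blast
    qed
  qed
  then obtain n where n: "\<And>i. i \<prec> k \<Longrightarrow> dv (a i) n \<longleftrightarrow> i \<prec> k \<and> P i" by blast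
  have "fset2 M (pr k (pr m n)) = {i. i \<prec> k \<and> (\<exists>d. n = a i \<otimes> d)}"
    unfolding fset2_def a_def by simp
  then show ?thesis using n dv_iff[OF apos] by (intro exI[of _ "pr k (pr m n)"]) auto
qed

lemma finite_set_code':
  assumes "dec P" "\<And>i. P i \<Longrightarrow> i \<prec> k" shows "\<exists>c. fset2 M c = {i. P i}"
proof -
  have "{i. i \<prec> k \<and> P i} = {i. P i}" using assms(2) by blast
  with finite_set_code[OF assms(1), of k] show ?thesis by simp
qed

lemma cf_finite_set:
  assumes "dec (\<lambda>z. P (p1 z) (p2 z))" "cf b"
  obtains C where "cf C" "\<forall>x. fset2 M (C x) = {y. y \<prec> b x \<and> P x y}"
proof -
  \<comment> \<open>Elements of a coded set lie below its code, so agreement below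
    \<open>b x \<oplus> c\<close> is equality of the two sets. This makes equality decidable and
    \<open>c\<close> searchable.\<close>
  define Q where "Q x c \<longleftrightarrow> (\<forall>y. y \<prec> b x \<oplus> c \<longrightarrow> (y \<in> fset2 M c \<longleftrightarrow> y \<prec> b x \<and> P x y))" for x c
  have Q: "Q x c \<longleftrightarrow> fset2 M c = {y. y \<prec> b x \<and> P x y}" for x c
    unfolding Q_def using fset_less[of _ c] leq_add[of c "b x"] leq_add[of "b x" c] ar.less_le_trans by blast
  have dQ: "dec (\<lambda>z. Q (p1 z) (p2 z))"
    unfolding Q_def by (intro dcf dec_comp2[OF assms(1)] cf_comp[OF assms(2)])
  have ex: "\<exists>c. Q x c" for x unfolding Q by (intro finite_set_code dec_section[OF assms(1)])
  show ?thesis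
    using that[OF cf_mu[OF dQ ex]] mu_prop[OF dQ ex] unfolding Q by blast
qed

lemma fset_insert: "\<exists>c'. fset2 M c' = insert u (fset2 M c)"
proof -
  have "dec (\<lambda>y. y = u \<or> y \<in> fset2 M c)" by (intro dcf)
  moreover have "y \<prec> c \<oplus> u \<oplus> \<one>" if "y = u \<or> y \<in> fset2 M c" for y
    unfolding less_succ_leq using that fset_less leq_add(1)[of c u] leq_add(2)[of u c]
    by (metis ar.less_imp_le leq_trans)
  ultimately have "\<exists>c'. fset2 M c' = {y. y = u \<or> y \<in> fset2 M c}" by (rule finite_set_code')
  then show ?thesis unfolding insert_compr .
qed

lemma fset_zero: "\<exists>c. fset2 M c = {}"
  using finite_set_code[of "\<lambda>_. False" \<zero>] by (simp add: dcf)

text \<open>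
  \<open>C p w\<close> says that \<open>w\<close> is a computation history: a finite set of pairs (argument, value) in which
  each pair is justified by an earlier one.
\<close>

lemma prim_rec:
  assumes A: "cf A" and F: "cf F"
  obtains h where "cf h" "\<forall>p. h (pr p \<zero>) = A p"
    "\<forall>p n. h (pr p (n \<oplus> \<one>)) = F (pr p (pr n (h (pr p n))))"
proof -
  define C where "C p w \<longleftrightarrow> (\<forall>u\<in>fset2 M w. u = pr (p1 u) (p2 u) \<and> (p1 u = \<zero> \<and> p2 u = A p \<or>
    (\<exists>i. i \<prec> u \<and> (\<exists>v\<in>fset2 M w. p1 u = i \<oplus> \<one> \<and> v = pr i (p2 v) \<and> p2 u = F (pr p v)))))" for p w
  have dC: "dec (\<lambda>x. C (f x) (g x))" if "cf f" "cf g" for f g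
    unfolding C_def by (intro dcf cf_comp[OF A] cf_comp[OF F] cf_comp[OF that(1)] cf_comp[OF that(2)])
  \<comment> \<open>Two histories agree on common arguments. The bounds on \<open>v\<close> and
    \<open>v'\<close> follow from membership and make the claim decidable, as \<open>ind\<close>
    requires.\<close>
  have uniq: "\<forall>v. v \<prec> w \<longrightarrow> (\<forall>v'. v' \<prec> w' \<longrightarrow> pr i v \<in> fset2 M w \<longrightarrow> pr i v' \<in> fset2 M w' \<longrightarrow> v = v')"
    if "C p w" "C p w'" for p w w' i
  proof (rule ind[where P = "\<lambda>i. \<forall>v. v \<prec> w \<longrightarrow> (\<forall>v'. v' \<prec> w' \<longrightarrow> pr i v \<in> fset2 M w \<longrightarrow> pr i v' \<in> fset2 M w' \<longrightarrow> v = v')"])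
    show "dec (\<lambda>i. \<forall>v. v \<prec> w \<longrightarrow> (\<forall>v'. v' \<prec> w' \<longrightarrow> pr i v \<in> fset2 M w \<longrightarrow> pr i v' \<in> fset2 M w' \<longrightarrow> v = v'))"
      by (intro dcf)
    have base: "v = A p" if "C p w" "pr \<zero> v \<in> fset2 M w" for v w
      using that(1)[unfolded C_def, rule_format, OF that(2)] succ_ne_zero by (auto dest: sym)
    show "\<forall>v. v \<prec> w \<longrightarrow> (\<forall>v'. v' \<prec> w' \<longrightarrow> pr \<zero> v \<in> fset2 M w \<longrightarrow> pr \<zero> v' \<in> fset2 M w' \<longrightarrow> v = v')"
      using base[OF that(1)] base[OF that(2)] by blast
  next
    fix n assume IH: "\<forall>v. v \<prec> w \<longrightarrow> (\<forall>v'. v' \<prec> w' \<longrightarrow> pr n v \<in> fset2 M w \<longrightarrow> pr n v' \<in> fset2 M w' \<longrightarrow> v = v')"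
    have step: "\<exists>v. v \<prec> w \<and> pr n v \<in> fset2 M w \<and> u = F (pr p (pr n v))"
      if "C p w" "pr (n \<oplus> \<one>) u \<in> fset2 M w" for u w
    proof -
      from that(1)[unfolded C_def, rule_format, OF that(2)]
      obtain v where "v \<in> fset2 M w" "v = pr n (p2 v)" "u = F (pr p v)" by auto
      then show ?thesis using fset_less[of v w] snd_leq_pr[of "p2 v" n] ar.le_less_trans by metis
    qed
    show "\<forall>v. v \<prec> w \<longrightarrow> (\<forall>v'. v' \<prec> w' \<longrightarrow> pr (n \<oplus> \<one>) v \<in> fset2 M w \<longrightarrow> pr (n \<oplus> \<one>) v' \<in> fset2 M w' \<longrightarrow> v = v')"
      using step[OF that(1)] step[OF that(2)] IH by metis
  qed
  have ex: "\<exists>u. C p (p1 u) \<and> pr n (p2 u) \<in> fset2 M (p1 u)" for p n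
  proof (rule sind[where P = "\<lambda>n u. C p (p1 u) \<and> pr n (p2 u) \<in> fset2 M (p1 u)"])
    show "dec (\<lambda>z. C p (p1 (p2 z)) \<and> pr (p1 z) (p2 (p2 z)) \<in> fset2 M (p1 (p2 z)))"
      by (intro dcf dC)
    obtain c where "fset2 M c = {}" using fset_zero by blast
    then obtain c' where "fset2 M c' = {pr \<zero> (A p)}" using fset_insert by metis
    then have "C p c'" "pr \<zero> (A p) \<in> fset2 M c'" unfolding C_def by simp_all
    then show "\<exists>u. C p (p1 u) \<and> pr \<zero> (p2 u) \<in> fset2 M (p1 u)" by (intro exI[of _ "pr c' (A p)"]) simp
  next
    fix n u assume u: "C p (p1 u) \<and> pr n (p2 u) \<in> fset2 M (p1 u)"
    let ?v = "F (pr p (pr n (p2 u)))"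
    obtain w where w: "fset2 M w = insert (pr (n \<oplus> \<one>) ?v) (fset2 M (p1 u))" using fset_insert by blast
    have "n \<prec> pr (n \<oplus> \<one>) ?v" using fst_leq_pr[of "n \<oplus> \<one>" ?v] succ_leq by blast
    then have "C p w" using u unfolding C_def w by fastforce
    then show "\<exists>y. C p (p1 y) \<and> pr (n \<oplus> \<one>) (p2 y) \<in> fset2 M (p1 y)"
      using w by (intro exI[of _ "pr w ?v"]) simp
  qed
  define R where "R x u \<longleftrightarrow> C (p1 x) (p1 u) \<and> pr (p2 x) (p2 u) \<in> fset2 M (p1 u)" for x u
  define h where "h x = p2 (mu (R x))" for x
  have dR: "dec (\<lambda>z. R (p1 z) (p2 z))" unfolding R_def by (intro dcf dC)
  have exR: "\<exists>u. R x u" for x unfolding R_def using ex by blast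
  have "cf h" unfolding h_def by (intro dcf cf_mu[OF dR exR])
  have h_eq: "h (pr p n) = v" if "C p w" "pr n v \<in> fset2 M w" for p n v w
  proof -
    from mu_prop[OF dR exR, of "pr p n"]
    have "C p (p1 (mu (R (pr p n))))" "pr n (h (pr p n)) \<in> fset2 M (p1 (mu (R (pr p n))))"
      unfolding R_def h_def by simp_all
    then show ?thesis using uniq[OF _ that(1), of "p1 (mu (R (pr p n)))" n] that(2)
      fset_less snd_leq_pr ar.le_less_trans by meson
  qed
  show ?thesis
  proof (rule that[OF \<open>cf h\<close>]; intro allI)
    fix p n
    obtain c where "fset2 M c = {}" using fset_zero by blast
    then obtain c' where "fset2 M c' = {pr \<zero> (A p)}" using fset_insert by metis
    then have "C p c'" "pr \<zero> (A p) \<in> fset2 M c'" unfolding C_def by simp_all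
    then show "h (pr p \<zero>) = A p" using h_eq by blast
    obtain w v where wv: "C p w" "pr (n \<oplus> \<one>) v \<in> fset2 M w" using ex by blast
    from wv(1)[unfolded C_def, rule_format, OF wv(2)]
    obtain x where "x \<in> fset2 M w" "x = pr n (p2 x)" "v = F (pr p x)" by auto
    then show "h (pr p (n \<oplus> \<one>)) = F (pr p (pr n (h (pr p n))))"
      using h_eq[OF wv] h_eq[OF wv(1), of n "p2 x"] by simp
  qed
qed

text \<open>Course-of-values recursion: a code of the part of \<open>S\<close> below
  \<open>n\<close> is computed by primitive recursion, inserting \<open>n\<close> whenever
  \<open>P\<close> accepts it. Both the set of trees and their order are defined this way.\<close>

lemma course_rec:
  assumes "dec (\<lambda>z. P (p1 z) (p2 z))"
  obtains S where "S \<in> sets2 M" "\<forall>n. \<exists>c. fset2 M c = {i. i \<prec> n \<and> i \<in> S} \<and> (n \<in> S \<longleftrightarrow> P n c)"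
proof -
  have "dec (\<lambda>z. p2 z \<in> fset2 M (p2 (p1 z)) \<or> p2 z = p1 (p1 z))" by (intro dcf)
  moreover have "cf (\<lambda>x. p2 x \<oplus> p1 x \<oplus> \<one>)" by (intro dcf)
  ultimately obtain C where C: "cf C"
    "\<forall>x. fset2 M (C x) = {y. y \<prec> p2 x \<oplus> p1 x \<oplus> \<one> \<and> (y \<in> fset2 M (p2 x) \<or> y = p1 x)}"
    by (rule cf_finite_set)
  have C_eq: "fset2 M (C (pr n c)) = insert n (fset2 M c)" for n c
    unfolding C(2)[rule_format] using fset_less[of _ c] leq_add(1)[of c n] leq_add(2)[of n c]
    by (auto simp del: ar.le_add_same_cancel1 ar.le_add_same_cancel2)
       (metis ar.less_imp_le leq_trans)
  obtain c0 where c0: "fset2 M c0 = {}" using fset_zero by blast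
  let ?F = "\<lambda>x. if P (p1 (p2 x)) (p2 (p2 x)) then C (p2 x) else p2 (p2 x)"
  have "cf ?F" by (intro dcf dec_comp2[OF assms] cf_comp[OF C(1)])
  with cf_const[of c0] obtain h where h: "cf h" "\<forall>p. h (pr p \<zero>) = c0"
    "\<forall>p n. h (pr p (n \<oplus> \<one>)) = ?F (pr p (pr n (h (pr p n))))"
    by (rule prim_rec)
  define H where "H n = h (pr \<zero> n)" for n
  have cH: "cf (\<lambda>x. H (f x))" if "cf f" for f
    unfolding H_def by (intro cf_comp[OF h(1)] dcf that)
  define S where "S = {n. P n (H n)}"
  have dS: "dec (\<lambda>n. P n (H n))" by (intro dec_comp2[OF assms] cH dcf)
  then have S: "S \<in> sets2 M" unfolding S_def dec_def .
  have "i \<in> fset2 M (H n) \<longleftrightarrow> i \<prec> n \<and> P i (H i)" for i n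
  proof (rule ind[where P = "\<lambda>n. i \<in> fset2 M (H n) \<longleftrightarrow> i \<prec> n \<and> P i (H i)"])
    show "dec (\<lambda>n. i \<in> fset2 M (H n) \<longleftrightarrow> i \<prec> n \<and> P i (H i))" by (intro dcf cH)
    show "i \<in> fset2 M (H \<zero>) \<longleftrightarrow> i \<prec> \<zero> \<and> P i (H i)" unfolding H_def using h(2) c0 by simp
    fix n assume IH: "i \<in> fset2 M (H n) \<longleftrightarrow> i \<prec> n \<and> P i (H i)"
    have "H (n \<oplus> \<one>) = (if P n (H n) then C (pr n (H n)) else H n)" unfolding H_def using h(3) by simp
    then show "i \<in> fset2 M (H (n \<oplus> \<one>)) \<longleftrightarrow> i \<prec> n \<oplus> \<one> \<and> P i (H i)"
      using IH C_eq by (auto simp: leq2_def)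
  qed
  then have "\<exists>c. fset2 M c = {i. i \<prec> n \<and> i \<in> S} \<and> (n \<in> S \<longleftrightarrow> P n c)" for n
    unfolding S_def by (intro exI[of _ "H n"]) auto
  with S that show ?thesis by blast
qed

section \<open>The weak order on trees\<close>

definition child :: "'a \<Rightarrow> 'a \<Rightarrow> bool" where "child s v \<longleftrightarrow> (\<exists>i. i \<prec> s \<and> entry2 M s i v)"

lemma child_iff: "child s v \<longleftrightarrow> (\<exists>i. entry2 M s i v)"
  unfolding child_def entry2_def using fset_less fst_leq_pr ar.le_less_trans by blast

lemma child_less: "child s v \<Longrightarrow> v \<prec> s"
  unfolding child_def entry2_def using fset_less snd_leq_pr ar.le_less_trans by blast

lemma child_less_pr: "child s v \<Longrightarrow> v \<prec> pr q s"
  using child_less snd_leq_pr ar.less_le_trans by blast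

lemma dec_child [dcf]: assumes "cf f" "cf g" shows "dec (\<lambda>x. child (f x) (g x))"
  unfolding child_def entry2_def by (intro dcf cf_comp[OF assms(1)] cf_comp[OF assms(2)] assms)

lemma fset_code_iff:
  "fset_code M c \<longleftrightarrow> (\<forall>d. d \<prec> c \<longrightarrow> (\<exists>i. i \<prec> c \<oplus> d \<and> \<not> (i \<in> fset2 M d \<longleftrightarrow> i \<in> fset2 M c)))"
proof -
  have "fset2 M d \<noteq> fset2 M c \<longleftrightarrow> (\<exists>i. i \<prec> c \<oplus> d \<and> \<not> (i \<in> fset2 M d \<longleftrightarrow> i \<in> fset2 M c))" for d
    using fset_less leq_add(1)[of c d] leq_add(2)[of d c] ar.less_le_trans by blast
  then show ?thesis unfolding fset_code_def by simp
qed

lemma dec_fset_code [dcf]: assumes "cf f" shows "dec (\<lambda>x. fset_code M (f x))"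
  unfolding fset_code_iff by (intro dcf cf_comp[OF assms] assms)

lemma is_seq_iff:
  "is_seq M s n \<longleftrightarrow> fset_code M s \<and> (\<forall>u\<in>fset2 M s. p1 u \<prec> n \<and> u = pr (p1 u) (p2 u)) \<and>
    (\<forall>i. i \<prec> n \<longrightarrow> (\<exists>v. v \<prec> s \<and> entry2 M s i v \<and> (\<forall>w. w \<prec> s \<longrightarrow> entry2 M s i w \<longrightarrow> w = v)))"
proof -
  have "(\<exists>!v. entry2 M s i v) \<longleftrightarrow> (\<exists>v. v \<prec> s \<and> entry2 M s i v \<and> (\<forall>w. w \<prec> s \<longrightarrow> entry2 M s i w \<longrightarrow> w = v))" for i
    using child_less[of s] unfolding child_iff by blast
  moreover have "(\<exists>i v. i \<prec> n \<and> u = pr i v) \<longleftrightarrow> p1 u \<prec> n \<and> u = pr (p1 u) (p2 u)" for u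
    by auto
  ultimately show ?thesis unfolding is_seq_def by simp
qed

lemma dec_entry [dcf]: "cf f \<Longrightarrow> cf g \<Longrightarrow> cf h \<Longrightarrow> dec (\<lambda>x. entry2 M (f x) (g x) (h x))"
  unfolding entry2_def by (intro dcf)

lemma dec_is_seq [dcf]: assumes "cf f" "cf g" shows "dec (\<lambda>x. is_seq M (f x) (g x))"
  unfolding is_seq_iff by (intro dcf cf_comp[OF assms(1)] cf_comp[OF assms(2)] assms)

text \<open>Otherwise there is an entry at index \<open>s\<close>. The code of that entry is at
  least \<open>s\<close>, yet it belongs to the set coded by \<open>s\<close>. The bound makes it
  decidable whether a number is a sequence of some length.\<close>

lemma is_seq_length: assumes "is_seq M s n" shows "n \<preceq> s"
proof (rule ccontr)
  assume "\<not> n \<preceq> s"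
  then have "s \<prec> n" using ar.not_le by blast
  then obtain v where "entry2 M s s v" using assms unfolding is_seq_def by blast
  then show False using fset_less fst_leq_pr unfolding entry2_def using ar.not_le by blast
qed

lemma tree_set_exists:
  assumes "Q \<in> sets2 M" shows "\<exists>T. tree_set M Q T"
proof -
  \<comment> \<open>\<open>c\<close> stands for a code of the trees below \<open>n\<close>. Children
    have smaller codes than their tree, so \<open>c\<close> decides whether they are trees.\<close>
  define P where "P n c \<longleftrightarrow> n = pr (p1 n) (p2 n) \<and> p1 n \<in> Q \<and> (\<exists>m. m \<preceq> p2 n \<and> is_seq M (p2 n) m) \<and>
    (\<forall>v. v \<prec> p2 n \<longrightarrow> child (p2 n) v \<longrightarrow> v \<in> fset2 M c)" for n c
  have "dec (\<lambda>z. P (p1 z) (p2 z))" unfolding P_def by (intro dcf assms)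
  then obtain T where T: "T \<in> sets2 M" "\<forall>n. \<exists>c. fset2 M c = {i. i \<prec> n \<and> i \<in> T} \<and> (n \<in> T \<longleftrightarrow> P n c)"
    by (rule course_rec)
  have "t \<in> T \<longleftrightarrow> (\<exists>q\<in>Q. \<exists>s n. t = pr q s \<and> is_seq M s n \<and> (\<forall>i v. entry2 M s i v \<longrightarrow> v \<in> T))" for t
  proof -
    obtain c where c: "fset2 M c = {i. i \<prec> t \<and> i \<in> T}" "t \<in> T \<longleftrightarrow> P t c" using T(2) by blast
    show ?thesis
    proof (cases "\<exists>q s. t = pr q s")
      case True
      then obtain q s where t: "t = pr q s" by blast
      have "P t c \<longleftrightarrow> q \<in> Q \<and> (\<exists>n. is_seq M s n) \<and> (\<forall>i v. entry2 M s i v \<longrightarrow> v \<in> T)"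
      proof -
        have "(\<forall>i v. entry2 M s i v \<longrightarrow> v \<in> T) \<longleftrightarrow>
            (\<forall>v. v \<prec> s \<longrightarrow> child s v \<longrightarrow> v \<prec> pr q s \<and> v \<in> T)"
          using child_less[of s] child_less_pr[of s _ q] child_iff[of s] by blast
        moreover have "(\<exists>n. is_seq M s n) \<longleftrightarrow> (\<exists>n. n \<preceq> s \<and> is_seq M s n)"
          using is_seq_length by blast
        ultimately show ?thesis unfolding P_def c(1) t by simp
      qed
      then show ?thesis unfolding c(2) using t by auto
    qed (use c(2) in \<open>auto simp: P_def\<close>)
  qed
  with T(1) show ?thesis unfolding tree_set_def by blast
qed

text \<open>Each recursive clause replaces one component of the pair by a child, which lowers the
  code of the pair. The recursion runs over all pair codes, not only over pairs of trees.\<close>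

lemma weak_tree_order_exists:
  assumes "R \<in> sets2 M" shows "\<exists>W. weak_tree_order M R T W"
proof -
  define P where "P z c \<longleftrightarrow>
    (related M R (p1 (p1 z)) (p1 (p2 z)) \<and>
      (\<forall>v. v \<prec> p2 (p1 z) \<longrightarrow> child (p2 (p1 z)) v \<longrightarrow> pr v (p2 z) \<in> fset2 M c)) \<or>
    (\<exists>v. v \<prec> p2 (p2 z) \<and> child (p2 (p2 z)) v \<and> pr (p1 z) v \<in> fset2 M c)" for z c
  have "dec (\<lambda>z. P (p1 z) (p2 z))" unfolding P_def by (intro dcf assms)
  then obtain W where W: "W \<in> sets2 M" "\<forall>n. \<exists>c. fset2 M c = {i. i \<prec> n \<and> i \<in> W} \<and> (n \<in> W \<longleftrightarrow> P n c)"
    by (rule course_rec)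
  have "related M W (pr p r) (pr q s) \<longleftrightarrow>
      (related M R p q \<and> (\<forall>i v. entry2 M r i v \<longrightarrow> related M W v (pr q s))) \<or>
      (\<exists>j v. entry2 M s j v \<and> related M W (pr p r) v)" for p r q s
  proof -
    let ?z = "pr (pr p r) (pr q s)"
    obtain c where c: "fset2 M c = {i. i \<prec> ?z \<and> i \<in> W}" "?z \<in> W \<longleftrightarrow> P ?z c" using W(2) by blast
    have 1: "v \<prec> r \<and> pr v (pr q s) \<prec> ?z" if "child r v" for v
      using child_less[OF that] child_less_pr[OF that, of p] pr_mono1 by blast
    have 2: "v \<prec> s \<and> pr (pr p r) v \<prec> ?z" if "child s v" for v
      using child_less[OF that] child_less_pr[OF that, of q] pr_mono2 by blast
    have "P ?z c \<longleftrightarrow> (related M R p q \<and> (\<forall>v. child r v \<longrightarrow> related M W v (pr q s))) \<or>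
      (\<exists>v. child s v \<and> related M W (pr p r) v)"
      unfolding P_def c(1) related_def using 1 2 by auto
    then show ?thesis using c(2) unfolding related_def child_iff by blast
  qed
  with W(1) show ?thesis unfolding weak_tree_order_def by blast
qed

text \<open>Membership in the base is a \<open>\<Sigma>\<^sup>0\<^sub>1\<close> condition, so the
  search is for a pair \<open>u\<close> of an element and a member of \<open>B\<close> containing
  it. As the code of the pair is minimised, not the element, parts of the base may be
  skipped.\<close>

lemma increasing_enumeration:
  assumes B: "B \<in> sets2 M" and unb: "unbounded2 M (base2 M B)"
  obtains e where "cf e" "\<forall>n. e n \<in> base2 M B" "\<forall>x y. x \<prec> y \<longrightarrow> e x \<prec> e y"
proof -
  define U where "U x u \<longleftrightarrow> p1 x \<prec> p1 u \<and> p2 u \<in> B \<and> p1 u \<in> fset2 M (p2 u)" for x u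
  have dU: "dec (\<lambda>z. U (p1 z) (p2 z))" unfolding U_def by (intro dcf B)
  have exU: "\<exists>u. U x u" for x
  proof -
    obtain y s where "p1 x \<prec> y" "s \<in> B" "y \<in> fset2 M s"
      using unb unfolding unbounded2_def base2_def by blast
    then show ?thesis unfolding U_def by (intro exI[of _ "pr y s"]) simp
  qed
  define nx where "nx x = mu (U x)" for x
  have cnx: "cf nx" unfolding nx_def by (rule cf_mu[OF dU exU])
  have nx: "U x (nx x)" for x unfolding nx_def by (rule mu_prop[OF dU exU])
  have "cf (\<lambda>x. nx (p2 (p2 x)))" by (intro cf_comp[OF cnx] dcf)
  with cnx obtain h where h: "cf h" "\<forall>p. h (pr p \<zero>) = nx p"
    "\<forall>p n. h (pr p (n \<oplus> \<one>)) = nx (p2 (p2 (pr p (pr n (h (pr p n))))))"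
    by (rule prim_rec)
  define e where "e n = p1 (h (pr \<zero> n))" for n
  have ce: "cf e" unfolding e_def by (intro dcf cf_comp[OF h(1)])
  have hs: "h (pr \<zero> (n \<oplus> \<one>)) = nx (h (pr \<zero> n))" for n using h(3) by simp
  have "e n \<in> base2 M B" for n
  proof -
    obtain x where x: "h (pr \<zero> n) = nx x" using zero_or_succ[of n] h(2) hs by auto
    then show ?thesis using nx[of x] unfolding U_def e_def x base2_def by blast
  qed
  moreover have less: "e n \<prec> e (n \<oplus> \<one>)" for n
    using nx[of "h (pr \<zero> n)"] unfolding e_def hs U_def by blast
  have "x \<prec> y \<longrightarrow> e x \<prec> e y" for x y
  proof (rule ind[where P = "\<lambda>y. x \<prec> y \<longrightarrow> e x \<prec> e y"])
    show "dec (\<lambda>y. x \<prec> y \<longrightarrow> e x \<prec> e y)" by (intro dcf ce)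
    fix n assume IH: "x \<prec> n \<longrightarrow> e x \<prec> e n"
    show "x \<prec> n \<oplus> \<one> \<longrightarrow> e x \<prec> e (n \<oplus> \<one>)"
      using IH less[of n] less_trans2 by (auto simp: leq2_def)
  qed simp
  ultimately show ?thesis using that ce by blast
qed

section \<open>Finite parts of infinite sets\<close>

definition nxt :: "'a \<Rightarrow> 'a \<Rightarrow> 'a \<Rightarrow> bool" where
  "nxt c x y \<longleftrightarrow> x \<in> fset2 M c \<and> y \<in> fset2 M c \<and> x \<prec> y \<and> (\<forall>w\<in>fset2 M c. x \<prec> w \<longrightarrow> y \<preceq> w)"

lemma dec_nxt [dcf]: assumes "cf f" "cf g" "cf h" shows "dec (\<lambda>x. nxt (f x) (g x) (h x))"
  unfolding nxt_def by (intro dcf assms cf_comp[OF assms(2)] cf_comp[OF assms(3)])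

lemma nxt_unique: "nxt c x y \<Longrightarrow> nxt c x y' \<Longrightarrow> y = y'"
  unfolding nxt_def by (meson ar.order_antisym)

definition rep :: "'a set \<Rightarrow> 'a \<Rightarrow> 'a \<Rightarrow> bool" where
  "rep X k c \<longleftrightarrow> fset2 M c = {i. i \<prec> k \<and> i \<in> X}"

lemma rep_exists: "X \<in> sets2 M \<Longrightarrow> \<exists>c. rep X k c"
  unfolding rep_def by (intro finite_set_code dcf)

lemma rep_iff: "rep X k c \<longleftrightarrow> (\<forall>i. i \<prec> k \<oplus> c \<longrightarrow> (i \<in> fset2 M c \<longleftrightarrow> i \<prec> k \<and> i \<in> X))"
  unfolding rep_def using fset_less[of _ c] leq_add[of c k] leq_add[of k c] ar.less_le_trans by blast

lemma dec_rep [dcf]: assumes "X \<in> sets2 M" "cf f" "cf g" shows "dec (\<lambda>x. rep X (f x) (g x))"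
  unfolding rep_iff by (intro dcf assms cf_comp[OF assms(2)] cf_comp[OF assms(3)])

lemma inf_setsD: "X \<in> inf_sets M \<Longrightarrow> X \<in> sets2 M" "X \<in> inf_sets M \<Longrightarrow> \<exists>x\<in>X. n \<prec> x"
  unfolding inf_sets_def unbounded2_def by blast+

lemma tail2_inf: assumes "X \<in> inf_sets M" shows "tail2 M X \<in> inf_sets M"
proof -
  have X: "X \<in> sets2 M" using assms by (rule inf_setsD)
  have "dec (\<lambda>x. x \<in> X \<and> (\<exists>y. y \<prec> x \<and> y \<in> X))" by (intro dcf X)
  then have "tail2 M X \<in> sets2 M" unfolding dec_def tail2_def
    by (smt (verit, ccfv_threshold) Collect_cong)
  moreover have "\<exists>x\<in>tail2 M X. n \<prec> x" for n
  proof -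
    obtain y where y: "y \<in> X" "n \<prec> y" using inf_setsD(2)[OF assms] by blast
    obtain x where "x \<in> X" "y \<prec> x" using inf_setsD(2)[OF assms] by blast
    with y show ?thesis unfolding tail2_def using less_trans2 by blast
  qed
  ultimately show ?thesis unfolding inf_sets_def unbounded2_def by blast
qed

lemma inf_set_min: assumes "X \<in> inf_sets M" obtains x where "x \<in> X" "\<forall>y\<in>X. x \<preceq> y"
proof -
  obtain y where "y \<in> X" using inf_setsD(2)[OF assms] by blast
  moreover have "dec (\<lambda>x. x \<in> X)" by (intro dcf inf_setsD(1)[OF assms])
  ultimately obtain x where "x \<in> X" "\<forall>k. k \<prec> x \<longrightarrow> k \<notin> X" using least[of "\<lambda>x. x \<in> X"] by blast
  with that show ?thesis using ar.not_le by blast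
qed

end

locale weak_trees = rca0 +
  fixes Q R T W :: "'a set"
  assumes Q: "quasi_order M Q R" and T: "tree_set M Q T" and W: "weak_tree_order M R T W"
begin

section \<open>The weak order is a quasi order\<close>

lemma sets_TW: "T \<in> sets2 M" "W \<in> sets2 M" "Q \<in> sets2 M" "R \<in> sets2 M"
  using Q T W unfolding quasi_order_def tree_set_def weak_tree_order_def by blast+

lemma tree_pr: "t \<in> T \<Longrightarrow> t = pr (p1 t) (p2 t)"
  using T unfolding tree_set_def by (metis p1_pr p2_pr)

lemma tree_label: "t \<in> T \<Longrightarrow> p1 t \<in> Q"
  using T unfolding tree_set_def by (metis p1_pr)

lemma tree_child: "t \<in> T \<Longrightarrow> child (p2 t) v \<Longrightarrow> v \<in> T"
  using T unfolding tree_set_def child_iff by (metis p2_pr)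

lemma child_p2_less: "t \<in> T \<Longrightarrow> child (p2 t) v \<Longrightarrow> v \<prec> t"
  using child_less p2_leq ar.less_le_trans by blast

lemma W_iff:
  assumes "a \<in> T" "b \<in> T"
  shows "related M W a b \<longleftrightarrow>
    (related M R (p1 a) (p1 b) \<and> (\<forall>v. child (p2 a) v \<longrightarrow> related M W v b)) \<or>
    (\<exists>v. child (p2 b) v \<and> related M W a v)"
proof -
  have "pr (p1 a) (p2 a) \<in> T" "pr (p1 b) (p2 b) \<in> T" using assms tree_pr by metis+
  then show ?thesis
    using W[unfolded weak_tree_order_def, THEN conjunct2, rule_format, of "p1 a" "p2 a" "p1 b" "p2 b"]
      tree_pr[OF assms(1)] tree_pr[OF assms(2)] unfolding child_iff by auto
qed

text \<open>A child is below itself by induction, hence below its tree by the second alternative of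
  the order; the first alternative then applies to the tree.\<close>

lemma W_refl: "a \<in> T \<Longrightarrow> related M W a a"
proof -
  have "a \<in> T \<longrightarrow> related M W a a"
  proof (rule strong_ind[where P = "\<lambda>a. a \<in> T \<longrightarrow> related M W a a"])
    show "dec (\<lambda>a. a \<in> T \<longrightarrow> related M W a a)" by (intro dcf sets_TW)
    fix n assume IH: "\<And>m. m \<prec> n \<Longrightarrow> m \<in> T \<longrightarrow> related M W m m"
    show "n \<in> T \<longrightarrow> related M W n n"
    proof
      assume n: "n \<in> T"
      have "related M W v n" if "child (p2 n) v" for v
        using W_iff[OF tree_child[OF n that] n] IH[OF child_p2_less[OF n that]] tree_child[OF n that] that by blast
      moreover have "related M R (p1 n) (p1 n)" using Q tree_label[OF n] unfolding quasi_order_def by blast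
      ultimately show "related M W n n" using W_iff[OF n n] by blast
    qed
  qed
  then show "a \<in> T \<Longrightarrow> related M W a a" by blast
qed

text \<open>Induction on the code of the triple. If \<open>b\<close> is below a child of
  \<open>c\<close>, that child replaces \<open>c\<close>; if \<open>a\<close> is below a child of
  \<open>b\<close>, that child replaces \<open>b\<close>; otherwise both relations come from the
  labels, and each child of \<open>a\<close> replaces \<open>a\<close>.\<close>

lemma W_trans:
  assumes "a \<in> T" "b \<in> T" "c \<in> T" "related M W a b" "related M W b c"
  shows "related M W a c"
proof -
  define P where "P a b c \<longleftrightarrow> (a \<in> T \<and> b \<in> T \<and> c \<in> T \<and> related M W a b \<and> related M W b c \<longrightarrow> related M W a c)" for a b c
  let ?t = "\<lambda>u. pr (p1 u) (pr (p1 (p2 u)) (p2 (p2 u)))"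
  have "u = ?t u \<longrightarrow> P (p1 u) (p1 (p2 u)) (p2 (p2 u))" for u
  proof (rule strong_ind[where P = "\<lambda>u. u = ?t u \<longrightarrow> P (p1 u) (p1 (p2 u)) (p2 (p2 u))"])
    show "dec (\<lambda>u. u = ?t u \<longrightarrow> P (p1 u) (p1 (p2 u)) (p2 (p2 u)))"
      unfolding P_def by (intro dcf sets_TW)
    fix u assume IH: "\<And>m. m \<prec> u \<Longrightarrow> m = ?t m \<longrightarrow> P (p1 m) (p1 (p2 m)) (p2 (p2 m))"
    show "u = ?t u \<longrightarrow> P (p1 u) (p1 (p2 u)) (p2 (p2 u))"
    proof
      assume True: "u = ?t u"
      define a b c where abc: "a = p1 u" "b = p1 (p2 u)" "c = p2 (p2 u)"
      have IH': "P a' b' c'" if "pr a' (pr b' c') \<prec> pr a (pr b c)" for a' b' c'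
        using IH[of "pr a' (pr b' c')"] that True unfolding abc by simp
      have "P a b c" unfolding P_def
      proof (intro impI, elim conjE)
        assume t: "a \<in> T" "b \<in> T" "c \<in> T" and ab: "related M W a b" and bc: "related M W b c"
        show "related M W a c"
        proof (cases "\<exists>v. child (p2 c) v \<and> related M W b v")
          case True
          then obtain v where v: "child (p2 c) v" "related M W b v" by blast
          have "related M W a v"
            using IH'[of a b v] child_p2_less[OF t(3) v(1)] pr_mono2 v(2) t ab tree_child[OF t(3) v(1)]
            unfolding P_def by blast
          then show ?thesis using W_iff[OF t(1,3)] v(1) by blast
        next
          case False
          then have bc': "related M R (p1 b) (p1 c)" "\<And>v. child (p2 b) v \<Longrightarrow> related M W v c"
            using W_iff[OF t(2,3)] bc by blast+
          show ?thesis
          proof (cases "\<exists>v. child (p2 b) v \<and> related M W a v")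
            case True
            then obtain v where v: "child (p2 b) v" "related M W a v" by blast
            have "pr a (pr v c) \<prec> pr a (pr b c)"
              using child_p2_less[OF t(2) v(1)] pr_mono1 pr_mono2 by blast
            then show ?thesis
              using IH'[of a v c] v t bc'(2) tree_child[OF t(2) v(1)] unfolding P_def by blast
          next
            case False
            then have ab': "related M R (p1 a) (p1 b)" "\<And>v. child (p2 a) v \<Longrightarrow> related M W v b"
              using W_iff[OF t(1,2)] ab by blast+
            have "related M W v c" if "child (p2 a) v" for v
              using IH'[of v b c] child_p2_less[OF t(1) that] pr_mono1 that t bc ab'(2) tree_child[OF t(1) that]
              unfolding P_def by blast
            moreover have "related M R (p1 a) (p1 c)"
              using ab'(1) bc'(1) tree_label t Q unfolding quasi_order_def by blast
            ultimately show ?thesis using W_iff[OF t(1,3)] by blast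
          qed
        qed
      qed
      then show "P (p1 u) (p1 (p2 u)) (p2 (p2 u))" unfolding abc .
    qed
  qed
  from this[of "pr a (pr b c)"] assms show ?thesis unfolding P_def by simp
qed

lemma W_quasi_order: "quasi_order M T W"
  unfolding quasi_order_def using sets_TW W_refl W_trans by blast

end

section \<open>From bad arrays to bad functions\<close>

text \<open>
  The base of \<open>B\<close> need not be a set of the model, so infinite sets \<open>X\<close> are moved into it by the
  increasing enumeration \<open>e\<close> of an infinite part.
\<close>

locale bad_array = weak_trees +
  fixes B f :: "'a set" and e :: "'a \<Rightarrow> 'a"
  assumes B: "barrier2 M B" and f: "function2 M f B T"
    and bad: "\<And>s t p q. s \<in> B \<Longrightarrow> t \<in> B \<Longrightarrow> shift_rel M s t \<Longrightarrow> pr s p \<in> f \<Longrightarrow> pr t q \<in> f \<Longrightarrow>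
      \<not> related M W p q"
    and cf_e: "cf e" and e_base: "e n \<in> base2 M B" and e_mono: "x \<prec> y \<Longrightarrow> e x \<prec> e y"
begin

lemma e_less [simp]: "e x \<prec> e y \<longleftrightarrow> x \<prec> y"
  using e_mono less_lin less_irr less_trans2 by metis

lemma e_inj [simp]: "e x = e y \<longleftrightarrow> x = y"
  using e_mono less_lin less_irr by metis

lemma e_ge: "x \<preceq> e x"
proof (rule ind[where P = "\<lambda>x. x \<preceq> e x"])
  show "dec (\<lambda>x. x \<preceq> e x)" by (intro dcf cf_e)
  fix n assume "n \<preceq> e n"
  moreover have "e n \<prec> e (n \<oplus> \<one>)" by simp
  ultimately show "n \<oplus> \<one> \<preceq> e (n \<oplus> \<one>)" using succ_leq ar.le_less_trans by blast
qed simp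

lemma sets_Bf: "B \<in> sets2 M" "f \<in> sets2 M"
  using B f unfolding barrier2_def block2_def function2_def by blast+

lemma fD: "pr s v \<in> f \<Longrightarrow> s \<in> B \<and> v \<in> T" "pr s v \<in> f \<Longrightarrow> pr s w \<in> f \<Longrightarrow> v = w"
  "s \<in> B \<Longrightarrow> \<exists>v. pr s v \<in> f"
proof -
  show *: "s \<in> B \<and> v \<in> T" if "pr s v \<in> f" for s v
    using f that unfolding function2_def by (metis pr_inj)
  show "pr s v \<in> f \<Longrightarrow> pr s w \<in> f \<Longrightarrow> v = w" "s \<in> B \<Longrightarrow> \<exists>v. pr s v \<in> f"
    using f * unfolding function2_def by blast+
qed

text \<open>\<open>stp a b v\<close> is the step from \<open>a = g\<^sub>n(X)\<close> and \<open>b = g\<^sub>n(X\<^sup>-)\<close> to \<open>v = g\<^sub>n\<^sub>+\<^sub>1(X)\<close>.\<close>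

definition stp :: "'a \<Rightarrow> 'a \<Rightarrow> 'a \<Rightarrow> bool" where
  "stp a b v \<longleftrightarrow> (related M R (p1 a) (p1 b) \<and> (child (p2 a) v \<and> \<not> related M W v b) \<and>
      (\<forall>w. w \<prec> v \<longrightarrow> \<not> (child (p2 a) w \<and> \<not> related M W w b))) \<or>
    (\<not> related M R (p1 a) (p1 b) \<and> v = a)"

lemma dec_stp [dcf]: assumes "cf f'" "cf g" "cf h" shows "dec (\<lambda>x. stp (f' x) (g x) (h x))"
  unfolding stp_def by (intro dcf assms cf_comp[OF assms(1)] cf_comp[OF assms(2)] cf_comp[OF assms(3)] sets_TW)

lemma stp_unique: "stp a b v \<Longrightarrow> stp a b w \<Longrightarrow> v = w"
  unfolding stp_def using less_lin by metis

lemma stp_leq: "stp a b v \<Longrightarrow> v \<preceq> a"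
  unfolding stp_def using child_less[of "p2 a" v] p2_leq[of a] ar.less_le_trans
  by (auto simp: leq2_def)

lemma stp_exists:
  assumes "a \<in> T" "b \<in> T" "\<not> related M W a b" shows "\<exists>v. stp a b v"
proof (cases "related M R (p1 a) (p1 b)")
  case True
  then obtain v where v: "child (p2 a) v \<and> \<not> related M W v b"
    using W_iff[OF assms(1,2)] assms(3) by blast
  have "dec (\<lambda>v. child (p2 a) v \<and> \<not> related M W v b)" by (intro dcf sets_TW)
  from least[where P = "\<lambda>v. child (p2 a) v \<and> \<not> related M W v b", OF this v] True
  show ?thesis unfolding stp_def by blast
qed (auto simp: stp_def)

lemma stp_tree: "a \<in> T \<Longrightarrow> stp a b v \<Longrightarrow> v \<in> T"
  unfolding stp_def using tree_child by blast

lemma stp_not_leq: "\<not> related M W a b \<Longrightarrow> stp a b v \<Longrightarrow> \<not> related M W v b"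
  unfolding stp_def by blast

text \<open>\<open>w\<close> is \<open>b\<close> or a child of \<open>b\<close>, and whatever is
  below a child of \<open>b\<close> is below \<open>b\<close>. So passing to the next stage on the
  side of \<open>X\<^sup>-\<close> keeps badness.\<close>

lemma stp_right:
  assumes "v \<in> T" "b \<in> T" "\<not> related M W v b" "stp b d w" shows "\<not> related M W v w"
  using assms W_iff[OF assms(1,2)] unfolding stp_def by blast

text \<open>A child has a smaller code than its tree, so a step without change can only come from
  the alternative of unrelated labels.\<close>

lemma stp_fixed: "a \<in> T \<Longrightarrow> stp a b a \<Longrightarrow> \<not> related M R (p1 a) (p1 b)"
  unfolding stp_def using child_p2_less less_irr by blast

text \<open>\<open>seg c x s\<close>: the set coded by \<open>s\<close> is an initial segment of the image under \<open>e\<close> of \<open>c \<inter> [x, \<infinity>)\<close>.\<close>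

definition seg :: "'a \<Rightarrow> 'a \<Rightarrow> 'a \<Rightarrow> bool" where
  "seg c x s \<longleftrightarrow> (\<forall>z\<in>fset2 M s. \<exists>y\<in>fset2 M c. x \<preceq> y \<and> z = e y) \<and>
    (\<forall>y\<in>fset2 M c. x \<preceq> y \<longrightarrow> (\<exists>z\<in>fset2 M s. e y \<prec> z) \<longrightarrow> e y \<in> fset2 M s)"

lemma segD:
  assumes "seg c x s"
  shows "z \<in> fset2 M s \<Longrightarrow> \<exists>y\<in>fset2 M c. x \<preceq> y \<and> z = e y"
    and "y \<in> fset2 M c \<Longrightarrow> x \<preceq> y \<Longrightarrow> z \<in> fset2 M s \<Longrightarrow> e y \<prec> z \<Longrightarrow> e y \<in> fset2 M s"
  using assms unfolding seg_def by blast+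

lemma seg_initial:
  assumes "seg c x s" "seg c x t" "z \<in> fset2 M s" "w \<in> fset2 M t" "w \<prec> z" shows "w \<in> fset2 M s"
proof -
  obtain y where "y \<in> fset2 M c" "x \<preceq> y" "w = e y" using segD(1)[OF assms(2,4)] by blast
  then show ?thesis using segD(2)[OF assms(1) _ _ assms(3)] assms(5) by blast
qed

lemma dec_seg [dcf]: assumes "cf f'" "cf g" "cf h" shows "dec (\<lambda>x. seg (f' x) (g x) (h x))"
  unfolding seg_def
  by (intro dcf assms cf_comp[OF assms(1)] cf_comp[OF assms(2)] cf_comp[OF assms(3)] cf_comp[OF cf_e])

text \<open>
  If \<open>c\<close> codes \<open>X \<inter> [0, k)\<close> then \<open>ini k c x v\<close> says that \<open>c\<close> suffices to see \<open>g\<^sub>0(X \<inter> [x, \<infinity>)) = v\<close>. The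
  bounds by \<open>k\<close> make this decidable and leave finitely many \<open>v\<close>.
\<close>

definition ini :: "'a \<Rightarrow> 'a \<Rightarrow> 'a \<Rightarrow> 'a \<Rightarrow> bool" where
  "ini k c x v \<longleftrightarrow> x \<in> fset2 M c \<and> (\<exists>s. s \<prec> k \<and> pr s v \<in> f \<and> pr s v \<prec> k \<and> seg c x s)"

lemma dec_ini [dcf]:
  assumes "cf f'" "cf g" "cf h" "cf i" shows "dec (\<lambda>x. ini (f' x) (g x) (h x) (i x))"
  unfolding ini_def
  by (intro dcf assms cf_comp[OF assms(1)] cf_comp[OF assms(2)] cf_comp[OF assms(3)] cf_comp[OF assms(4)] sets_Bf)

text \<open>Initial segments of one set are comparable, and no member of \<open>B\<close> is a
  proper initial segment of another. Equal sets give equal numbers because members of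
  \<open>B\<close> are least codes.\<close>

lemma seg_unique:
  assumes "s \<in> B" "t \<in> B" "seg c x s" "seg c x t" shows "s = t"
proof -
  have sub: "fset2 M s = fset2 M t" if "s \<in> B" "t \<in> B" "seg c x s" "seg c x t" "fset2 M s \<subseteq> fset2 M t" for s t
  proof (rule ccontr)
    assume ne: "fset2 M s \<noteq> fset2 M t"
    have "init_seg M (fset2 M s) (fset2 M t)"
      using that(5) seg_initial[OF that(3,4)] unfolding init_seg_def by blast
    then show False using B ne that(1,2) unfolding barrier2_def block2_def by blast
  qed
  have "fset2 M s \<subseteq> fset2 M t \<or> fset2 M t \<subseteq> fset2 M s"
  proof (rule ccontr)
    assume "\<not> ?thesis"
    then obtain z w where z: "z \<in> fset2 M s" "z \<notin> fset2 M t" and w: "w \<in> fset2 M t" "w \<notin> fset2 M s" by blast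
    then have "\<not> z \<prec> w" "\<not> w \<prec> z" using seg_initial[OF assms(3,4)] seg_initial[OF assms(4,3)] by blast+
    then show False using less_lin z w by metis
  qed
  then have "fset2 M s = fset2 M t" using sub[OF assms] sub[OF assms(2,1,4,3)] by blast
  moreover have "fset_code M s" "fset_code M t"
    using B assms(1,2) unfolding barrier2_def block2_def by blast+
  ultimately show ?thesis unfolding fset_code_def using less_lin by metis
qed

lemma ini_unique: "ini k c x v \<Longrightarrow> ini k c x w \<Longrightarrow> v = w"
  unfolding ini_def using seg_unique fD by metis

text \<open>
  \<open>G k c n x v\<close> says that \<open>c\<close>, which codes \<open>X \<inter> [0, k)\<close>, suffices to see \<open>g\<^sub>n(X \<inter> [x, \<infinity>)) = v\<close>. The finite
  graph of this partial function of \<open>x\<close> is \<open>st\<close>, which is computed by primitive recursion on \<open>n\<close>.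
\<close>

definition st :: "'a \<Rightarrow> 'a" where
  "st = (SOME st. cf st \<and>
    (\<forall>k c x v. pr x v \<in> fset2 M (st (pr (pr k c) \<zero>)) \<longleftrightarrow> ini k c x v) \<and>
    (\<forall>k c n x v. pr x v \<in> fset2 M (st (pr (pr k c) (n \<oplus> \<one>))) \<longleftrightarrow>
      (\<exists>y a b. nxt c x y \<and> pr x a \<in> fset2 M (st (pr (pr k c) n)) \<and>
        pr y b \<in> fset2 M (st (pr (pr k c) n)) \<and> stp a b v)))"

definition G :: "'a \<Rightarrow> 'a \<Rightarrow> 'a \<Rightarrow> 'a \<Rightarrow> 'a \<Rightarrow> bool" where
  "G k c n x v \<longleftrightarrow> pr x v \<in> fset2 M (st (pr (pr k c) n))"

lemma st_props: "cf st" "G k c \<zero> x v \<longleftrightarrow> ini k c x v"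
  "G k c (n \<oplus> \<one>) x v \<longleftrightarrow> (\<exists>y a b. nxt c x y \<and> G k c n x a \<and> G k c n y b \<and> stp a b v)"
proof -
  have "dec (\<lambda>z. p2 z = pr (p1 (p2 z)) (p2 (p2 z)) \<and> ini (p1 (p1 z)) (p2 (p1 z)) (p1 (p2 z)) (p2 (p2 z)))"
    by (intro dcf)
  \<comment> \<open>At the argument \<open>pr k c\<close> this bound is \<open>pr c k\<close>: an
    entry \<open>pr x v\<close> of the graph has \<open>x\<close> below \<open>c\<close> and
    \<open>v\<close> below \<open>k\<close>.\<close>
  moreover have "cf (\<lambda>z. pr (p2 z) (p1 z))" by (intro dcf)
  ultimately obtain A where A: "cf A" "\<forall>x. fset2 M (A x) =
      {y. y \<prec> pr (p2 x) (p1 x) \<and> (y = pr (p1 y) (p2 y) \<and> ini (p1 x) (p2 x) (p1 y) (p2 y))}"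
    by (rule cf_finite_set)
  let ?N = "\<lambda>c S x v. \<exists>y. y \<prec> c \<and> nxt c x y \<and> (\<exists>a. a \<prec> S \<and> pr x a \<in> fset2 M S \<and>
    (\<exists>b. b \<prec> S \<and> pr y b \<in> fset2 M S \<and> stp a b v))"
  have "dec (\<lambda>z. p2 z = pr (p1 (p2 z)) (p2 (p2 z)) \<and>
      ?N (p2 (p1 (p1 z))) (p2 (p2 (p1 z))) (p1 (p2 z)) (p2 (p2 z)))"
    by (intro dcf)
  \<comment> \<open>The code of the graph at one stage also bounds the entries of the next, because
    steps never increase values (\<open>stp_leq\<close>).\<close>
  moreover have "cf (\<lambda>z. p2 (p2 z))" by (intro dcf)
  ultimately obtain C where C: "cf C" "\<forall>x. fset2 M (C x) =
      {y. y \<prec> p2 (p2 x) \<and> (y = pr (p1 y) (p2 y) \<and> ?N (p2 (p1 x)) (p2 (p2 x)) (p1 y) (p2 y))}"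
    by (rule cf_finite_set)
  from A(1) C(1) obtain h where h: "cf h" "\<forall>p. h (pr p \<zero>) = A p"
    "\<forall>p n. h (pr p (n \<oplus> \<one>)) = C (pr p (pr n (h (pr p n))))"
    by (rule prim_rec)
  have 0: "pr x v \<in> fset2 M (h (pr (pr k c) \<zero>)) \<longleftrightarrow> ini k c x v" for k c x v
  proof -
    have "pr x v \<prec> pr c k" if "ini k c x v"
    proof -
      obtain s where "pr s v \<prec> k" using \<open>ini k c x v\<close> unfolding ini_def by blast
      then have "v \<prec> k" using snd_leq_pr ar.le_less_trans by blast
      moreover have "x \<prec> c" using \<open>ini k c x v\<close> fset_less unfolding ini_def by blast
      ultimately show ?thesis using pr_mono1 pr_mono2 less_trans2 by blast
    qed
    then show ?thesis using h(2) A(2) by auto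
  qed
  have 1: "pr x v \<in> fset2 M (h (pr (pr k c) (n \<oplus> \<one>))) \<longleftrightarrow>
      (\<exists>y a b. nxt c x y \<and> pr x a \<in> fset2 M (h (pr (pr k c) n)) \<and>
        pr y b \<in> fset2 M (h (pr (pr k c) n)) \<and> stp a b v)" for k c n x v
  proof -
    let ?S = "h (pr (pr k c) n)"
    have bnd: "a \<prec> ?S" if "pr x a \<in> fset2 M ?S" for x a
      using fset_less[OF that] snd_leq_pr ar.le_less_trans by blast
    have y: "y \<prec> c" if "nxt c x y" for x y using that fset_less unfolding nxt_def by blast
    have v: "pr x v \<prec> ?S" if "pr x a \<in> fset2 M ?S" "stp a b v" for a b
      using stp_leq[OF that(2)] fset_less[OF that(1)] pr_mono2 less_trans2 unfolding leq2_def by blast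
    have "pr x v \<in> fset2 M (h (pr (pr k c) (n \<oplus> \<one>))) \<longleftrightarrow> pr x v \<prec> ?S \<and> ?N c ?S x v"
      using h(3) C(2) by simp
    then show ?thesis using bnd y v by blast
  qed
  have "\<exists>st. cf st \<and>
    (\<forall>k c x v. pr x v \<in> fset2 M (st (pr (pr k c) \<zero>)) \<longleftrightarrow> ini k c x v) \<and>
    (\<forall>k c n x v. pr x v \<in> fset2 M (st (pr (pr k c) (n \<oplus> \<one>))) \<longleftrightarrow>
      (\<exists>y a b. nxt c x y \<and> pr x a \<in> fset2 M (st (pr (pr k c) n)) \<and>
        pr y b \<in> fset2 M (st (pr (pr k c) n)) \<and> stp a b v))"
    using h(1) 0 1 by (intro exI[of _ h]) blast
  from someI_ex[OF this, folded st_def]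
  show "cf st" "G k c \<zero> x v \<longleftrightarrow> ini k c x v"
    "G k c (n \<oplus> \<one>) x v \<longleftrightarrow> (\<exists>y a b. nxt c x y \<and> G k c n x a \<and> G k c n y b \<and> stp a b v)"
    unfolding G_def by blast+
qed

lemma dec_G [dcf]:
  assumes "cf g" "cf h" "cf i" "cf j" "cf l" shows "dec (\<lambda>x. G (g x) (h x) (i x) (j x) (l x))"
  unfolding G_def by (intro dcf assms cf_comp[OF st_props(1)])

lemma G_bound: "G k c n x v \<Longrightarrow> x \<prec> st (pr (pr k c) n) \<and> v \<prec> st (pr (pr k c) n)"
  unfolding G_def using fset_less fst_leq_pr snd_leq_pr ar.le_less_trans by blast

text \<open>The graph of a stage is a finite set with a computable code, which bounds
  \<open>x\<close> and \<open>v\<close>. Inductions on \<open>n\<close> about all values in one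
  approximation thus remain decidable.\<close>

lemma dec_ball_G:
  assumes "dec (\<lambda>z. P (p1 (p1 z)) (p2 (p1 z)) (p2 z))" "cf g" "cf h" "cf i"
  shows "dec (\<lambda>y. \<forall>x v. G (g y) (h y) (i y) x v \<longrightarrow> P y x v)"
proof -
  let ?b = "\<lambda>y. st (pr (pr (g y) (h y)) (i y))"
  have "dec (\<lambda>y. \<forall>x. x \<prec> ?b y \<longrightarrow> (\<forall>v. v \<prec> ?b y \<longrightarrow> G (g y) (h y) (i y) x v \<longrightarrow> P y x v))"
    by (intro dcf cf_comp[OF st_props(1)] cf_comp[OF assms(2)] cf_comp[OF assms(3)] cf_comp[OF assms(4)] assms)
  moreover have "(\<forall>x. x \<prec> ?b y \<longrightarrow> (\<forall>v. v \<prec> ?b y \<longrightarrow> G (g y) (h y) (i y) x v \<longrightarrow> P y x v)) \<longleftrightarrow>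
      (\<forall>x v. G (g y) (h y) (i y) x v \<longrightarrow> P y x v)" for y
    using G_bound by blast
  ultimately show ?thesis by simp
qed

lemma G_in: assumes "G k c n x v" shows "x \<in> fset2 M c"
  using zero_or_succ[of n] assms st_props(2,3) unfolding ini_def nxt_def by auto

text \<open>The segment consists of images of elements of \<open>c\<close>, all below
  \<open>k\<close>. As \<open>e\<close> is increasing, an element of \<open>c'\<close> from
  \<open>x\<close> on whose image precedes one of these lies between \<open>l\<close> and
  \<open>k\<close>, so it was already in \<open>c\<close>.\<close>

lemma ini_mono:
  assumes "ini k c x v" "k \<preceq> k'" "\<And>i. i \<in> fset2 M c \<longleftrightarrow> i \<in> fset2 M c' \<and> l \<preceq> i \<and> i \<prec> k"
  shows "ini k' c' x v"
proof -
  obtain s where s: "s \<prec> k" "pr s v \<in> f" "pr s v \<prec> k" "seg c x s" and x: "x \<in> fset2 M c"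
    using assms(1) unfolding ini_def by blast
  have "seg c' x s" unfolding seg_def
  proof (intro conjI ballI impI)
    fix z assume "z \<in> fset2 M s"
    then show "\<exists>y\<in>fset2 M c'. x \<preceq> y \<and> z = e y" using segD(1)[OF s(4)] assms(3) by blast
  next
    fix y assume y: "y \<in> fset2 M c'" "x \<preceq> y" "\<exists>z\<in>fset2 M s. e y \<prec> z"
    then obtain z w where z: "z \<in> fset2 M s" "e y \<prec> z" "w \<in> fset2 M c" "z = e w"
      using segD(1)[OF s(4)] by blast
    then have "y \<prec> w" by simp
    then have "y \<prec> k" using z(3) assms(3) less_trans2 by blast
    moreover have "l \<preceq> y" using x y(2) assms(3) leq_trans by blast
    ultimately have "y \<in> fset2 M c" using y(1) assms(3) by blast
    then show "e y \<in> fset2 M s" using segD(2)[OF s(4) _ y(2) z(1,2)] by blast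
  qed
  then show ?thesis unfolding ini_def using s x assms(2,3) ar.less_le_trans by blast
qed

text \<open>
  With \<open>l = \<zero>\<close> this compares two initial parts of one set, and with \<open>k = k'\<close> and \<open>l\<close> the least element
  of \<open>X\<^sup>-\<close> it compares \<open>X\<^sup>-\<close> with \<open>X\<close>.
\<close>

lemma G_mono:
  assumes "G k c n x v" "k \<preceq> k'" "\<And>i. i \<in> fset2 M c \<longleftrightarrow> i \<in> fset2 M c' \<and> l \<preceq> i \<and> i \<prec> k"
  shows "G k' c' n x v"
proof -
  have nxt: "nxt c' x y" if xy: "nxt c x y" for x y
  proof -
    have "y \<preceq> w" if w: "w \<in> fset2 M c'" "x \<prec> w" for w
    proof (cases "w \<prec> k")
      case True
      moreover have "l \<preceq> w" using xy w(2) assms(3) leq_trans unfolding nxt_def leq2_def by blast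
      ultimately show ?thesis using xy w assms(3) unfolding nxt_def by blast
    next
      case False
      moreover have "y \<prec> k" using xy assms(3) unfolding nxt_def by blast
      ultimately show ?thesis using ar.not_le ar.less_imp_le ar.less_le_trans by metis
    qed
    then show ?thesis using xy assms(3) unfolding nxt_def by blast
  qed
  have "\<forall>x v. G k c n x v \<longrightarrow> G k' c' n x v"
  proof (rule ind[where P = "\<lambda>n. \<forall>x v. G k c n x v \<longrightarrow> G k' c' n x v"])
    show "dec (\<lambda>n. \<forall>x v. G k c n x v \<longrightarrow> G k' c' n x v)"
      by (intro dec_ball_G[where P = "\<lambda>n x v. G k' c' n x v"] dcf)
    show "\<forall>x v. G k c \<zero> x v \<longrightarrow> G k' c' \<zero> x v"
      unfolding st_props using ini_mono[OF _ assms(2,3)] by blast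
  qed (unfold st_props(3), use nxt in blast)
  then show ?thesis using assms(1) by blast
qed

lemma G_unique: assumes "G k c n x v" "G k c n x w" shows "v = w"
proof -
  let ?P = "\<lambda>n x v. \<forall>x' v'. G k c n x' v' \<longrightarrow> x' = x \<longrightarrow> v' = v"
  have "\<forall>x v. G k c n x v \<longrightarrow> ?P n x v"
  proof (rule ind[where P = "\<lambda>n. \<forall>x v. G k c n x v \<longrightarrow> ?P n x v"])
    show "dec (\<lambda>n. \<forall>x v. G k c n x v \<longrightarrow> ?P n x v)"
      by (intro dec_ball_G[where P = ?P] dec_ball_G[where P = "\<lambda>z x' v'. x' = p2 (p1 z) \<longrightarrow> v' = p2 z"] dcf)
    show "\<forall>x v. G k c \<zero> x v \<longrightarrow> ?P \<zero> x v"
      unfolding st_props using ini_unique by blast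
  qed (unfold st_props(3), use nxt_unique stp_unique in blast)
  then show ?thesis using assms by blast
qed

lemma G_tree: assumes "G k c n x v" shows "v \<in> T"
proof -
  have "\<forall>x v. G k c n x v \<longrightarrow> v \<in> T"
  proof (rule ind[where P = "\<lambda>n. \<forall>x v. G k c n x v \<longrightarrow> v \<in> T"])
    show "dec (\<lambda>n. \<forall>x v. G k c n x v \<longrightarrow> v \<in> T)"
      by (intro dec_ball_G[where P = "\<lambda>n x v. v \<in> T"] dcf sets_TW)
    show "\<forall>x v. G k c \<zero> x v \<longrightarrow> v \<in> T" unfolding st_props ini_def using fD(1) by blast
  qed (unfold st_props(3), use stp_tree in blast)
  then show ?thesis using assms by blast
qed

section \<open>Badness, existence and limits of the values\<close>

definition img :: "'a set \<Rightarrow> 'a \<Rightarrow> 'a set" where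
  "img X x = {z. \<exists>i. i \<preceq> z \<and> i \<in> X \<and> x \<preceq> i \<and> z = e i}"

lemma img_iff: "z \<in> img X x \<longleftrightarrow> (\<exists>i\<in>X. x \<preceq> i \<and> z = e i)"
  unfolding img_def using e_ge by blast

lemma img_inf: assumes "X \<in> inf_sets M" shows "img X x \<in> inf_sets M"
proof -
  have "dec (\<lambda>z. \<exists>i. i \<preceq> z \<and> i \<in> X \<and> x \<preceq> i \<and> z = e i)"
    by (intro dcf cf_comp[OF cf_e] inf_setsD(1)[OF assms])
  then have "img X x \<in> sets2 M" unfolding img_def dec_def .
  moreover have "\<exists>z\<in>img X x. n \<prec> z" for n
  proof -
    obtain i where i: "i \<in> X" "n \<oplus> x \<prec> i" using inf_setsD(2)[OF assms] by blast
    then have "x \<preceq> i" "n \<prec> i"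
      using leq_add(1)[of n x] leq_add(2)[of x n] ar.le_less_trans ar.less_imp_le by blast+
    then show ?thesis using i(1) e_ge[of i] img_iff ar.less_le_trans by blast
  qed
  ultimately show ?thesis unfolding inf_sets_def unbounded2_def by blast
qed

lemma seg_init:
  assumes "rep X k c" "seg c x s" shows "init_seg M (fset2 M s) (img X x)"
  unfolding init_seg_def
proof (intro conjI ballI impI subsetI)
  fix z assume "z \<in> fset2 M s"
  then show "z \<in> img X x" using segD(1)[OF assms(2)] assms(1) unfolding img_iff rep_def by blast
next
  fix z w assume z: "z \<in> fset2 M s" and w: "w \<in> img X x" "w \<prec> z"
  obtain y where y: "y \<in> fset2 M c" "z = e y" using segD(1)[OF assms(2) z] by blast
  obtain i where i: "i \<in> X" "x \<preceq> i" "w = e i" using w(1) img_iff by blast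
  then have "i \<prec> y" using w(2) y(2) by simp
  then have "i \<in> fset2 M c" using y(1) i(1) assms(1) less_trans2 unfolding rep_def by blast
  then show "w \<in> fset2 M s" using segD(2)[OF assms(2) _ i(2) z] w(2) i(3) by blast
qed

lemma nxt_rep:
  assumes "rep X k c" "nxt c x y"
  shows "x \<in> X" "y \<in> X" "x \<prec> y" "w \<in> X \<Longrightarrow> x \<prec> w \<Longrightarrow> y \<preceq> w"
proof -
  show *: "x \<in> X" "y \<in> X" "x \<prec> y" using assms unfolding rep_def nxt_def by blast+
  assume w: "w \<in> X" "x \<prec> w"
  show "y \<preceq> w"
  proof (rule ccontr)
    assume "\<not> y \<preceq> w"
    then have "w \<prec> y" using ar.not_le by blast
    then have "w \<in> fset2 M c" using assms w(1) less_trans2 unfolding rep_def nxt_def by blast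
    then show False using \<open>\<not> y \<preceq> w\<close> assms(2) w(2) unfolding nxt_def by blast
  qed
qed

text \<open>Stage \<open>\<zero>\<close> is badness of the array: \<open>img X x\<close> witnesses
  the shift relation, since its tail is \<open>img X y\<close>. At a step,
  \<open>stp_not_leq\<close> treats the left value and then \<open>stp_right\<close> the right
  one.\<close>

lemma G_bad:
  assumes X: "X \<in> inf_sets M" and rep: "rep X k c"
    and "nxt c x y" "G k c n x a" "G k c n y b"
  shows "\<not> related M W a b"
proof -
  let ?P = "\<lambda>n x a. \<forall>y b. G k c n y b \<longrightarrow> nxt c x y \<longrightarrow> \<not> related M W a b"
  have "\<forall>x a. G k c n x a \<longrightarrow> ?P n x a"
  proof (rule ind[where P = "\<lambda>n. \<forall>x a. G k c n x a \<longrightarrow> ?P n x a"])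
    show "dec (\<lambda>n. \<forall>x a. G k c n x a \<longrightarrow> ?P n x a)"
      by (intro dec_ball_G[where P = ?P]
          dec_ball_G[where P = "\<lambda>z y b. nxt c (p2 (p1 z)) y \<longrightarrow> \<not> related M W (p2 z) b"] dcf sets_TW)
    show "\<forall>x a. G k c \<zero> x a \<longrightarrow> ?P \<zero> x a"
      unfolding st_props
    proof (intro allI impI)
      fix x a y b assume "ini k c x a" "ini k c y b" and xy: "nxt c x y"
      then obtain s t where s: "pr s a \<in> f" "seg c x s" and t: "pr t b \<in> f" "seg c y t"
        unfolding ini_def by blast
      note nx = nxt_rep[OF rep xy]
      have "tail2 M (img X x) = img X y"
      proof (intro set_eqI iffI)
        fix z assume "z \<in> tail2 M (img X x)"
        then obtain w where "z \<in> img X x" "w \<in> img X x" "w \<prec> z" unfolding tail2_def by blast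
        then obtain i j where ij: "i \<in> X" "z = e i" "x \<preceq> j" "e j \<prec> e i" unfolding img_iff by blast
        then have "x \<prec> i" using ar.le_less_trans by auto
        then show "z \<in> img X y" unfolding img_iff using ij nx(4) by blast
      next
        fix z assume "z \<in> img X y"
        then obtain i where i: "i \<in> X" "y \<preceq> i" "z = e i" unfolding img_iff by blast
        then have "x \<prec> i" using nx(3) ar.less_le_trans by blast
        then have "z \<in> img X x" "e x \<prec> z" "e x \<in> img X x"
          using i nx(1) unfolding img_iff by (auto simp: leq2_def)
        then show "z \<in> tail2 M (img X x)" unfolding tail2_def by blast
      qed
      then have "shift_rel M s t"
        unfolding shift_rel_def using img_inf[OF X, of x] seg_init[OF rep s(2)] seg_init[OF rep t(2)] by auto
      then show "\<not> related M W a b" using bad fD(1) s(1) t(1) by blast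
    qed
  next
    fix n assume IH: "\<forall>x a. G k c n x a \<longrightarrow> ?P n x a"
    show "\<forall>x a. G k c (n \<oplus> \<one>) x a \<longrightarrow> ?P (n \<oplus> \<one>) x a"
    proof (intro allI impI)
      fix x v y w assume v: "G k c (n \<oplus> \<one>) x v" and w: "G k c (n \<oplus> \<one>) y w" and xy: "nxt c x y"
      obtain a b where ab: "G k c n x a" "G k c n y b" "stp a b v"
        using v nxt_unique[OF xy] unfolding st_props(3) by blast
      obtain d where d: "stp b d w"
        using w G_unique[OF ab(2)] unfolding st_props(3) by blast
      have "\<not> related M W a b" using IH ab(1,2) xy by blast
      then have "\<not> related M W v b" using stp_not_leq ab(3) by blast
      then show "\<not> related M W v w" using stp_right[OF _ _ _ d] G_tree v ab(2) by blast
    qed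
  qed
  then show ?thesis using assms by blast
qed

definition val :: "'a set \<Rightarrow> 'a \<Rightarrow> 'a \<Rightarrow> 'a \<Rightarrow> bool" where
  "val X n x v \<longleftrightarrow> (\<exists>k c. rep X k c \<and> G k c n x v)"

lemma G_rep_mono: assumes "rep X k c" "rep X k' c'" "k \<preceq> k'" "G k c n x v" shows "G k' c' n x v"
proof (rule G_mono[OF assms(4,3), where l = \<zero>])
  fix i show "i \<in> fset2 M c \<longleftrightarrow> i \<in> fset2 M c' \<and> \<zero> \<preceq> i \<and> i \<prec> k"
    using assms(1-3) ar.less_le_trans unfolding rep_def by auto
qed

lemma ini_rep_mono: assumes "rep X k c" "rep X k' c'" "k \<preceq> k'" "ini k c x v" shows "ini k' c' x v"
  using G_rep_mono[OF assms(1-3), of \<zero>] assms(4) unfolding st_props by blast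

lemma val_unique: assumes "val X n x v" "val X n x w" shows "v = w"
proof -
  obtain k c k' c' where "rep X k c" "G k c n x v" "rep X k' c'" "G k' c' n x w"
    using assms unfolding val_def by blast
  then show ?thesis using G_rep_mono G_unique ar.linear by meson
qed

lemma ini_total:
  assumes "X \<in> inf_sets M" "x \<in> X" shows "\<exists>k c v. rep X k c \<and> ini k c x v"
proof -
  have "img X x \<subseteq> base2 M B" using e_base by (auto simp: img_iff)
  moreover have "\<forall>X\<in>inf_sets M. X \<subseteq> base2 M B \<longrightarrow> (\<exists>s\<in>B. init_seg M (fset2 M s) X)"
    using B unfolding barrier2_def block2_def by (elim conjE)
  ultimately obtain s where s: "s \<in> B" "init_seg M (fset2 M s) (img X x)"
    using img_inf[OF assms(1)] by blast
  obtain v where v: "pr s v \<in> f" using fD(3)[OF s(1)] by blast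
  \<comment> \<open>Chosen to exceed \<open>pr s v\<close>, hence \<open>s\<close>, as
    \<open>ini\<close> demands, and also \<open>x\<close>. By \<open>e_ge\<close> all numbers that
    \<open>e\<close> maps into the segment are then below \<open>k\<close> as well.\<close>
  define k where "k = pr s v \<oplus> x \<oplus> \<one>"
  obtain c where c: "rep X k c" using rep_exists inf_setsD(1)[OF assms(1)] by blast
  have k: "pr s v \<prec> k" "x \<prec> k" unfolding k_def using leq_add(1)[of "pr s v" x] leq_add(2)[of x "pr s v"] by simp_all
  then have sk: "s \<prec> k" using fst_leq_pr ar.le_less_trans by blast
  have "seg c x s" unfolding seg_def
  proof (intro conjI ballI impI)
    fix z assume z: "z \<in> fset2 M s"
    then have "z \<in> img X x" using s(2) unfolding init_seg_def by blast
    then obtain i where i: "i \<in> X" "x \<preceq> i" "z = e i" unfolding img_iff by blast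
    have "i \<prec> k" using i(3) e_ge[of i] fset_less[OF z] sk ar.le_less_trans less_trans2 by metis
    then show "\<exists>y\<in>fset2 M c. x \<preceq> y \<and> z = e y" using c i unfolding rep_def by blast
  next
    fix y assume "y \<in> fset2 M c" "x \<preceq> y" "\<exists>z\<in>fset2 M s. e y \<prec> z"
    moreover from this have "e y \<in> img X x" using c unfolding rep_def img_iff by blast
    ultimately show "e y \<in> fset2 M s" using s(2) unfolding init_seg_def by blast
  qed
  moreover have "x \<in> fset2 M c" using c k(2) assms(2) unfolding rep_def by blast
  ultimately show ?thesis using c sk k v unfolding ini_def by blast
qed

text \<open>
  The obvious induction on \<open>n\<close> for all \<open>x\<close> is not available, since its claim is \<open>\<Pi>\<^sup>0\<^sub>2\<close>. Instead, one
  \<open>c\<close> is chosen that suffices for stage \<open>0\<close> at \<open>x = b(0) < \<dots> < b(n)\<close>, consecutive elements of \<open>X\<close>; the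
  remaining induction is bounded.
\<close>

lemma val_total:
  assumes X: "X \<in> inf_sets M" and x: "x \<in> X" shows "\<exists>v. val X n x v"
proof -
  have sX: "X \<in> sets2 M" using X by (rule inf_setsD)
  have "dec (\<lambda>z. p2 z \<in> X \<and> p1 z \<prec> p2 z)" by (intro dcf sX)
  moreover have "\<exists>w. w \<in> X \<and> y \<prec> w" for y using inf_setsD(2)[OF X] by blast
  ultimately have nx: "cf (\<lambda>y. mu (\<lambda>w. w \<in> X \<and> y \<prec> w))" by (rule cf_mu)
  define nx where "nx y = mu (\<lambda>w. w \<in> X \<and> y \<prec> w)" for y
  have nx1: "nx y \<in> X" "y \<prec> nx y" "w \<in> X \<Longrightarrow> y \<prec> w \<Longrightarrow> nx y \<preceq> w" for y w
  proof -
    have "dec (\<lambda>w. w \<in> X \<and> y \<prec> w)" by (intro dcf sX)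
    moreover obtain w where "w \<in> X \<and> y \<prec> w" using inf_setsD(2)[OF X] by blast
    ultimately have *: "z = nx y \<longleftrightarrow> (z \<in> X \<and> y \<prec> z) \<and> (\<forall>u. u \<prec> z \<longrightarrow> \<not> (u \<in> X \<and> y \<prec> u))" for z
      unfolding nx_def by (rule mu_iff[where P = "\<lambda>w. w \<in> X \<and> y \<prec> w"])
    from *[of "nx y"] show "nx y \<in> X" "y \<prec> nx y" "w \<in> X \<Longrightarrow> y \<prec> w \<Longrightarrow> nx y \<preceq> w" for w
      using ar.not_le by blast+
  qed
  have "cf (\<lambda>z. nx (p2 (p2 z)))" unfolding nx_def by (intro cf_comp[OF nx] dcf)
  with cf_const[of x] obtain h where h: "cf h" "\<forall>p. h (pr p \<zero>) = x"
    "\<forall>p n. h (pr p (n \<oplus> \<one>)) = nx (p2 (p2 (pr p (pr n (h (pr p n))))))"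
    by (rule prim_rec)
  define b where "b n = h (pr \<zero> n)" for n
  have b0: "b \<zero> = x" and bs: "b (n \<oplus> \<one>) = nx (b n)" for n using h(2,3) unfolding b_def by simp_all
  have cb: "cf (\<lambda>x. b (g x))" if "cf g" for g unfolding b_def by (intro dcf that cf_comp[OF h(1)])
  have bX: "b n \<in> X" for n using zero_or_succ[of n] b0 bs x nx1(1) by auto
  have "\<exists>u. rep X (p1 u) (p2 u) \<and> (\<forall>j. j \<preceq> n \<longrightarrow> (\<exists>v. v \<prec> p1 u \<and> ini (p1 u) (p2 u) (b j) v))"
  proof (rule sind[where P = "\<lambda>n u. rep X (p1 u) (p2 u) \<and> (\<forall>j. j \<preceq> n \<longrightarrow> (\<exists>v. v \<prec> p1 u \<and> ini (p1 u) (p2 u) (b j) v))"])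
    show "dec (\<lambda>z. rep X (p1 (p2 z)) (p2 (p2 z)) \<and> (\<forall>j. j \<preceq> p1 z \<longrightarrow>
        (\<exists>v. v \<prec> p1 (p2 z) \<and> ini (p1 (p2 z)) (p2 (p2 z)) (b j) v)))"
      by (intro dcf sX cb)
    have bnd: "v \<prec> k" if "ini k c y v" for k c y v
      using that snd_leq_pr ar.le_less_trans unfolding ini_def by blast
    obtain k c v where "rep X k c" "ini k c x v" using ini_total[OF X x] by blast
    moreover from this have "\<exists>v. v \<prec> k \<and> ini k c x v" using bnd by blast
    ultimately show "\<exists>u. rep X (p1 u) (p2 u) \<and> (\<forall>j. j \<preceq> \<zero> \<longrightarrow> (\<exists>v. v \<prec> p1 u \<and> ini (p1 u) (p2 u) (b j) v))"
      using b0 by (intro exI[of _ "pr k c"]) (auto simp: leq2_def)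
    fix n u assume u: "rep X (p1 u) (p2 u) \<and> (\<forall>j. j \<preceq> n \<longrightarrow> (\<exists>v. v \<prec> p1 u \<and> ini (p1 u) (p2 u) (b j) v))"
    obtain k c v where kc: "rep X k c" "ini k c (b (n \<oplus> \<one>)) v" using ini_total[OF X bX] by blast
    \<comment> \<open>Beyond both bounds, so the old and the new initial values persist by
      \<open>ini_rep_mono\<close>.\<close>
    define k' where "k' = k \<oplus> p1 u"
    obtain c' where c': "rep X k' c'" using rep_exists[OF sX] by blast
    have "ini k' c' (b (n \<oplus> \<one>)) v"
      using ini_rep_mono[OF kc(1) c' _ kc(2)] leq_add unfolding k'_def by blast
    moreover have "\<exists>v. ini k' c' (b j) v" if "j \<preceq> n" for j
      using ini_rep_mono[OF _ c'] u that leq_add unfolding k'_def by blast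
    ultimately have "\<exists>v. v \<prec> k' \<and> ini k' c' (b j) v" if "j \<preceq> n \<oplus> \<one>" for j
      using that bnd unfolding leq2_def[of j "n \<oplus> \<one>"] less_succ_leq by blast
    then show "\<exists>u. rep X (p1 u) (p2 u) \<and> (\<forall>j. j \<preceq> n \<oplus> \<one> \<longrightarrow> (\<exists>v. v \<prec> p1 u \<and> ini (p1 u) (p2 u) (b j) v))"
      using c' by (intro exI[of _ "pr k' c'"]) simp
  qed
  then obtain k c where kc: "rep X k c" "\<And>j. j \<preceq> n \<Longrightarrow> \<exists>v. ini k c (b j) v" by blast
  have bn: "nxt c (b j) (b (j \<oplus> \<one>))" if j: "j \<oplus> \<one> \<preceq> n" for j
  proof -
    have "j \<preceq> n" using j leq_add(1)[of j \<one>] leq_trans by blast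
    then have "b j \<in> fset2 M c" "b (j \<oplus> \<one>) \<in> fset2 M c" using kc(2) j unfolding ini_def by blast+
    then show ?thesis unfolding nxt_def using nx1 kc(1) unfolding rep_def bs by blast
  qed
  \<comment> \<open>Each stage looks one element further along \<open>b\<close>, so stage
    \<open>i\<close> is claimed at \<open>b j\<close> only while \<open>j \<oplus> i\<close> is at
    most \<open>n\<close>. For \<open>i = n\<close> this leaves \<open>j = \<zero>\<close>, the
    wanted value.\<close>
  let ?P = "\<lambda>i. \<forall>j. j \<preceq> n \<longrightarrow> j \<oplus> i \<preceq> n \<longrightarrow> (\<exists>v. v \<prec> st (pr (pr k c) i) \<and> G k c i (b j) v)"
  have "?P n"
  proof (rule ind[where P = ?P])
    show "dec ?P" by (intro dcf cb cf_comp[OF st_props(1)])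
    show "?P \<zero>" using kc(2) G_bound st_props(2) by blast
    fix i assume IH: "?P i"
    show "?P (i \<oplus> \<one>)"
    proof (intro allI impI)
      fix j assume j: "j \<preceq> n" "j \<oplus> (i \<oplus> \<one>) \<preceq> n"
      have j': "(j \<oplus> \<one>) \<oplus> i \<preceq> n" using j(2) by (simp only: add_ass add_comm[of \<one> i])
      have "j \<oplus> i \<preceq> n" using j(2) leq_add(1)[of "j \<oplus> i" \<one>] leq_trans unfolding add_ass by blast
      then obtain a where a: "G k c i (b j) a" using IH j(1) by blast
      have j1: "j \<oplus> \<one> \<preceq> n" using j' leq_add(1) leq_trans by blast
      then obtain d where d: "G k c i (b (j \<oplus> \<one>)) d" using IH j' by blast
      have "\<not> related M W a d" using G_bad[OF X kc(1) bn[OF j1] a d] .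
      then obtain v where "stp a d v" using stp_exists G_tree a d by blast
      then have "G k c (i \<oplus> \<one>) (b j) v" unfolding st_props(3) using bn[OF j1] a d by blast
      then show "\<exists>v. v \<prec> st (pr (pr k c) (i \<oplus> \<one>)) \<and> G k c (i \<oplus> \<one>) (b j) v" using G_bound by blast
    qed
  qed
  then have "\<exists>v. G k c n (b \<zero>) v" by (metis zero_add ar.order_refl zero_leq)
  then show ?thesis using kc(1) b0 unfolding val_def by blast
qed

text \<open>In one approximation, stage \<open>n \<oplus> \<one>\<close> at \<open>x\<close>
  presupposes stage \<open>n\<close> at \<open>x\<close>, and \<open>stp_leq\<close> compares the
  two values.\<close>

lemma G_decreasing:
  assumes "G k c n x w" "m \<preceq> n" shows "\<exists>v. G k c m x v \<and> w \<preceq> v"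
proof -
  let ?Q = "\<lambda>x w. \<exists>v. v \<prec> st (pr (pr k c) m) \<and> G k c m x v \<and> w \<preceq> v"
  have "m \<preceq> n \<longrightarrow> (\<forall>x w. G k c n x w \<longrightarrow> ?Q x w)"
  proof (rule ind[where P = "\<lambda>n. m \<preceq> n \<longrightarrow> (\<forall>x w. G k c n x w \<longrightarrow> ?Q x w)"])
    show "dec (\<lambda>n. m \<preceq> n \<longrightarrow> (\<forall>x w. G k c n x w \<longrightarrow> ?Q x w))"
      by (intro dec_ball_G[where P = "\<lambda>n. ?Q"] dcf cf_comp[OF st_props(1)])
    show "m \<preceq> \<zero> \<longrightarrow> (\<forall>x w. G k c \<zero> x w \<longrightarrow> ?Q x w)"
    proof (intro impI allI)
      fix x w assume "m \<preceq> \<zero>" "G k c \<zero> x w"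
      then have "G k c m x w" by (simp add: leq2_def)
      then show "?Q x w" using G_bound ar.order_refl by blast
    qed
    fix n assume IH: "m \<preceq> n \<longrightarrow> (\<forall>x w. G k c n x w \<longrightarrow> ?Q x w)"
    show "m \<preceq> n \<oplus> \<one> \<longrightarrow> (\<forall>x w. G k c (n \<oplus> \<one>) x w \<longrightarrow> ?Q x w)"
    proof (intro allI impI)
      fix x w assume m: "m \<preceq> n \<oplus> \<one>" and w: "G k c (n \<oplus> \<one>) x w"
      show "?Q x w"
      proof (cases "m = n \<oplus> \<one>")
        case True
        then show ?thesis using w G_bound ar.order_refl by blast
      next
        case False
        then have mn: "m \<preceq> n" using m unfolding leq2_def[of m "n \<oplus> \<one>"] less_succ_leq by blast
        obtain a where "G k c n x a" "w \<preceq> a" using w stp_leq unfolding st_props(3) by blast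
        then show ?thesis using IH mn leq_trans by blast
      qed
    qed
  qed
  then show ?thesis using assms by blast
qed

text \<open>The limit is the least value attained at any stage: later values are at most this one by
  \<open>G_decreasing\<close> and not smaller by minimality. The witness \<open>u\<close> of
  attainment combines a stage with an approximation.\<close>

lemma val_limit:
  assumes X: "X \<in> inf_sets M" and x: "x \<in> X"
  obtains m v where "\<forall>n w. m \<preceq> n \<longrightarrow> val X n x w \<longrightarrow> w = v"
proof -
  have sX: "X \<in> sets2 M" using X by (rule inf_setsD)
  let ?P = "\<lambda>v u. rep X (p1 (p2 u)) (p2 (p2 u)) \<and> G (p1 (p2 u)) (p2 (p2 u)) (p1 u) x v"
  have P: "(\<exists>u. ?P v u) \<longleftrightarrow> (\<exists>m. val X m x v)" for v
  proof
    assume "\<exists>m. val X m x v"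
    then obtain m k c where "rep X k c" "G k c m x v" unfolding val_def by blast
    then show "\<exists>u. ?P v u" by (intro exI[of _ "pr m (pr k c)"]) simp
  qed (auto simp: val_def)
  have "dec (\<lambda>z. ?P (p1 z) (p2 z))" by (intro dcf sX)
  moreover obtain v0 u0 where "?P v0 u0" using val_total[OF X x] P by blast
  ultimately have "\<exists>v. (\<exists>u. ?P v u) \<and> (\<forall>w u. w \<prec> v \<longrightarrow> \<not> ?P w u)"
    by (rule least_sigma[where P = ?P])
  then obtain v where "\<exists>u. ?P v u" and vmin: "\<And>w u. w \<prec> v \<Longrightarrow> \<not> ?P w u" by blast
  then obtain m where m: "val X m x v" using P by blast
  have "w = v" if n: "m \<preceq> n" and w: "val X n x w" for n w
  proof -
    have "\<not> w \<prec> v" using vmin w P by blast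
    moreover obtain k c where kc: "rep X k c" "G k c n x w" using w unfolding val_def by blast
    then obtain v' where "G k c m x v'" "w \<preceq> v'" using G_decreasing n by blast
    moreover from this have "v' = v" using val_unique m kc(1) unfolding val_def by blast
    ultimately show ?thesis unfolding leq2_def by blast
  qed
  with that show ?thesis by blast
qed

section \<open>The limit label\<close>

definition lmin :: "'a \<Rightarrow> 'a \<Rightarrow> bool" where
  "lmin c x \<longleftrightarrow> x \<in> fset2 M c \<and> (\<forall>i\<in>fset2 M c. x \<preceq> i)"

text \<open>Only universal quantifiers follow \<open>N\<close>. Asking for an approximation that
  shows the label would add a quantifier alternation. The least element, too, is read off the
  approximation.\<close>

definition limit_label :: "'a set \<Rightarrow> 'a \<Rightarrow> bool" where
  "limit_label X q \<longleftrightarrow> (\<exists>N. \<forall>n k c x v. N \<preceq> n \<longrightarrow> rep X k c \<longrightarrow> lmin c x \<longrightarrow> G k c n x v \<longrightarrow> p1 v = q)"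

definition F :: "'a set \<Rightarrow> 'a" where "F X = (THE q. limit_label X q)"

text \<open>A nonempty part of \<open>X\<close> below \<open>k\<close> contains the least element of
  \<open>X\<close>, so no approximation shows a wrong one.\<close>

lemma lmin_rep:
  assumes "rep X k c" "x \<in> X" "\<forall>y\<in>X. x \<preceq> y" shows "lmin c z \<Longrightarrow> z = x" "x \<in> fset2 M c \<Longrightarrow> lmin c x"
proof -
  show "x \<in> fset2 M c \<Longrightarrow> lmin c x" using assms unfolding lmin_def rep_def by blast
  assume z: "lmin c z"
  then have "x \<preceq> z" "z \<prec> k" "z \<in> X" using assms unfolding lmin_def rep_def by blast+
  then have "x \<in> fset2 M c" using assms ar.le_less_trans unfolding rep_def by blast
  then have "z \<preceq> x" using z unfolding lmin_def by blast
  with \<open>x \<preceq> z\<close> show "z = x" by (rule ar.order_antisym[rotated])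
qed

lemma limit_label_val:
  assumes X: "X \<in> inf_sets M" and x: "x \<in> X" "\<forall>y\<in>X. x \<preceq> y"
  shows "limit_label X q \<longleftrightarrow> (\<exists>N. \<forall>n v. N \<preceq> n \<longrightarrow> val X n x v \<longrightarrow> p1 v = q)"
proof -
  have "(\<forall>k c z v. rep X k c \<longrightarrow> lmin c z \<longrightarrow> G k c n z v \<longrightarrow> p1 v = q) \<longleftrightarrow>
      (\<forall>v. val X n x v \<longrightarrow> p1 v = q)" for n
    unfolding val_def using lmin_rep[OF _ x] G_in by metis
  then show ?thesis unfolding limit_label_def by (metis (no_types, lifting))
qed

lemma F_iff:
  assumes X: "X \<in> inf_sets M" and x: "x \<in> X" "\<forall>y\<in>X. x \<preceq> y" and lim: "\<forall>n w. m \<preceq> n \<longrightarrow> val X n x w \<longrightarrow> w = v"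
  shows "limit_label X q \<longleftrightarrow> q = p1 v" "F X = p1 v"
proof -
  show *: "limit_label X q \<longleftrightarrow> q = p1 v" for q
  proof
    assume "limit_label X q"
    then obtain N where N: "\<forall>n v. N \<preceq> n \<longrightarrow> val X n x v \<longrightarrow> p1 v = q"
      using limit_label_val[OF X x] by blast
    \<comment> \<open>This stage is beyond both thresholds, and its value rules out that
      \<open>limit_label\<close> holds vacuously.\<close>
    obtain w where w: "val X (N \<oplus> m) x w" using val_total[OF X x(1)] by blast
    then have "w = v" using lim leq_add(2) by blast
    with w show "q = p1 v" using N leq_add(1) by blast
  next
    assume "q = p1 v"
    then show "limit_label X q" using limit_label_val[OF X x] lim by blast
  qed
  show "F X = p1 v" unfolding F_def by (rule the_equality) (use * in blast)+
qed

lemma F_label: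
  assumes "X \<in> inf_sets M" shows "F X \<in> Q" "F X = q \<longleftrightarrow> limit_label X q"
proof -
  obtain x where x: "x \<in> X" "\<forall>y\<in>X. x \<preceq> y" using inf_set_min[OF assms] by blast
  obtain m v where lim: "\<forall>n w. m \<preceq> n \<longrightarrow> val X n x w \<longrightarrow> w = v" using val_limit[OF assms x(1)] by blast
  obtain w where w: "val X m x w" using val_total[OF assms x(1)] by blast
  then have "v \<in> T" using lim ar.order_refl G_tree unfolding val_def by blast
  then show "F X \<in> Q" using F_iff(2)[OF assms x lim] tree_label by simp
  show "F X = q \<longleftrightarrow> limit_label X q" using F_iff[OF assms x lim] by auto
qed

lemma F_bad: "bad_function M R F"
  unfolding bad_function_def
proof (rule notI, elim bexE)
  fix X assume X: "X \<in> inf_sets M" and rel: "related M R (F X) (F (tail2 M X))"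
  let ?Y = "tail2 M X"
  have Y: "?Y \<in> inf_sets M" using X by (rule tail2_inf)
  obtain x where x: "x \<in> X" "\<forall>y\<in>X. x \<preceq> y" using inf_set_min[OF X] by blast
  obtain y where y: "y \<in> ?Y" "\<forall>z\<in>?Y. y \<preceq> z" using inf_set_min[OF Y] by blast
  have Y_iff: "z \<in> ?Y \<longleftrightarrow> z \<in> X \<and> x \<prec> z" for z
    unfolding tail2_def using x ar.le_less_trans by blast
  have Y_iff': "z \<in> ?Y \<longleftrightarrow> z \<in> X \<and> y \<preceq> z" for z
    using y Y_iff ar.less_le_trans by blast
  obtain m v where lim: "\<forall>n w. m \<preceq> n \<longrightarrow> val X n x w \<longrightarrow> w = v" using val_limit[OF X x(1)] by blast
  obtain m' v' where lim': "\<forall>n w. m' \<preceq> n \<longrightarrow> val ?Y n y w \<longrightarrow> w = v'" using val_limit[OF Y y(1)] by blast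
  let ?n = "m \<oplus> m'"
  \<comment> \<open>At stage \<open>?n\<close> both sequences have settled. The value at
    \<open>x\<close> is \<open>v\<close> there and also one stage later, so this step maps
    \<open>v\<close> to itself and \<open>stp_fixed\<close> applies.\<close>
  obtain u where "val X (?n \<oplus> \<one>) x u" using val_total[OF X x(1)] by blast
  then obtain k c z a b where kc: "rep X k c" "nxt c x z" "G k c ?n x a" "G k c ?n z b" "stp a b u"
    unfolding val_def st_props(3) by blast
  have "m \<preceq> ?n" "m \<preceq> ?n \<oplus> \<one>" "m' \<preceq> ?n" using leq_add leq_trans by blast+
  then have "a = v" "u = v"
    using lim \<open>val X (?n \<oplus> \<one>) x u\<close> kc(1,3) unfolding val_def by blast+
  have "z = y"
    using nxt_rep[OF kc(1,2)] y Y_iff by (meson ar.order_antisym)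
  obtain w where w: "val ?Y ?n y w" using val_total[OF Y y(1)] by blast
  then have "w = v'" using lim' \<open>m' \<preceq> ?n\<close> by blast
  obtain k' c' where kc': "rep ?Y k' c'" "G k' c' ?n y w" using w unfolding val_def by blast
  \<comment> \<open>The value for \<open>?Y\<close> is transferred to an approximation of
    \<open>X\<close>, so that it can be identified with \<open>b\<close>.\<close>
  obtain c'' where c'': "rep X k' c''" using rep_exists inf_setsD(1)[OF X] by blast
  have "G k' c'' ?n y w"
    using kc' c'' Y_iff' by (intro G_mono[OF kc'(2), where l = y]) (auto simp: rep_def)
  then have "b = w" using val_unique[of X ?n y] c'' kc(1,4) \<open>z = y\<close> unfolding val_def by blast
  then have "\<not> related M R (p1 v) (p1 v')"
    using stp_fixed[of v v'] kc(3,5) G_tree \<open>a = v\<close> \<open>u = v\<close> \<open>w = v'\<close> by blast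
  then show False using rel F_iff(2)[OF X x lim] F_iff(2)[OF Y y lim'] by simp
qed

text \<open>The universal variable of the formula is \<open>u = ((k, c), n)\<close>, and its premise says \<open>X \<inter> [0, k) = c \<inter> [0, k)\<close>.\<close>

lemma F_Delta02: "Delta02_function M Q F"
proof -
  define D1 where "D1 = {z. p2 z \<prec> p1 (p1 (p1 z))}"
  define D2 where "D2 = {z. p2 z \<in> fset2 M (p2 (p1 (p1 z)))}"
  \<comment> \<open>The comparison with \<open>X\<close> is left to the formula. This is the half of
    \<open>rep X k c\<close> without \<open>X\<close>, followed by the rest of
    \<open>limit_label\<close>.\<close>
  define ok where "ok N k c n q \<longleftrightarrow> (\<forall>i\<in>fset2 M c. i \<prec> k) \<longrightarrow> N \<preceq> n \<longrightarrow>
      (\<forall>x v. G k c n x v \<longrightarrow> lmin c x \<longrightarrow> p1 v = q)" for N k c n q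
  define A where "A = {z. ok (p1 z) (p1 (p1 (p1 (p2 z)))) (p2 (p1 (p1 (p2 z)))) (p2 (p1 (p2 z))) (p2 (p2 z))}"
  have "dec (\<lambda>z. p2 z \<prec> p1 (p1 (p1 z)))" "dec (\<lambda>z. p2 z \<in> fset2 M (p2 (p1 (p1 z))))" by (intro dcf)+
  moreover have "dec (\<lambda>z. ok (p1 z) (p1 (p1 (p1 (p2 z)))) (p2 (p1 (p1 (p2 z)))) (p2 (p1 (p2 z))) (p2 (p2 z)))"
    unfolding ok_def lmin_def
    by (intro dcf dec_ball_G[where P = "\<lambda>z x v. x \<in> fset2 M (p2 (p1 (p1 (p2 z)))) \<and>
      (\<forall>i\<in>fset2 M (p2 (p1 (p1 (p2 z)))). x \<preceq> i) \<longrightarrow> p1 v = p2 (p2 z)"])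
  ultimately have sets: "D1 \<in> sets2 M" "D2 \<in> sets2 M" "A \<in> sets2 M"
    unfolding D1_def D2_def A_def dec_def by blast+
  \<comment> \<open>Decoding is not a term, so tests on the parts of \<open>u\<close> are absorbed
    into the set parameters \<open>D1\<close>, \<open>D2\<close> and \<open>A\<close>, and
    \<open>i\<close> is bounded by \<open>u\<close> instead of \<open>k\<close>. Number variables 0
    to 3 are \<open>N\<close>, \<open>u\<close>, \<open>i\<close>, \<open>q\<close>; set variable 0
    is \<open>X\<close>.\<close>
  define \<theta> where "\<theta> = FImp
    (blt 2 1 (FImp (FMem (tpair (TVar 1) (TVar 2)) 1)
      (FAnd (FImp (FMem (TVar 2) 0) (FMem (tpair (TVar 1) (TVar 2)) 2))
        (FImp (FMem (tpair (TVar 1) (TVar 2)) 2) (FMem (TVar 2) 0)))))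
    (FMem (tpair (TVar 0) (tpair (TVar 1) (TVar 3))) 3)"
  define E :: "nat \<Rightarrow> 'a set" where "E = (\<lambda>i. if i = 1 then D1 else if i = 2 then D2 else A)"
  have "bounded_form \<theta>" unfolding \<theta>_def by (auto intro!: bf bf_blt)
  then have "Sigma02 (FEx 0 (FAll 1 \<theta>))" unfolding Sigma02_def by blast
  moreover have "range E \<subseteq> sets2 M" using sets unfolding E_def by auto
  moreover have "F X = q \<longleftrightarrow> sat M ((\<lambda>_. \<zero>)(3 := q)) (E(0 := X)) (FEx 0 (FAll 1 \<theta>))"
    if X: "X \<in> inf_sets M" for X q
  proof -
    have "sat M ((\<lambda>_. \<zero>)(3 := q)) (E(0 := X)) (FEx 0 (FAll 1 \<theta>)) \<longleftrightarrow>
      (\<exists>N. \<forall>u. (\<forall>i. i \<prec> u \<longrightarrow> i \<prec> p1 (p1 u) \<longrightarrow> (i \<in> X \<longleftrightarrow> i \<in> fset2 M (p2 (p1 u)))) \<longrightarrow> ok N (p1 (p1 u)) (p2 (p1 u)) (p2 u) q)"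
      unfolding \<theta>_def E_def D1_def D2_def A_def by (simp add: iff_conv_conj_imp)
    also have "\<dots> \<longleftrightarrow> (\<exists>N. \<forall>u. (\<forall>i. i \<prec> p1 (p1 u) \<longrightarrow> (i \<in> X \<longleftrightarrow> i \<in> fset2 M (p2 (p1 u)))) \<longrightarrow> ok N (p1 (p1 u)) (p2 (p1 u)) (p2 u) q)"
    proof -
      have "i \<prec> u" if "i \<prec> p1 (p1 u)" for i u
        using that p1_leq leq_trans ar.less_le_trans by blast
      then show ?thesis by (metis (no_types, lifting))
    qed
    also have "\<dots> \<longleftrightarrow> (\<exists>N. \<forall>n k c. (\<forall>i. i \<prec> k \<longrightarrow> (i \<in> X \<longleftrightarrow> i \<in> fset2 M c)) \<longrightarrow> ok N k c n q)"
      using p1_pr p2_pr by metis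
    also have "\<dots> \<longleftrightarrow> limit_label X q"
    proof -
      have "((\<forall>i. i \<prec> k \<longrightarrow> (i \<in> X \<longleftrightarrow> i \<in> fset2 M c)) \<longrightarrow> ok N k c n q) \<longleftrightarrow>
        (\<forall>x v. N \<preceq> n \<longrightarrow> rep X k c \<longrightarrow> lmin c x \<longrightarrow> G k c n x v \<longrightarrow> p1 v = q)" for N n k c
      proof -
        have "rep X k c \<longleftrightarrow> (\<forall>i. i \<prec> k \<longrightarrow> (i \<in> X \<longleftrightarrow> i \<in> fset2 M c)) \<and> (\<forall>i\<in>fset2 M c. i \<prec> k)"
          unfolding rep_def by blast
        then show ?thesis unfolding ok_def by auto
      qed
      then show ?thesis unfolding limit_label_def by simp
    qed
    finally show ?thesis using F_label(2)[OF X] by blast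
  qed
  ultimately show ?thesis using F_label(1) unfolding Delta02_function_def by blast
qed

end

lemma (in weak_trees) weak_trees_bqo:
  assumes "Delta02_BQO M Q R" shows "BQO M T W"
proof (rule ccontr)
  assume "\<not> BQO M T W"
  then obtain B f where B: "barrier2 M B" "function2 M f B T"
    and bad: "\<And>s t p q. s \<in> B \<Longrightarrow> t \<in> B \<Longrightarrow> shift_rel M s t \<Longrightarrow> pr s p \<in> f \<Longrightarrow> pr t q \<in> f \<Longrightarrow> \<not> related M W p q"
    unfolding BQO_def using W_quasi_order by blast
  have "B \<in> sets2 M" "unbounded2 M (base2 M B)" using B(1) unfolding barrier2_def block2_def by blast+
  then obtain e where "cf e" "\<forall>n. e n \<in> base2 M B" "\<forall>x y. x \<prec> y \<longrightarrow> e x \<prec> e y"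
    by (rule increasing_enumeration)
  then interpret bad_array M Q R T W B f e using B bad by unfold_locales blast+
  show False using assms F_Delta02 F_bad unfolding Delta02_BQO_def by blast
qed

theorem theorem3p13:
  fixes M :: "'a L2_structure" and Q R :: "'a set"
  assumes "RCA0_model M"
    and "quasi_order M Q R"
    and "Delta02_BQO M Q R"
  shows "weak_trees_BQO M Q R"
proof -
  interpret rca0 M using assms(1) by unfold_locales
  have "Q \<in> sets2 M" "R \<in> sets2 M" using assms(2) unfolding quasi_order_def by blast+
  then have "\<exists>T W. weak_tree_quasi_order M Q R T W"
    unfolding weak_tree_quasi_order_def using tree_set_exists weak_tree_order_exists by blast
  moreover have "BQO M T W" if "weak_tree_quasi_order M Q R T W" for T W
  proof -
    interpret weak_trees M Q R T W
      using assms(2) that unfolding weak_tree_quasi_order_def by unfold_locales blast+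
    show ?thesis using assms(3) by (rule weak_trees_bqo)
  qed
  ultimately show ?thesis unfolding weak_trees_BQO_def by blast
qed
end
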